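(* Let $\beta>0$ and let $V,W\colon\mathbb T^d\to\mathbb R$ satisfy: (i) $V,W\in\mathcal C^2(\mathbb T^d)$; (ii) $W$ is even; (iii) $W$ is either $H$-stable (i.e. it has nonnegative Fourier modes) or satisfies $\|W\|_{L^\infty(\mathbb T^d)}<\beta^{-1}$. Then the invariant measure $d\mu_\infty(x)=f_\infty(x)\,dx$ of the McKean dynamics on $\mathbb T^d$ satisfies an LSI with constant $\Gamma/(2\pi^2)$, where $$\Gamma=e^{2\beta\left(\|V\|_{L^\infty(\mathbb T^d)}+\|W\|_{L^\infty(\mathbb T^d)}\right)}.$$
   Context: $\mathbb T^d$ is the $d$-dimensional torus of side length $1$. The McKean dynamics on $\mathbb T^d$ is $dX_t=-\nabla V(X_t)\,dt-(\nabla W*f_t)(X_t)\,dt+\sqrt{2\beta^{-1}}\,dB_t$, with $f_t$ the density of the law of $X_t$. Under the stated hypotheses it has a unique invariant measure $\mu_\infty$, whose density $f_\infty$ is the unique probability density on $\mathbb T^d$ solving $f_\infty=\frac1Ze^{-\beta(V+W*f_\infty)}$, $Z=\int_{\mathbb T^d}e^{-\beta(V+W*f_\infty)}$. For probability measures with $\mu\ll\nu$: $\mathcal H(\mu|\nu)=\int\log\left(\frac{d\mu}{d\nu}\right)d\mu$, $\mathcal I(\mu|\nu)=\int\left|\nabla\log\frac{d\mu}{d\nu}\right|^2d\mu$. A measure $\nu$ satisfies an LSI with constant $\lambda>0$ if $\mathcal H(\mu|\nu)\le\frac\lambda4\mathcal I(\mu|\nu)$ for all probability measures $\mu\ll\nu$.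 *)

theory Defs
  imports "HOL-Probability.Probability"
begin

section \<open>Functions and measures on the torus\<close>

text \<open>
  Functions on the torus \<open>\<real>\<^sup>d / \<int>\<^sup>d\<close> are functions on \<open>real ^ 'd\<close> that are 1-periodic in
  every coordinate. Measures on the torus are Borel measures on the half-open unit cube, which
  contains exactly one point of every class; the measure \<open>torus\<close> is the normalised Haar measure.
\<close>

definition unit_cube :: "(real ^ 'd) set" where
  "unit_cube = {x. \<forall>i. 0 \<le> x $ i \<and> x $ i < 1}"

definition torus :: "(real ^ 'd) measure" where
  "torus = restrict_space lborel unit_cube"

definition torus_proj :: "real ^ 'd \<Rightarrow> real ^ 'd" where
  "torus_proj x = (\<chi> i. frac (x $ i))"

definition periodic :: "(real ^ 'd \<Rightarrow> 'b) \<Rightarrow> bool" where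
  "periodic f \<longleftrightarrow> (\<forall>x i. f (x + axis i 1) = f x)"

definition partial :: "'d \<Rightarrow> (real ^ 'd \<Rightarrow> real) \<Rightarrow> real ^ 'd \<Rightarrow> real" where
  "partial i f x = frechet_derivative f (at x) (axis i 1)"

definition grad :: "(real ^ 'd \<Rightarrow> real) \<Rightarrow> real ^ 'd \<Rightarrow> real ^ 'd" where
  "grad f x = (\<chi> i. partial i f x)"

primrec Ck :: "nat \<Rightarrow> (real ^ 'd \<Rightarrow> real) \<Rightarrow> bool" where
  "Ck 0 f \<longleftrightarrow> continuous_on UNIV f"
| "Ck (Suc k) f \<longleftrightarrow> (\<forall>x. f differentiable (at x)) \<and> (\<forall>i. Ck k (partial i f))"

definition torus_Ck :: "nat \<Rightarrow> (real ^ 'd \<Rightarrow> real) \<Rightarrow> bool" where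
  "torus_Ck k f \<longleftrightarrow> periodic f \<and> Ck k f"

definition torus_smooth :: "(real ^ 'd \<Rightarrow> real) \<Rightarrow> bool" where
  "torus_smooth f \<longleftrightarrow> (\<forall>k. torus_Ck k f)"

definition Linf_norm :: "(real ^ 'd \<Rightarrow> real) \<Rightarrow> real" where
  "Linf_norm f = real_of_ereal (esssup torus (\<lambda>x. ereal \<bar>f x\<bar>))"

definition fourier_mode :: "(real ^ 'd \<Rightarrow> real) \<Rightarrow> int ^ 'd \<Rightarrow> complex" where
  "fourier_mode f k =
     (\<integral>x. of_real (f x) * cis (- 2 * pi * (\<Sum>i\<in>UNIV. of_int (k $ i) * x $ i)) \<partial>torus)"

definition H_stable :: "(real ^ 'd \<Rightarrow> real) \<Rightarrow> bool" where
  "H_stable W \<longleftrightarrow> (\<forall>k. fourier_mode W k \<in> \<real>\<^sub>\<ge>\<^sub>0)"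


section \<open>The McKean dynamics and its invariant measures\<close>

text \<open>
  Brownian motion with respect to a filtration, started at 0. Only the times \<open>t \<ge> 0\<close> matter.
\<close>

definition brownian_motion ::
  "'w measure \<Rightarrow> (real \<Rightarrow> 'w measure) \<Rightarrow> (real \<Rightarrow> 'w \<Rightarrow> real ^ 'd) \<Rightarrow> bool" where
  "brownian_motion M F B \<longleftrightarrow>
     (\<forall>t\<ge>0. B t \<in> borel_measurable (F t)) \<and>
     (AE \<omega> in M. B 0 \<omega> = 0) \<and>
     (AE \<omega> in M. continuous_on {0..} (\<lambda>t. B t \<omega>)) \<and>
     (\<forall>s\<ge>0. \<forall>t>s.
        distributed M lborel (\<lambda>\<omega>. B t \<omega> - B s \<omega>)
          (\<lambda>x. ennreal (\<Prod>i\<in>UNIV. normal_density 0 (sqrt (t - s)) (x $ i))) \<and>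
        prob_space.indep_set M (sets (F s))
          {(\<lambda>\<omega>. B t \<omega> - B s \<omega>) -` A \<inter> space M | A. A \<in> sets borel})"

definition torus_law :: "'w measure \<Rightarrow> ('w \<Rightarrow> real ^ 'd) \<Rightarrow> (real ^ 'd) measure" where
  "torus_law M Y = distr M torus (\<lambda>\<omega>. torus_proj (Y \<omega>))"

text \<open>
  The drift \<open>- \<nabla>V - \<nabla>W * \<mu>\<close>. The convolution is with the measure \<open>\<mu>\<close>; if \<open>\<mu>\<close> has density \<open>f\<close>
  with respect to \<open>torus\<close>, it is the convolution \<open>\<nabla>W * f\<close> of functions on the torus.
\<close>

definition mckean_drift ::
  "(real ^ 'd \<Rightarrow> real) \<Rightarrow> (real ^ 'd \<Rightarrow> real) \<Rightarrow> (real ^ 'd) measure \<Rightarrow> real ^ 'd \<Rightarrow> real ^ 'd" where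
  "mckean_drift V W \<mu> x = - grad V x - (\<integral>y. grad W (x - y) \<partial>\<mu>)"

text \<open>
  (Weak) solutions of the McKean equation. The process on the torus is represented by a
  continuous lift \<open>X\<close> to \<open>real ^ 'd\<close>: the drift is periodic and depends only on the law of the
  projection of \<open>X\<close>. As the noise is additive, the equation in integral form contains no
  stochastic integral.
\<close>

definition mckean_process ::
  "'w measure \<Rightarrow> (real \<Rightarrow> 'w measure) \<Rightarrow> (real \<Rightarrow> 'w \<Rightarrow> real ^ 'd) \<Rightarrow>
   real \<Rightarrow> (real ^ 'd \<Rightarrow> real) \<Rightarrow> (real ^ 'd \<Rightarrow> real) \<Rightarrow> (real \<Rightarrow> 'w \<Rightarrow> real ^ 'd) \<Rightarrow> bool" where
  "mckean_process M F B \<beta> V W X \<longleftrightarrow>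
     prob_space M \<and> filtration (space M) F \<and> (\<forall>t. sets (F t) \<subseteq> sets M) \<and>
     brownian_motion M F B \<and>
     (\<forall>t\<ge>0. X t \<in> borel_measurable (F t)) \<and>
     (AE \<omega> in M. continuous_on {0..} (\<lambda>t. X t \<omega>)) \<and>
     (AE \<omega> in M. \<forall>t\<ge>0.
        ((\<lambda>s. mckean_drift V W (torus_law M (X s)) (X s \<omega>)) has_integral
           (X t \<omega> - X 0 \<omega> - sqrt (2 / \<beta>) *\<^sub>R B t \<omega>)) {0..t})"

text \<open>
  A measure is invariant if some solution of the McKean equation has it as its law at all times.
  HOL cannot quantify over types inside a formula, so the type of the sample space is an
  argument; a theorem that leaves this type free covers solutions on arbitrary probability spaces.
\<close>

definition mckean_invariant_measure ::
  "'w itself \<Rightarrow> real \<Rightarrow> (real ^ 'd \<Rightarrow> real) \<Rightarrow> (real ^ 'd \<Rightarrow> real) \<Rightarrow> (real ^ 'd) measure \<Rightarrow> bool" where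
  "mckean_invariant_measure (_ :: 'w itself) \<beta> V W \<mu> \<longleftrightarrow>
     (\<exists>(M :: 'w measure) F B X.
        mckean_process M F B \<beta> V W X \<and> (\<forall>t\<ge>0. torus_law M (X t) = \<mu>))"


section \<open>Logarithmic Sobolev inequalities on the torus\<close>

text \<open>
  The case distinction is needed because the Bochner integral of a non-integrable function is 0.
  For probability measures \<open>\<mu> \<ll> \<nu>\<close> the negative part of \<open>log (d\<mu>/d\<nu>)\<close> is always
  \<open>\<mu>\<close>-integrable, so the value is then really \<open>\<infinity>\<close>.
\<close>

definition relative_entropy :: "'a measure \<Rightarrow> 'a measure \<Rightarrow> ereal" where
  "relative_entropy \<mu> \<nu> =
     (if integrable \<mu> (\<lambda>x. ln (enn2real (RN_deriv \<nu> \<mu> x)))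
      then ereal (\<integral>x. ln (enn2real (RN_deriv \<nu> \<mu> x)) \<partial>\<mu>) else \<infinity>)"

definition weak_gradient :: "(real ^ 'd \<Rightarrow> real) \<Rightarrow> (real ^ 'd \<Rightarrow> real ^ 'd) \<Rightarrow> bool" where
  "weak_gradient h G \<longleftrightarrow>
     integrable torus h \<and> integrable torus G \<and>
     (\<forall>\<phi>. torus_smooth \<phi> \<longrightarrow> (\<integral>x. h x *\<^sub>R grad \<phi> x \<partial>torus) = - (\<integral>x. \<phi> x *\<^sub>R G x \<partial>torus))"

text \<open>
  \<open>v = \<nabla> log h\<close> for a nonnegative density \<open>h\<close> that need not be smooth or bounded away from 0, so
  that \<open>log h\<close> itself need not be locally integrable: the weak form of \<open>\<nabla>h = h \<nabla> log h\<close>. It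
  determines \<open>v\<close> almost everywhere on \<open>{h > 0}\<close>.
\<close>

definition log_gradient :: "(real ^ 'd \<Rightarrow> real) \<Rightarrow> (real ^ 'd \<Rightarrow> real ^ 'd) \<Rightarrow> bool" where
  "log_gradient h v \<longleftrightarrow> v \<in> borel_measurable torus \<and> weak_gradient h (\<lambda>x. h x *\<^sub>R v x)"

text \<open>
  For \<open>\<mu> \<ll> \<nu> \<ll> torus\<close> the logarithmic gradient is unique \<open>\<mu>\<close>-almost everywhere, so the infimum
  runs over at most one value; it is \<open>\<infinity>\<close> if there is no logarithmic gradient.
\<close>

definition fisher_information :: "(real ^ 'd) measure \<Rightarrow> (real ^ 'd) measure \<Rightarrow> ennreal" where
  "fisher_information \<mu> \<nu> =
     (INF v \<in> {v. log_gradient (\<lambda>x. enn2real (RN_deriv \<nu> \<mu> x)) v}.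
        \<integral>\<^sup>+ x. ennreal ((norm (v x))\<^sup>2) \<partial>\<mu>)"

definition satisfies_LSI :: "(real ^ 'd) measure \<Rightarrow> real \<Rightarrow> bool" where
  "satisfies_LSI \<nu> c \<longleftrightarrow>
     0 < c \<and>
     (\<forall>\<mu>. prob_space \<mu> \<and> sets \<mu> = sets \<nu> \<and> absolutely_continuous \<nu> \<mu> \<longrightarrow>
        relative_entropy \<mu> \<nu> \<le> ereal (c / 4) * enn2ereal (fisher_information \<mu> \<nu>))"

end

theory Submission
  imports Defs
begin

text \<open>
  An invariant measure \<open>\<mu>\<close> of the dynamics is stationary for the linear diffusion with drift \<open>- \<nabla>U\<close>,
  where \<open>U = V + W * \<mu>\<close>. Comparing increments of the process for small times gives
  \<open>\<integral> (\<beta>\<^sup>-\<^sup>1 \<Delta>\<psi> - \<nabla>U \<bullet> \<nabla>\<psi>) d\<mu> = 0\<close> for trigonometric polynomials \<open>\<psi>\<close>. Mollify \<open>\<mu>\<close> to a density \<open>f\<close>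
  and test this equation with a mollification of \<open>log f + \<beta> U\<close>: the Fisher information of \<open>f\<close>
  relative to \<open>exp (- \<beta> U)\<close> is bounded by a commutator that vanishes in the limit. So
  \<open>\<nabla>\<mu> + \<beta> \<mu> \<nabla>U = 0\<close> weakly, all nonconstant Fourier modes of \<open>exp (\<beta> U) \<mu>\<close> vanish, and \<open>\<mu>\<close> has the
  density \<open>c exp (- \<beta> U)\<close>. Since \<open>\<bar>U\<bar> \<le> \<parallel>V\<parallel> + \<parallel>W\<parallel>\<close>, the Holley-Stroock argument reduces the claim to
  the LSI of the Haar measure with the constant \<open>1 / (2 \<pi>\<^sup>2)\<close>.

  For the Haar measure, the Bakry-Emery argument along the heat flow needs the inequality
  \<open>4 \<pi>\<^sup>2 \<integral> u'\<^sup>2 / u \<le> \<integral> u (log u)''\<^sup>2\<close> on the circle, which for \<open>u = v\<^sup>2\<close> follows from Wirtinger's inequality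
  for \<open>v'\<close>. It is applied to positive trigonometric polynomials, on which the heat flow is explicit;
  general densities are reached by mollification, convexity of the Fisher information and lower
  semicontinuity of the entropy.
\<close>

section \<open>Functions on the torus\<close>

subsection \<open>Periodicity\<close>

text \<open>An invariant measure is given only as the law of a process and may a priori be singular,
  so integration by parts against its density becomes possible only after mollification. All
  mollifiers are trigonometric polynomials: the convolution with any finite measure is then a finite
  sum of cosines, for which derivatives, heat flow and interchange of integrals are finite linear
  algebra.

  The flat torus has no positive curvature, so the Hessian term of the Bakry-Emery computation has
  no useful pointwise lower bound. The spectral gap 4 pi^2 of the circle enters in integrated form,
  on each coordinate line separately, which makes the constant independent of the dimension: H is at
  most I / (8 pi^2), a quarter of 1 / (2 pi^2) times I. The factor \<open>\<Gamma>\<close> is the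
  quotient of the bounds c exp (\<beta> N) and c exp (- \<beta> N) of the Gibbs density, where N is
  the sum of the two norms.

  The competing densities in the inequality are merely integrable and may vanish. Their entropy is
  bounded through its dual formula, which is linear in the density and passes to weak
  limits.\<close>

lemma periodic_shift_int:
  assumes "periodic f"
  shows "f (x + axis i (of_int m)) = f x"
proof -
  have nat: "f (y + axis i (of_nat n)) = f y" for n y
  proof (induction n arbitrary: y)
    case 0
    then show ?case by (simp add: axis_def vec_eq_iff cong: if_cong) (metis add.right_neutral zero_vec_def zero_index)
  next
    case (Suc n)
    have "y + axis i (of_nat (Suc n)) = (y + axis i (of_nat n)) + axis i 1"
      by (simp add: axis_def vec_eq_iff)
    then show ?case using Suc assms by (metis periodic_def)
  qed
  show ?thesis
  proof (cases "m \<ge> 0")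
    case True
    then show ?thesis using nat[of x "nat m"] by simp
  next
    case False
    have "x = x + axis i (of_int m) + axis i (of_nat (nat (- m)))"
      using False by (auto simp: axis_def vec_eq_iff)
    then show ?thesis using nat[of "x + axis i (of_int m)" "nat (-m)"] by metis
  qed
qed

lemma periodic_shift_Ints:
  assumes "periodic f" "\<And>i. z $ i \<in> \<int>"
  shows "f (x + z) = f x"
proof -
  have "f (x + (\<Sum>i\<in>I. axis i (z $ i))) = f x" if "finite I" for I
    using that
  proof (induction I)
    case (insert i I)
    obtain m where m: "z $ i = of_int m" using assms(2) Ints_cases by blast
    have "f (x + (\<Sum>i\<in>insert i I. axis i (z $ i))) = f ((x + (\<Sum>i\<in>I. axis i (z $ i))) + axis i (of_int m))"
      using insert m by (simp add: add.commute add.left_commute)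
    then show ?case using periodic_shift_int[OF assms(1)] insert by metis
  qed simp
  from this[of UNIV] have "f (x + (\<Sum>i\<in>UNIV. axis i (z $ i))) = f x" by simp
  moreover have "(\<Sum>i\<in>UNIV. axis i (z $ i)) = z"
    by (simp add: vec_eq_iff axis_def if_distrib[of "\<lambda>x. x $ _"] sum.delta cong: if_cong)
  ultimately show ?thesis by simp
qed

lemma periodic_torus_proj:
  assumes "periodic f"
  shows "f (torus_proj x) = f x"
proof -
  have "torus_proj x = x + (\<chi> i. - of_int \<lfloor>x $ i\<rfloor>)"
    by (simp add: torus_proj_def vec_eq_iff frac_def)
  then show ?thesis using periodic_shift_Ints[OF assms, of "\<chi> i. - of_int \<lfloor>x $ i\<rfloor>" x] by simp
qed

lemma periodic_minus_left:
  fixes x :: "real ^ 'd"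
  assumes "periodic f"
  shows "periodic (\<lambda>y. f (x - y))"
  unfolding periodic_def
proof (intro allI)
  fix y i
  have "f (x - (y + axis i 1)) = f (x - y + axis i (of_int (-1)))"
    by (rule arg_cong[of _ _ f]) (simp add: vec_eq_iff axis_def)
  then show "f (x - (y + axis i 1)) = f (x - y)" using periodic_shift_int[OF assms] by metis
qed

lemma periodic_shift: "periodic f \<Longrightarrow> periodic (\<lambda>x. f (x + a))"
  unfolding periodic_def by (metis (no_types, opaque_lifting) add.assoc add.commute)

lemma torus_proj_in_cube: "torus_proj x \<in> unit_cube"
  by (simp add: torus_proj_def unit_cube_def frac_lt_1)

lemma unit_cube_subset_cbox: "unit_cube \<subseteq> cbox (0 :: real ^ 'd) 1"
  by (auto simp: unit_cube_def mem_box_cart less_imp_le)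

lemma box_subset_unit_cube: "box (0 :: real ^ 'd) 1 \<subseteq> unit_cube"
  by (auto simp: unit_cube_def mem_box_cart less_imp_le)

lemma periodic_continuous_bounded:
  fixes f :: "real ^ 'd \<Rightarrow> real"
  assumes "periodic f" "continuous_on UNIV f"
  obtains C where "C > 0" "\<And>x. \<bar>f x\<bar> \<le> C"
proof -
  have "compact (f ` cbox 0 1)"
    by (intro compact_continuous_image continuous_on_subset[OF assms(2)]) auto
  then obtain C where C: "\<And>x. x \<in> cbox 0 1 \<Longrightarrow> \<bar>f x\<bar> \<le> C"
    using compact_imp_bounded bounded_iff by (metis imageI real_norm_def)
  have "\<bar>f x\<bar> \<le> max C 1" for x
    using C[of "torus_proj x"] periodic_torus_proj[OF assms(1), of x] torus_proj_in_cube[of x]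
      unit_cube_subset_cbox by (metis max.coboundedI1 subsetD)
  then show ?thesis using that[of "max C 1"] by auto
qed

lemma periodic_continuous_positive:
  fixes f :: "real ^ 'd \<Rightarrow> real"
  assumes "periodic f" "continuous_on UNIV f" "\<And>x. f x > 0"
  obtains c where "c > 0" "\<And>x. c \<le> f x"
proof -
  have "\<exists>x\<in>cbox (0::real^'d) 1. \<forall>y\<in>cbox 0 1. f x \<le> f y"
    by (intro continuous_attains_inf continuous_on_subset[OF assms(2)])
       (use torus_proj_in_cube unit_cube_subset_cbox in auto)
  then obtain x where x: "\<And>y. y \<in> cbox 0 1 \<Longrightarrow> f x \<le> f y" by auto
  have "f x \<le> f y" for y
    using x[of "torus_proj y"] periodic_torus_proj[OF assms(1), of y] torus_proj_in_cube[of y]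
      unit_cube_subset_cbox by (metis subsetD)
  then show ?thesis using that[of "f x"] assms(3) by auto
qed

subsection \<open>Haar measure\<close>

lemma unit_cube_borel [measurable]: "unit_cube \<in> sets borel"
proof -
  have "unit_cube = (\<Inter>i. {x :: real ^ 'd. 0 \<le> x $ i} \<inter> {x. x $ i < 1})"
    by (auto simp: unit_cube_def)
  moreover have "{x :: real ^ 'd. 0 \<le> x $ i} \<inter> {x. x $ i < 1} \<in> sets borel" for i
    by measurable
  ultimately show ?thesis
    by (metis (no_types, lifting) UNIV_not_empty finite_class.finite_UNIV sets.finite_INT)
qed

lemma space_torus [simp]: "space torus = unit_cube"
  by (simp add: torus_def space_restrict_space)

lemma sets_torus: "sets torus = sets (restrict_space borel unit_cube)"
  by (simp add: torus_def sets_restrict_space)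

lemma AE_cbox_unit_cube: "AE x in lborel. (x :: real ^ 'd) \<in> cbox 0 1 \<longleftrightarrow> x \<in> unit_cube"
proof (rule AE_I')
  show "cbox 0 1 - box (0 :: real ^ 'd) 1 \<in> null_sets lborel"
    by (rule null_sets_cbox_Diff_box)
  show "{x \<in> space lborel. \<not> (((x :: real ^ 'd) \<in> cbox 0 1) = (x \<in> unit_cube))} \<subseteq> cbox 0 1 - box 0 1"
    using unit_cube_subset_cbox box_subset_unit_cube by auto
qed

lemma emeasure_unit_cube: "emeasure lborel (unit_cube :: (real ^ 'd) set) = 1"
proof -
  have "emeasure lborel (unit_cube :: (real ^ 'd) set) = emeasure lborel (cbox (0 :: real ^ 'd) 1)"
    by (rule emeasure_eq_AE) (use AE_cbox_unit_cube in auto)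
  also have "\<dots> = ennreal (\<Prod>b\<in>Basis. (1 - 0 :: real ^ 'd) \<bullet> b)"
    by (rule emeasure_lborel_cbox) (auto simp: Basis_vec_def inner_axis)
  also have "(\<Prod>b\<in>Basis. (1 - 0 :: real ^ 'd) \<bullet> b) = 1"
    by (rule prod.neutral) (auto simp: Basis_vec_def inner_axis)
  finally show ?thesis by simp
qed

lemma prob_space_torus: "prob_space torus"
  by standard (simp add: torus_def emeasure_restrict_space emeasure_unit_cube space_restrict_space)

interpretation torus: prob_space "torus :: (real ^ 'd) measure"
  by (rule prob_space_torus)

lemma borel_measurable_torus:
  "f \<in> borel_measurable borel \<Longrightarrow> f \<in> borel_measurable torus"
  by (simp add: torus_def measurable_restrict_space1)

lemma torus_proj_measurable [measurable]: "torus_proj \<in> borel \<rightarrow>\<^sub>M torus"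
proof -
  have "(\<lambda>x. torus_proj x :: real ^ 'd) \<in> borel_measurable borel"
  proof (subst borel_measurable_euclidean_space, intro ballI)
    fix b :: "real ^ 'd" assume "b \<in> Basis"
    then obtain i where b: "b = axis i 1" by (auto simp: Basis_vec_def)
    have "(\<lambda>x. torus_proj x \<bullet> b) = (\<lambda>x :: real ^ 'd. x $ i - of_int \<lfloor>x $ i\<rfloor>)"
      by (simp add: fun_eq_iff b inner_axis torus_proj_def frac_def)
    moreover have "(\<lambda>x :: real ^ 'd. x $ i) \<in> borel_measurable borel"
      by (intro borel_measurable_continuous_onI continuous_intros)
    ultimately show "(\<lambda>x. torus_proj x \<bullet> b) \<in> borel_measurable borel"
      by (simp only:) (intro borel_measurable_diff measurable_compose[OF _ borel_measurable_real_floor])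
  qed
  then show ?thesis
    unfolding torus_def
    by (intro measurable_restrict_space2) (auto simp: torus_proj_in_cube)
qed

lemma measurable_torus_continuous:
  "continuous_on UNIV f \<Longrightarrow> f \<in> borel_measurable torus"
  by (intro borel_measurable_torus borel_measurable_continuous_onI)

text \<open>The bridge to gauge integrals, where the Leibniz rule and the exchange of iterated
  integrals of continuous functions are available.\<close>

lemma integral_torus_cbox:
  fixes f :: "real ^ 'd \<Rightarrow> real"
  assumes "continuous_on UNIV f"
  shows "integral\<^sup>L torus f = integral (cbox 0 1) f"
proof -
  have [measurable]: "f \<in> borel_measurable borel"
    using assms by (rule borel_measurable_continuous_onI)
  have "integral\<^sup>L torus f = (\<integral>x. indicator unit_cube x *\<^sub>R f x \<partial>lborel)"
    unfolding torus_def by (rule integral_restrict_space) auto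
  also have "\<dots> = (\<integral>x. indicator (cbox 0 1) x *\<^sub>R f x \<partial>lborel)"
  proof (rule integral_cong_AE)
    show "AE x in lborel. indicator unit_cube x *\<^sub>R f x = indicator (cbox 0 1) x *\<^sub>R f x"
      using AE_cbox_unit_cube by eventually_elim (simp add: indicator_def)
  qed measurable
  also have "\<dots> = integral (cbox 0 1) f"
  proof -
    have "set_integrable lborel (cbox 0 1) f"
      unfolding set_integrable_def
      by (rule borel_integrable_compact[OF compact_cbox continuous_on_subset[OF assms subset_UNIV]])
    then show ?thesis
      unfolding set_lebesgue_integral_def[symmetric]
      by (rule set_borel_integral_eq_integral)
  qed
  finally show ?thesis .
qed

lemma integrable_periodic_continuous:
  fixes f :: "real ^ 'd \<Rightarrow> real"
  assumes "finite_measure \<rho>" "sets \<rho> = sets torus" "periodic f" "continuous_on UNIV f"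
  shows "integrable \<rho> f"
proof -
  obtain C where C: "\<And>x. \<bar>f x\<bar> \<le> C" using periodic_continuous_bounded[OF assms(3,4)] by metis
  have "f \<in> borel_measurable \<rho>"
    using measurable_torus_continuous[OF assms(4)] measurable_cong_sets[OF assms(2) refl] by blast
  then show ?thesis using C by (intro finite_measure.integrable_const_bound[OF assms(1), of _ C]) auto
qed

lemmas integrable_torus = integrable_periodic_continuous[OF torus.finite_measure_axioms refl]

section \<open>Translation invariance and integration along coordinate lines\<close>

lemma integral_torus_lborel:
  fixes f :: "real ^ 'd \<Rightarrow> real"
  shows "integral\<^sup>L torus f = (\<integral>x. indicator unit_cube x * f x \<partial>lborel)"
  unfolding torus_def by (subst integral_restrict_space) auto

lemma lborel_integral_shift:
  fixes f :: "'a :: euclidean_space \<Rightarrow> real"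
  assumes "f \<in> borel_measurable borel"
  shows "(\<integral>x. f (x + a) \<partial>lborel) = integral\<^sup>L lborel f"
proof -
  have "integral\<^sup>L lborel f = (\<integral>x. f x \<partial>distr lborel borel ((+) a))"
    by (simp add: lborel_distr_plus)
  also have "\<dots> = (\<integral>x. f (a + x) \<partial>lborel)"
    by (rule integral_distr) (use assms in auto)
  finally show ?thesis by (simp add: add.commute)
qed

text \<open>Shifting pushes a slab of thickness s out of the cube at one face, and periodicity lets
  it re-enter at the opposite one. For 0 \<le> s < 1 a single slab is involved.\<close>

lemma integral_torus_shift_axis_unit:
  fixes f :: "real ^ 'd \<Rightarrow> real"
  assumes f: "periodic f" "continuous_on UNIV f" and s: "0 \<le> s" "s < 1"
  shows "(\<integral>x. f (x + axis i s) \<partial>torus) = integral\<^sup>L torus f"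
proof -
  have fm: "f \<in> borel_measurable borel" by (rule borel_measurable_continuous_onI) fact
  define B where "B = {y \<in> unit_cube. y $ i < s}"
  have nth: "(\<lambda>y :: real ^ 'd. y $ i) \<in> borel_measurable borel"
    by (intro borel_measurable_continuous_onI continuous_intros)
  have Bm: "B \<in> sets borel"
  proof -
    have "B = unit_cube \<inter> {y \<in> space borel. y $ i < s}" by (auto simp: B_def)
    moreover have "{y \<in> space borel. y $ i < s} \<in> sets borel"
      by (rule borel_measurable_less) (use nth in auto)
    ultimately show ?thesis using unit_cube_borel by auto
  qed
  have fm': "(\<lambda>x. indicator A (x + a) * f (x + b)) \<in> borel_measurable borel" if "A \<in> sets borel" for A a b
  proof -
    have "(\<lambda>x. x + a) \<in> borel_measurable borel" "(\<lambda>x. x + b) \<in> borel_measurable borel" by auto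
    then show ?thesis
      using borel_measurable_times[OF measurable_compose[of "\<lambda>x. x + a" borel borel, OF _ borel_measurable_indicator[OF that]]
           measurable_compose[of "\<lambda>x. x + b" borel borel, OF _ fm]] by simp
  qed
  obtain C where C: "\<And>x. \<bar>f x\<bar> \<le> C" "C > 0" using periodic_continuous_bounded[OF f] by metis
  have intf: "integrable lborel (\<lambda>x. indicator A (x + a) * f (x + b))"
    if A: "A \<in> sets borel" "A \<subseteq> unit_cube" for A a b
  proof (rule Bochner_Integration.integrable_bound)
    have "integrable lborel (indicator (cbox (- a) (1 - a)) :: real ^ 'd \<Rightarrow> real)"
      by (rule integrable_real_indicator) (use emeasure_lborel_cbox_finite in auto)
    then show "integrable lborel (\<lambda>x. C * indicator (cbox (- a) (1 - a)) x :: real)" by simp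
    show "(\<lambda>x. indicator A (x + a) * f (x + b)) \<in> borel_measurable lborel" using fm'[OF A(1)] by simp
    have "x \<in> cbox (- a) (1 - a)" if "x + a \<in> A" for x
    proof -
      have "x + a \<in> unit_cube" using that A(2) by auto
      then have "0 \<le> x $ j + a $ j \<and> x $ j + a $ j < 1" for j by (simp add: unit_cube_def)
      then have "- a $ j \<le> x $ j \<and> x $ j \<le> 1 - a $ j" for j by (smt (verit))
      then show ?thesis by (simp add: mem_box_cart)
    qed
    then show "AE x in lborel. norm (indicator A (x + a) * f (x + b)) \<le> norm (C * indicator (cbox (- a) (1 - a)) x)"
      using C by (intro AE_I2) (auto simp: indicator_def)
  qed
  \<comment> \<open>The shifted cube is the cube without its slab \<open>B\<close>, together with
    the copy of \<open>B\<close> one period further on.\<close>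
  have eq: "(indicator unit_cube (y - axis i s) :: real) = indicator unit_cube y - indicator B y + indicator B (y - axis i 1)" for y
  proof -
    have *: "y - axis i t \<in> unit_cube \<longleftrightarrow> (\<forall>j. j \<noteq> i \<longrightarrow> 0 \<le> y $ j \<and> y $ j < 1) \<and> t \<le> y $ i \<and> y $ i < 1 + t" for t
    proof -
      have "(y - axis i t) $ j = (if j = i then y $ i - t else y $ j)" for j by (simp add: axis_def)
      then show ?thesis unfolding unit_cube_def by (auto split: if_splits)
    qed
    define P where "P = (\<forall>j. j \<noteq> i \<longrightarrow> 0 \<le> y $ j \<and> y $ j < 1)"
    have 1: "y \<in> unit_cube \<longleftrightarrow> P \<and> 0 \<le> y $ i \<and> y $ i < 1"
    proof -
      have "axis i 0 = (0 :: real ^ 'd)" by simp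
      then show ?thesis using *[of 0] unfolding P_def by (simp only: diff_zero) simp
    qed
    have 2: "y - axis i s \<in> unit_cube \<longleftrightarrow> P \<and> s \<le> y $ i \<and> y $ i < 1 + s"
      using *[of s] unfolding P_def .
    have 3: "y - axis i 1 \<in> B \<longleftrightarrow> P \<and> 1 \<le> y $ i \<and> y $ i < 1 + s"
      using *[of 1] s unfolding P_def B_def by auto
    have 4: "y \<in> B \<longleftrightarrow> P \<and> 0 \<le> y $ i \<and> y $ i < s"
      using 1 s unfolding B_def by auto
    show ?thesis
      unfolding indicator_def 1 2 3 4 using s by (cases P; simp; linarith?)
  qed
  have "(\<integral>x. f (x + axis i s) \<partial>torus) = (\<integral>x. indicator unit_cube x * f (x + axis i s) \<partial>lborel)"
    by (rule integral_torus_lborel)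
  also have "\<dots> = (\<integral>x. indicator unit_cube (x - axis i s) * f x \<partial>lborel)"
    using lborel_integral_shift[of "\<lambda>x. indicator unit_cube (x + (- axis i s)) * f (x + 0)" "axis i s"]
      fm'[OF unit_cube_borel, of "- axis i s" 0] by simp
  also have "\<dots> = (\<integral>x. indicator unit_cube x * f x - indicator B x * f x + indicator B (x - axis i 1) * f x \<partial>lborel)"
    by (simp only: eq ring_distribs)
  also have "\<dots> = (\<integral>x. indicator unit_cube x * f x \<partial>lborel) - (\<integral>x. indicator B x * f x \<partial>lborel)
      + (\<integral>x. indicator B (x - axis i 1) * f x \<partial>lborel)"
    using intf[OF unit_cube_borel, of 0 0] intf[OF Bm, of 0 0] intf[OF Bm, of "- axis i 1" 0]
    by (auto simp: B_def)
  also have "(\<integral>x. indicator B (x - axis i 1) * f x \<partial>lborel) = (\<integral>x. indicator B x * f (x + axis i 1) \<partial>lborel)"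
    using lborel_integral_shift[of "\<lambda>x. indicator B (x + 0) * f (x + axis i 1)" "- axis i 1"] fm'[OF Bm, of 0 "axis i 1"]
    by simp
  also have "\<dots> = (\<integral>x. indicator B x * f x \<partial>lborel)" using f(1) by (simp add: periodic_def)
  finally show ?thesis by (simp add: integral_torus_lborel)
qed

lemma integral_torus_shift_axis:
  fixes f :: "real ^ 'd \<Rightarrow> real"
  assumes f: "periodic f" "continuous_on UNIV f"
  shows "(\<integral>x. f (x + axis i s) \<partial>torus) = integral\<^sup>L torus f"
proof -
  have "f (x + axis i s) = f (x + axis i (frac s))" for x
  proof -
    have "x + axis i s = x + axis i (frac s) + axis i (of_int \<lfloor>s\<rfloor>)"
      by (simp add: axis_def vec_eq_iff frac_def)
    then show ?thesis by (simp only: periodic_shift_int[OF f(1)])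
  qed
  then show ?thesis
    using integral_torus_shift_axis_unit[OF f, of "frac s" i] by (simp add: frac_lt_1)
qed

lemma continuous_on_shift:
  fixes f :: "'a :: topological_monoid_add \<Rightarrow> 'b :: topological_space"
  shows "continuous_on UNIV f \<Longrightarrow> continuous_on UNIV (\<lambda>x. f (x + a))"
  by (rule continuous_on_compose2[of UNIV f]) (auto intro!: continuous_intros)

lemma integral_torus_shift:
  fixes f :: "real ^ 'd \<Rightarrow> real"
  assumes f: "periodic f" "continuous_on UNIV f"
  shows "(\<integral>x. f (x + a) \<partial>torus) = integral\<^sup>L torus f"
proof -
  have "(\<integral>x. f (x + (\<Sum>i\<in>I. axis i (a $ i))) \<partial>torus) = integral\<^sup>L torus f" if "finite I" for I
    using that
  proof (induction I)
    case (insert i I)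
    define z where "z = (\<Sum>i\<in>I. axis i (a $ i))"
    have "(\<integral>x. f (x + (\<Sum>i\<in>insert i I. axis i (a $ i))) \<partial>torus) = (\<integral>x. f (x + axis i (a $ i) + z) \<partial>torus)"
      using insert(1,2) by (simp add: z_def add.assoc)
    also have "\<dots> = (\<integral>x. f (x + z) \<partial>torus)"
      by (rule integral_torus_shift_axis[of "\<lambda>x. f (x + z)"]) (auto intro: periodic_shift continuous_on_shift f)
    finally show ?case using insert z_def by simp
  qed simp
  from this[of UNIV] have "(\<integral>x. f (x + (\<Sum>i\<in>UNIV. axis i (a $ i))) \<partial>torus) = integral\<^sup>L torus f" by simp
  moreover have "(\<Sum>i\<in>UNIV. axis i (a $ i)) = a"
    by (simp add: vec_eq_iff axis_def if_distrib[of "\<lambda>x. x $ _"] cong: if_cong)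
  ultimately show ?thesis by simp
qed

lemma continuous_on_line:
  fixes f :: "real ^ 'd \<Rightarrow> real"
  assumes "continuous_on UNIV f"
  shows "continuous_on S (\<lambda>s. f (x + s *\<^sub>R v))"
  by (rule continuous_on_compose2[OF assms]) (auto intro!: continuous_intros)

lemma continuous_on_slice_integral:
  fixes f :: "real ^ 'd \<Rightarrow> real"
  assumes "continuous_on UNIV f"
  shows "continuous_on UNIV (\<lambda>x. integral {0..1} (\<lambda>s. f (x + s *\<^sub>R v)))"
proof -
  have "continuous_on UNIV (\<lambda>x. integral (cbox 0 1) (\<lambda>s::real. f (x + s *\<^sub>R v)))"
    by (rule integral_continuous_on_param)
       (auto simp: split_beta intro!: continuous_intros continuous_on_compose2[OF assms])
  then show ?thesis by simp
qed

text \<open>Translation invariance averaged over a full period of shifts. This takes the place of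
  splitting the cube into a product and reduces inequalities on the torus to inequalities on
  circles.\<close>

lemma integral_torus_slice:
  fixes f :: "real ^ 'd \<Rightarrow> real"
  assumes f: "periodic f" "continuous_on UNIV f"
  shows "integral\<^sup>L torus f = (\<integral>x. integral {0..1} (\<lambda>s. f (x + s *\<^sub>R axis i 1)) \<partial>torus)"
proof -
  have "(\<integral>x. integral {0..1} (\<lambda>s. f (x + s *\<^sub>R axis i 1)) \<partial>torus)
      = integral (cbox 0 1) (\<lambda>x. integral (cbox 0 1) (\<lambda>s :: real. f (x + s *\<^sub>R axis i 1)))"
    using integral_torus_cbox[OF continuous_on_slice_integral[OF f(2)]] by simp
  also have "\<dots> = integral (cbox 0 1) (\<lambda>s :: real. integral (cbox 0 1) (\<lambda>x. f (x + s *\<^sub>R axis i 1)))"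
    by (rule integral_swap_continuous)
       (auto simp: split_beta intro!: continuous_intros continuous_on_compose2[OF f(2)])
  also have "\<dots> = integral (cbox 0 1) (\<lambda>s :: real. integral\<^sup>L torus f)"
  proof (rule integral_cong)
    fix s :: real
    have *: "s *\<^sub>R axis i 1 = (axis i s :: real ^ 'd)" by (simp add: axis_def vec_eq_iff)
    show "integral (cbox 0 1) (\<lambda>x. f (x + s *\<^sub>R axis i 1)) = integral\<^sup>L torus f"
      unfolding * integral_torus_cbox[symmetric, OF continuous_on_shift[OF f(2)]]
      by (rule integral_torus_shift_axis[OF f])
  qed
  finally show ?thesis by simp
qed

subsection \<open>Partial derivatives\<close>

text \<open>A derivative along one coordinate line, which the one-variable derivative rules
  establish directly; for \<open>partial\<close>, Frechet differentiability has to be known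
  first.\<close>

definition has_partial :: "'d \<Rightarrow> (real ^ 'd \<Rightarrow> real) \<Rightarrow> (real ^ 'd \<Rightarrow> real) \<Rightarrow> bool" where
  "has_partial i f f' \<longleftrightarrow> (\<forall>x. ((\<lambda>s. f (x + s *\<^sub>R axis i 1)) has_real_derivative f' x) (at 0))"

lemma has_partial_line:
  assumes "has_partial i f f'"
  shows "((\<lambda>s. f (x + s *\<^sub>R axis i 1)) has_real_derivative f' (x + s *\<^sub>R axis i 1)) (at s)"
proof -
  have "((\<lambda>r. f (x + s *\<^sub>R axis i 1 + r *\<^sub>R axis i 1)) has_real_derivative f' (x + s *\<^sub>R axis i 1)) (at 0)"
    using assms unfolding has_partial_def by blast
  then show ?thesis
    using DERIV_shift[of "\<lambda>r. f (x + r *\<^sub>R axis i 1)" "f' (x + s *\<^sub>R axis i 1)" 0 s]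
    by (simp add: scaleR_left_distrib add.assoc add.commute[of _ s])
qed

lemma has_partial_unique: "has_partial i f f' \<Longrightarrow> has_partial i f f'' \<Longrightarrow> f' = f''"
  unfolding has_partial_def using DERIV_unique by blast

lemma periodic_has_partial:
  assumes "has_partial i f f'" "periodic f"
  shows "periodic f'"
  unfolding periodic_def
proof (intro allI)
  fix x j
  have "((\<lambda>s. f (x + axis j 1 + s *\<^sub>R axis i 1)) has_real_derivative f' (x + axis j 1)) (at 0)"
    using assms(1) unfolding has_partial_def by blast
  moreover have "f (x + axis j 1 + s *\<^sub>R axis i 1) = f (x + s *\<^sub>R axis i 1)" for s
    using assms(2) unfolding periodic_def by (metis (no_types, lifting) add.assoc add.commute)
  ultimately have "((\<lambda>s. f (x + s *\<^sub>R axis i 1)) has_real_derivative f' (x + axis j 1)) (at 0)" by simp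
  then show "f' (x + axis j 1) = f' x"
    using assms(1) DERIV_unique unfolding has_partial_def by blast
qed

text \<open>On every coordinate line the integral is the increment of \<open>f\<close> over a full
  period. All integrations by parts on the torus below rest on this.\<close>

lemma integral_torus_partial:
  assumes "has_partial i f f'" "periodic f" "continuous_on UNIV f'"
  shows "integral\<^sup>L torus f' = 0"
proof -
  have "integral {0..1} (\<lambda>s. f' (x + s *\<^sub>R axis i 1)) = 0" for x
  proof -
    have "((\<lambda>s. f' (x + s *\<^sub>R axis i 1)) has_integral f (x + 1 *\<^sub>R axis i 1) - f (x + 0 *\<^sub>R axis i 1)) {0..1}"
      by (rule fundamental_theorem_of_calculus)
         (auto intro!: has_partial_line[OF assms(1)] has_field_derivative_at_within
            simp: has_real_derivative_iff_has_vector_derivative[symmetric])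
    then show ?thesis using assms(2) by (simp add: periodic_def integral_unique)
  qed
  then show ?thesis
    using integral_torus_slice[OF periodic_has_partial[OF assms(1,2)] assms(3), of i] by simp
qed

lemma has_partial_Ck:
  assumes "f differentiable (at x)"
  shows "((\<lambda>s. f (x + s *\<^sub>R axis i 1)) has_real_derivative partial i f x) (at 0)"
proof -
  have "(f has_derivative frechet_derivative f (at x)) (at (x + 0 *\<^sub>R axis i 1))"
    using assms frechet_derivative_works by fastforce
  then have "((\<lambda>s. f (x + s *\<^sub>R axis i 1)) has_derivative (\<lambda>s. frechet_derivative f (at x) (s *\<^sub>R axis i 1))) (at 0)"
    by (rule has_derivative_compose[rotated]) (auto intro!: derivative_eq_intros)
  then show ?thesis
    by (simp add: has_field_derivative_def partial_def linear_frechet_derivative[OF assms] linear_cmul mult_commute_abs)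
qed

lemma Ck_Suc_has_partial: "Ck (Suc k) f \<Longrightarrow> has_partial i f (partial i f)"
  unfolding has_partial_def by (auto intro: has_partial_Ck)

lemma Ck_continuous: "Ck k f \<Longrightarrow> continuous_on UNIV f"
  by (cases k) (auto intro!: differentiable_imp_continuous_on simp: differentiable_on_def)

lemma partial_eqI:
  assumes "has_partial i f f'" "\<And>x. f differentiable (at x)"
  shows "partial i f = f'"
  by (rule has_partial_unique[OF _ assms(1)]) (use assms(2) in \<open>auto simp: has_partial_def intro: has_partial_Ck\<close>)

section \<open>The circle\<close>

text \<open>The extremal function is sin (2 pi (x - p)), and 2 pi c is its logarithmic derivative.
  The difference of the two integrands is the square of g' - 2 pi g c plus the derivative of F, and
  F vanishes at both ends.\<close>

lemma Wirtinger_Dirichlet: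
  fixes g g' :: "real \<Rightarrow> real"
  assumes g: "\<And>x. (g has_real_derivative g' x) (at x)" and cont: "continuous_on UNIV g'"
    and zero: "g p = 0" "g (p + 1/2) = 0"
  shows "integral {p..p+1/2} (\<lambda>x. 4 * pi\<^sup>2 * (g x)\<^sup>2) \<le> integral {p..p+1/2} (\<lambda>x. (g' x)\<^sup>2)"
proof -
  define c where "c x = cot (2 * pi * (x - p))" for x
  define F where "F x = 2 * pi * (g x)\<^sup>2 * c x" for x
  define F' where "F' x = 4 * pi * g x * g' x * c x - 4 * pi\<^sup>2 * (g x)\<^sup>2 * (1 + (c x)\<^sup>2)" for x
  have contg: "continuous_on S g" for S
    using g DERIV_continuous_on has_field_derivative_at_within by blast
  have der: "(F has_real_derivative F' x) (at x)" if "x \<in> {p<..<p+1/2}" for x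
  proof -
    have "0 < 2 * pi * (x - p)" "2 * pi * (x - p) < pi" using that by auto
    then have s: "sin (2 * pi * (x - p)) \<noteq> 0" using sin_gt_zero by fastforce
    have "(c has_real_derivative - inverse ((sin (2 * pi * (x - p)))\<^sup>2) * (2 * pi)) (at x)"
      unfolding c_def by (rule DERIV_chain2[OF DERIV_cot]) (use s in \<open>auto intro!: derivative_eq_intros\<close>)
    moreover have "inverse ((sin (2 * pi * (x - p)))\<^sup>2) = 1 + (c x)\<^sup>2"
      using s sin_cos_squared_add[of "2 * pi * (x - p)"] by (simp add: c_def cot_def field_simps)
    ultimately have "(c has_real_derivative - (1 + (c x)\<^sup>2) * (2 * pi)) (at x)" by simp
    note [derivative_intros] = this g
    show ?thesis
      unfolding F_def F'_def by (auto intro!: derivative_eq_intros simp: power2_eq_square algebra_simps)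
  qed
  \<comment> \<open>At each end the cotangent has a simple pole and g^2 a double zero. With the
    difference quotients \<open>G\<close> of g and \<open>S\<close> of the sine, F becomes a
    quotient whose denominator stays away from 0 near the end and whose factor g tends to 0.\<close>
  have endpoint: "continuous (at q within {p..p+1/2}) F"
    if q: "g q = 0" "sin (2 * pi * (q - p)) = 0" for q
  proof -
    have cq: "cos (2 * pi * (q - p)) \<noteq> 0" using q(2) sin_cos_squared_add[of "2 * pi * (q - p)"] by auto
    define S where "S y = (sin (2 * pi * (y - p)) - sin (2 * pi * (q - p))) / (y - q)" for y
    define G where "G y = (g y - g q) / (y - q)" for y
    have S: "(S \<longlongrightarrow> 2 * pi * cos (2 * pi * (q - p))) (at q within {p..p+1/2})"
    proof -
      have "((\<lambda>y. sin (2 * pi * (y - p))) has_real_derivative 2 * pi * cos (2 * pi * (q - p))) (at q within {p..p+1/2})"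
        by (auto intro!: derivative_eq_intros)
      then show ?thesis unfolding S_def[abs_def] has_field_derivative_iff .
    qed
    have G: "(G \<longlongrightarrow> g' q) (at q within {p..p+1/2})"
      using has_field_derivative_at_within[OF g[of q]] unfolding G_def[abs_def] has_field_derivative_iff .
    have g0: "(g \<longlongrightarrow> 0) (at q within {p..p+1/2})"
      using g[of q] q(1) by (metis DERIV_isCont continuous_at_imp_continuous_at_within continuous_within)
    have co: "((\<lambda>y. cos (2 * pi * (y - p))) \<longlongrightarrow> cos (2 * pi * (q - p))) (at q within {p..p+1/2})"
      by (auto intro!: tendsto_intros)
    have "((\<lambda>y. 2 * pi * cos (2 * pi * (y - p)) * g y * G y / S y) \<longlongrightarrow>
        2 * pi * cos (2 * pi * (q - p)) * 0 * g' q / (2 * pi * cos (2 * pi * (q - p)))) (at q within {p..p+1/2})"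
      by (intro tendsto_intros S G g0 co) (use cq in auto)
    \<comment> \<open>Where the sine vanishes at y too, division by zero makes both sides 0.\<close>
    moreover have "2 * pi * cos (2 * pi * (y - p)) * g y * G y / S y = F y" if "y \<noteq> q" for y
      using that q by (simp add: S_def G_def F_def c_def cot_def power2_eq_square)
    ultimately have "(F \<longlongrightarrow> 0) (at q within {p..p+1/2})"
      by (auto intro: Lim_transform_within[of _ 0 q _ 1])
    then show ?thesis using q by (simp add: continuous_within F_def)
  qed
  have contF: "continuous_on {p..p+1/2} F"
    unfolding continuous_on_eq_continuous_within
  proof
    fix x assume x: "x \<in> {p..p+1/2}"
    consider "x = p" | "x = p + 1/2" | "x \<in> {p<..<p+1/2}" using x by force
    then show "continuous (at x within {p..p+1/2}) F"
    proof cases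
      case 1 then show ?thesis using endpoint zero by simp
    next
      case 2 then show ?thesis using endpoint[of x] zero by simp
    next
      case 3 then show ?thesis
        using der DERIV_isCont continuous_at_imp_continuous_at_within by blast
    qed
  qed
  have "(F' has_integral F (p + 1/2) - F p) {p..p+1/2}"
    by (rule fundamental_theorem_of_calculus_interior[OF _ contF])
       (use der in \<open>auto simp: has_real_derivative_iff_has_vector_derivative[symmetric]\<close>)
  then have F': "(F' has_integral 0) {p..p+1/2}" using zero by (simp add: F_def)
  have i: "(\<lambda>x. (g' x)\<^sup>2) integrable_on {p..p+1/2}" "(\<lambda>x. 4 * pi\<^sup>2 * (g x)\<^sup>2) integrable_on {p..p+1/2}"
    by (intro integrable_continuous_real continuous_intros contg continuous_on_subset[OF cont] subset_UNIV)+
  have "integral {p..p+1/2} F' \<le> integral {p..p+1/2} (\<lambda>x. (g' x)\<^sup>2 - 4 * pi\<^sup>2 * (g x)\<^sup>2)"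
  proof (rule integral_le)
    fix x
    have "(g' x)\<^sup>2 - 4 * pi\<^sup>2 * (g x)\<^sup>2 - F' x = (g' x - 2 * pi * g x * c x)\<^sup>2"
      unfolding F'_def by (simp add: power2_eq_square algebra_simps)
    then show "F' x \<le> (g' x)\<^sup>2 - 4 * pi\<^sup>2 * (g x)\<^sup>2"
      by (metis diff_ge_0_iff_ge zero_le_power2)
  qed (use F' i in \<open>auto intro: integrable_diff\<close>)
  then show ?thesis using F' i by (simp add: integral_unique integral_diff)
qed

lemma integral_unit_period:
  fixes f :: "real \<Rightarrow> real"
  assumes "continuous_on UNIV f" "\<And>x. f (x + 1) = f x" "0 \<le> a" "a \<le> 1"
  shows "integral {a..a+1} f = integral {0..1} f"
proof -
  have i: "f integrable_on {x..y}" for x y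
    by (rule integrable_continuous_real) (rule continuous_on_subset[OF assms(1) subset_UNIV])
  have "integral {0..a} (\<lambda>x. f (x + 1)) = integral {1..a+1} f"
    using integral_shift_real_ivl[of 1 1 "a + 1" f] by simp
  then have "integral {0..a} f = integral {1..a+1} f" using assms(2) by simp
  moreover have "integral {a..1} f + integral {1..a+1} f = integral {a..a+1} f"
    by (rule Henstock_Kurzweil_Integration.integral_combine) (use assms i in auto)
  moreover have "integral {0..a} f + integral {a..1} f = integral {0..1} f"
    by (rule Henstock_Kurzweil_Integration.integral_combine) (use assms i in auto)
  ultimately show ?thesis by simp
qed

text \<open>The function g (x + 1/2) - g x takes opposite values at 0 and 1/2, so g has the same
  value a at some p and p + 1/2. Then g - a satisfies Dirichlet conditions on both half periods, and
  since g has mean zero, subtracting a only increases the integral of the square.\<close>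

lemma Wirtinger_periodic:
  fixes g g' :: "real \<Rightarrow> real"
  assumes g: "\<And>x. (g has_real_derivative g' x) (at x)" and cont: "continuous_on UNIV g'"
    and per: "\<And>x. g (x + 1) = g x" "\<And>x. g' (x + 1) = g' x" and mean: "integral {0..1} g = 0"
  shows "4 * pi\<^sup>2 * integral {0..1} (\<lambda>x. (g x)\<^sup>2) \<le> integral {0..1} (\<lambda>x. (g' x)\<^sup>2)"
proof -
  have contg: "continuous_on S g" for S
    using g DERIV_continuous_on has_field_derivative_at_within by blast
  have contg': "continuous_on S g'" for S using cont continuous_on_subset by blast
  define \<phi> where "\<phi> x = g (x + 1/2) - g x" for x
  have c\<phi>: "continuous_on {0..1/2} \<phi>"
    unfolding \<phi>_def by (intro continuous_intros contg continuous_on_compose2[OF contg[of UNIV]]) auto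
  have "\<phi> 0 = - \<phi> (1/2)" using per(1)[of 0] by (simp add: \<phi>_def)
  then have "\<exists>x\<ge>0. x \<le> 1/2 \<and> \<phi> x = 0"
    using IVT'[of \<phi> 0 0 "1/2"] IVT2'[of \<phi> "1/2" 0 0] c\<phi> by (cases "\<phi> 0 \<le> 0") auto
  then obtain p where p: "0 \<le> p" "p \<le> 1/2" "\<phi> p = 0" by auto
  define a where "a = g p"
  define h where "h x = g x - a" for x
  have h: "(h has_real_derivative g' x) (at x)" for x
    unfolding h_def by (auto intro!: derivative_eq_intros g)
  have h0: "h p = 0" "h (p + 1/2) = 0" "h (p + 1/2 + 1/2) = 0"
    using p(3) per(1)[of p] by (auto simp: h_def a_def \<phi>_def add.assoc)
  have conth: "continuous_on S h" for S unfolding h_def by (intro continuous_intros contg)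
  have i: "(\<lambda>x. (g' x)\<^sup>2) integrable_on {x..y}" "(\<lambda>x. 4 * pi\<^sup>2 * (h x)\<^sup>2) integrable_on {x..y}"
     "g integrable_on {x..y}" "(\<lambda>x. (g x)\<^sup>2) integrable_on {x..y}" for x y
    by (intro integrable_continuous_real continuous_intros contg contg' conth)+
  have combine: "integral {p..p+1/2} f + integral {p+1/2..p+1/2+1/2} f = integral {0..1} f"
    if "continuous_on UNIV f" "\<And>x. f (x + 1) = f x" for f :: "real \<Rightarrow> real"
  proof -
    have "integral {p..p+1/2} f + integral {p+1/2..p+1/2+1/2} f = integral {p..p+1/2+1/2} f"
      by (rule Henstock_Kurzweil_Integration.integral_combine)
         (use integrable_continuous_real[OF continuous_on_subset[OF that(1) subset_UNIV]] in auto)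
    also have "integral {p..p+1/2+1/2} f = integral {p..p+1} f" by (simp add: add.commute)
    also have "\<dots> = integral {0..1} f" using integral_unit_period[OF that, of p] p by simp
    finally show ?thesis .
  qed
  have "integral {0..1} (\<lambda>x. 4 * pi\<^sup>2 * (h x)\<^sup>2) \<le> integral {0..1} (\<lambda>x. (g' x)\<^sup>2)"
  proof -
    have ch: "continuous_on UNIV (\<lambda>x. 4 * pi\<^sup>2 * (h x)\<^sup>2)" "continuous_on UNIV (\<lambda>x. (g' x)\<^sup>2)"
      by (intro continuous_intros conth contg')+
    show ?thesis
      using add_mono[OF Wirtinger_Dirichlet[OF h cont h0(1,2)] Wirtinger_Dirichlet[OF h cont h0(2,3)]]
      unfolding combine[OF ch(2), unfolded per, OF refl]
      by (subst (asm) combine[OF ch(1)]) (auto simp: h_def per)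
  qed
  moreover have "integral {0..1} (\<lambda>x. (h x)\<^sup>2) = integral {0..1} (\<lambda>x. (g x)\<^sup>2) + a\<^sup>2"
  proof -
    have "integral {0..1} (\<lambda>x. (h x)\<^sup>2) = integral {0..1} (\<lambda>x. (g x)\<^sup>2 - (2 * a) * g x + a\<^sup>2)"
      by (simp add: h_def power2_diff algebra_simps)
    also have "\<dots> = integral {0..1} (\<lambda>x. (g x)\<^sup>2) - (2 * a) * integral {0..1} g + a\<^sup>2"
      by (subst integral_add integral_diff integral_mult_right; use i in \<open>auto intro!: integrable_diff integrable_on_mult_right\<close>)+
    finally show ?thesis using mean by simp
  qed
  ultimately show ?thesis by (simp add: algebra_simps) (smt (verit) mult_nonneg_nonneg zero_le_power2)
qed

text \<open>The integrand on the right is u times the square of (ln u)'', written without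
  logarithms. For v = sqrt u the integrand on the left is 4 v'^2, and 4 v''^2 equals the one on the
  right up to a total derivative and a term of fixed sign.\<close>

lemma circle_curvature_inequality:
  fixes u u' u'' :: "real \<Rightarrow> real"
  assumes u: "\<And>x. (u has_real_derivative u' x) (at x)" and u': "\<And>x. (u' has_real_derivative u'' x) (at x)"
    and cont: "continuous_on UNIV u''" and pos: "\<And>x. u x > 0"
    and per: "\<And>x. u (x + 1) = u x" "\<And>x. u' (x + 1) = u' x" "\<And>x. u'' (x + 1) = u'' x"
  shows "4 * pi\<^sup>2 * integral {0..1} (\<lambda>x. (u' x)\<^sup>2 / u x)
      \<le> integral {0..1} (\<lambda>x. (u'' x - (u' x)\<^sup>2 / u x)\<^sup>2 / u x)"
proof -
  note [derivative_intros] = u u'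
  have c: "continuous_on S u" "continuous_on S u'" "continuous_on S u''" for S
    by (blast intro: DERIV_continuous_on[OF has_field_derivative_at_within[OF u]]
          DERIV_continuous_on[OF has_field_derivative_at_within[OF u']] continuous_on_subset[OF cont])+
  have u0: "u x \<noteq> 0" "sqrt (u x) \<noteq> 0" "\<bar>u x\<bar> = u x" for x using pos[of x] by auto
  define v' where "v' x = u' x / (2 * sqrt (u x))" for x
  define v'' where "v'' x = (u'' x - (u' x)\<^sup>2 / (2 * u x)) / (2 * sqrt (u x))" for x
  \<comment> \<open>The derivative of u'^3 / (8 u^2). The multiple 8/3 used below cancels the mixed
    term u'^2 u'' / u^2, and what remains is u'^4 / (12 u^3), which is nonnegative.\<close>
  define B where "B x = 3 * (u' x)\<^sup>2 * u'' x / (8 * (u x)\<^sup>2) - (u' x)^4 / (4 * (u x)^3)" for x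
  have sq: "sqrt (u x) * sqrt (u x) = u x" for x using pos[of x] by simp
  have v: "((\<lambda>x. sqrt (u x)) has_real_derivative v' x) (at x)" for x
    unfolding v'_def using pos[of x] by (auto intro!: derivative_eq_intros simp: field_simps)
  have v': "(v' has_real_derivative v'' x) (at x)" for x
  proof -
    have "(v' has_real_derivative (u'' x * (2 * sqrt (u x)) - u' x * (2 * v' x)) / ((2 * sqrt (u x)) * (2 * sqrt (u x)))) (at x)"
      unfolding v'_def[abs_def] by (rule derivative_eq_intros v[unfolded v'_def] refl | simp add: u0)+
    also have "(u'' x * (2 * sqrt (u x)) - u' x * (2 * v' x)) / ((2 * sqrt (u x)) * (2 * sqrt (u x))) = v'' x"
    proof -
      define s where "s = sqrt (u x)"
      have "u x = s * s" "s \<noteq> 0" using sq u0 by (auto simp: s_def)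
      then show ?thesis unfolding v''_def v'_def s_def[symmetric] by (simp add: field_simps power2_eq_square)
    qed
    finally show ?thesis .
  qed
  have B: "((\<lambda>x. (u' x)^3 / (8 * (u x)\<^sup>2)) has_real_derivative B x) (at x)" for x
    unfolding B_def by (auto intro!: derivative_eq_intros simp: u0)
      (simp add: u0 field_simps power2_eq_square power3_eq_cube power4_eq_xxxx)
  have iv': "integral {0..1} v' = 0"
  proof -
    have "(v' has_integral sqrt (u 1) - sqrt (u 0)) {0..1}"
      by (rule fundamental_theorem_of_calculus)
         (use v in \<open>auto simp: has_real_derivative_iff_has_vector_derivative[symmetric] intro: has_field_derivative_at_within\<close>)
    then show ?thesis using per(1)[of 0] by (simp add: integral_unique)
  qed
  have iB: "(B has_integral 0) {0..1}"
  proof -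
    have "(B has_integral (u' 1)^3 / (8 * (u 1)\<^sup>2) - (u' 0)^3 / (8 * (u 0)\<^sup>2)) {0..1}"
      by (rule fundamental_theorem_of_calculus)
         (use B in \<open>auto simp: has_real_derivative_iff_has_vector_derivative[symmetric] intro: has_field_derivative_at_within\<close>)
    then show ?thesis using per(1,2)[of 0] by simp
  qed
  have cv'': "continuous_on UNIV v''"
    unfolding v''_def by (intro continuous_intros c) (auto simp: u0)
  have W: "4 * pi\<^sup>2 * integral {0..1} (\<lambda>x. (v' x)\<^sup>2) \<le> integral {0..1} (\<lambda>x. (v'' x)\<^sup>2)"
    by (rule Wirtinger_periodic[OF v' cv'' _ _ iv']) (auto simp: v'_def v''_def per)
  have "(v' x)\<^sup>2 = 1 / 4 * ((u' x)\<^sup>2 / u x)" for x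
    unfolding v'_def power2_eq_square using sq[of x] by (simp add: field_simps)
  then have eq1: "integral {0..1} (\<lambda>x. (v' x)\<^sup>2) = 1 / 4 * integral {0..1} (\<lambda>x. (u' x)\<^sup>2 / u x)"
    by (simp only: integral_mult_right)
  have iR: "(\<lambda>x. (u'' x - (u' x)\<^sup>2 / u x)\<^sup>2 / u x) integrable_on {0..1}"
    by (intro integrable_continuous_real continuous_intros c) (auto simp: u0)
  have i4: "(\<lambda>x. 4 * (v'' x)\<^sup>2) integrable_on {0..1}"
    by (intro integrable_continuous_real continuous_intros continuous_on_subset[OF cv''] subset_UNIV)
  have iB': "((\<lambda>x. 8 / 3 * B x) has_integral 0) {0..1}"
    using has_integral_mult_right[OF iB, of "8 / 3"] by simp
  have "4 * integral {0..1} (\<lambda>x. (v'' x)\<^sup>2) = integral {0..1} (\<lambda>x. 4 * (v'' x)\<^sup>2 - 8 / 3 * B x)"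
    unfolding integral_diff[OF i4 has_integral_integrable[OF iB']] integral_unique[OF iB'] by simp
  also have "\<dots> \<le> integral {0..1} (\<lambda>x. (u'' x - (u' x)\<^sup>2 / u x)\<^sup>2 / u x)"
  proof (rule integral_le[OF _ iR])
    show "(\<lambda>x. 4 * (v'' x)\<^sup>2 - 8 / 3 * B x) integrable_on {0..1}"
      by (rule integrable_diff[OF i4 has_integral_integrable[OF iB']])
    fix x
    have "4 * (v'' x)\<^sup>2 = (u'' x - (u' x)\<^sup>2 / (2 * u x))\<^sup>2 / u x"
      unfolding v''_def power_divide power_mult_distrib using pos[of x] by simp
    moreover have "(u'' x - (u' x)\<^sup>2 / u x)\<^sup>2 / u x
        = (u'' x - (u' x)\<^sup>2 / (2 * u x))\<^sup>2 / u x - 8 / 3 * B x + (u' x)^4 / (12 * (u x)^3)"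
      using u0[of x] unfolding B_def
      by (simp add: field_simps power2_eq_square power3_eq_cube power4_eq_xxxx)
    moreover have "(u' x)^4 / (12 * (u x)^3) \<ge> 0" using pos[of x] by simp
    ultimately show "4 * (v'' x)\<^sup>2 - 8 / 3 * B x \<le> (u'' x - (u' x)\<^sup>2 / u x)\<^sup>2 / u x" by linarith
  qed
  finally show ?thesis using W eq1 by simp
qed

section \<open>Gaussian averages\<close>

lemma integral_normal_density_iexp:
  assumes "\<sigma> > 0"
  shows "integrable lborel (\<lambda>x. complex_of_real (normal_density 0 \<sigma> x) * iexp (t * x))"
    and "(\<integral>x. complex_of_real (normal_density 0 \<sigma> x) * iexp (t * x) \<partial>lborel) = complex_of_real (exp (- (\<sigma> * t)\<^sup>2 / 2))"
proof -
  have [measurable]: "(\<lambda>x. iexp (t * x)) \<in> borel_measurable borel"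
    by (intro borel_measurable_continuous_onI continuous_intros)
  have "integrable lborel (\<lambda>x. normal_density 0 \<sigma> x)"
    by (rule integrable_normal_density) fact
  then show "integrable lborel (\<lambda>x. complex_of_real (normal_density 0 \<sigma> x) * iexp (t * x))"
    by (rule Bochner_Integration.integrable_bound) (auto simp: norm_mult)
  have "(\<integral>x. complex_of_real (normal_density 0 \<sigma> x) * iexp (t * x) \<partial>lborel)
      = \<bar>\<sigma>\<bar> *\<^sub>R (\<integral>x. complex_of_real (normal_density 0 \<sigma> (0 + \<sigma> * x)) * iexp (t * (0 + \<sigma> * x)) \<partial>lborel)"
    by (rule lborel_integral_real_affine) (use assms in simp)
  also have "\<dots> = (\<integral>x. complex_of_real (std_normal_density x) * iexp (\<sigma> * t * x) \<partial>lborel)"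
  proof -
    have "complex_of_real (normal_density 0 \<sigma> (0 + \<sigma> * x)) = complex_of_real (1 / \<sigma>) * complex_of_real (std_normal_density x)" for x
    proof -
      have "normal_density 0 \<sigma> (\<sigma> * x) = 1 / \<sigma> * std_normal_density x"
        using assms by (simp add: normal_density_def real_sqrt_mult power_mult_distrib)
      then show ?thesis by (simp add: of_real_mult[symmetric] del: of_real_mult)
    qed
    then have "\<bar>\<sigma>\<bar> *\<^sub>R (complex_of_real (normal_density 0 \<sigma> (0 + \<sigma> * x)) * iexp (t * (0 + \<sigma> * x)))
        = complex_of_real (std_normal_density x) * iexp (\<sigma> * t * x)" for x
      using assms by (simp add: scaleR_conv_of_real mult.commute[of t] mult.assoc)
    then show ?thesis
      by (simp only: integral_scaleR_right[symmetric])
  qed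
  also have "\<dots> = char std_normal_distribution (\<sigma> * t)"
    unfolding char_def by (subst integral_density) (auto simp: scaleR_conv_of_real mult.assoc)
  also have "\<dots> = complex_of_real (exp (- (\<sigma> * t)\<^sup>2 / 2))"
    by (simp add: char_std_normal_distribution)
  finally show "(\<integral>x. complex_of_real (normal_density 0 \<sigma> x) * iexp (t * x) \<partial>lborel) = complex_of_real (exp (- (\<sigma> * t)\<^sup>2 / 2))" .
qed

text \<open>Lebesgue measure is the image of a product measure indexed by \<open>Basis\<close>;
  reindexing along the axes turns its product formula into one over coordinates.\<close>

lemma integral_lborel_vec_prod:
  fixes f :: "'d :: finite \<Rightarrow> real \<Rightarrow> complex"
  assumes f: "\<And>i. integrable lborel (f i)"
  shows "integrable lborel (\<lambda>x :: real ^ 'd. \<Prod>i\<in>UNIV. f i (x $ i))"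
    and "(\<integral>x. (\<Prod>i\<in>UNIV. f i ((x :: real ^ 'd) $ i)) \<partial>lborel) = (\<Prod>i\<in>UNIV. integral\<^sup>L lborel (f i))"
proof -
  interpret product_sigma_finite "\<lambda>_ :: real ^ 'd. lborel :: real measure"
    by standard
  define h where "h b = f (axis_index b)" for b :: "real ^ 'd"
  have bij: "bij_betw (\<lambda>i. axis i 1) (UNIV :: 'd set) (Basis :: (real ^ 'd) set)"
    by (rule bij_betwI'[where f="\<lambda>i. axis i (1 :: real)"]) (auto simp: axis_eq_axis Basis_vec_def)
  have [measurable]: "f i \<in> borel_measurable borel" for i using borel_measurable_integrable[OF f[of i]] by simp
  have [measurable]: "(\<lambda>x :: real ^ 'd. x $ i) \<in> borel_measurable borel" for i
    by (intro borel_measurable_continuous_onI continuous_intros)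
  have m: "(\<lambda>x :: real ^ 'd. \<Prod>i\<in>UNIV. f i (x $ i)) \<in> borel_measurable borel" by measurable
  have m2: "(\<lambda>z. \<Sum>b\<in>Basis. z b *\<^sub>R b) \<in> (\<Pi>\<^sub>M b\<in>(Basis :: (real ^ 'd) set). lborel) \<rightarrow>\<^sub>M borel"
    by measurable
  have nth: "(\<Sum>b\<in>Basis. z b *\<^sub>R b :: real ^ 'd) $ i = z (axis i 1)" for z i
  proof -
    have "(\<Sum>b\<in>Basis. z b *\<^sub>R b :: real ^ 'd) \<bullet> axis i 1 = z (axis i 1)"
      by (simp add: inner_sum_left_Basis)
    then show ?thesis by (simp add: inner_axis)
  qed
  have prod_eq: "(\<Prod>i\<in>UNIV. f i ((\<Sum>b\<in>Basis. z b *\<^sub>R b :: real ^ 'd) $ i)) = (\<Prod>b\<in>Basis. h b (z b))" for z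
    unfolding nth by (subst prod.reindex_bij_betw[OF bij, symmetric]) (simp add: h_def)
  have hi: "integrable lborel (h b)" for b unfolding h_def by (rule f)
  show "integrable lborel (\<lambda>x :: real ^ 'd. \<Prod>i\<in>UNIV. f i (x $ i))"
    by (subst lborel_eq, subst integrable_distr_eq[OF m2 m], unfold prod_eq, rule product_integrable_prod)
       (auto intro: hi)
  have "(\<integral>x. (\<Prod>i\<in>UNIV. f i ((x :: real ^ 'd) $ i)) \<partial>lborel) = (\<Prod>b\<in>Basis. integral\<^sup>L lborel (h b))"
    by (subst lborel_eq, subst integral_distr[OF m2 m], unfold prod_eq, rule product_integral_prod)
       (auto intro: hi)
  also have "\<dots> = (\<Prod>i\<in>UNIV. integral\<^sup>L lborel (f i))"
    by (subst prod.reindex_bij_betw[OF bij, symmetric]) (simp add: h_def)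
  finally show "(\<integral>x. (\<Prod>i\<in>UNIV. f i ((x :: real ^ 'd) $ i)) \<partial>lborel) = (\<Prod>i\<in>UNIV. integral\<^sup>L lborel (f i))" .
qed

text \<open>The centred normal density with covariance s times the identity. It serves twice: as the
  heat kernel with s = 2 t, and as the density of the increments in
  \<open>brownian_motion\<close>.\<close>

definition gauss_density :: "real \<Rightarrow> real ^ 'd \<Rightarrow> real" where
  "gauss_density s z = (\<Prod>i\<in>UNIV. normal_density 0 (sqrt s) (z $ i))"

lemma gauss_density_nonneg: "0 \<le> gauss_density s z"
  by (simp add: gauss_density_def prod_nonneg)

lemma gauss_density_cos:
  fixes k :: "real ^ 'd"
  assumes "s > 0"
  shows "has_bochner_integral lborel (\<lambda>z. gauss_density s z * cos (2 * pi * (k \<bullet> z) + \<theta>))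
    (exp (- 2 * pi\<^sup>2 * (k \<bullet> k) * s) * cos \<theta>)"
proof -
  define f where "f i x = complex_of_real (normal_density 0 (sqrt s) x) * iexp (2 * pi * k $ i * x)" for i x
  have fi: "integrable lborel (f i)" for i
    unfolding f_def by (rule integral_normal_density_iexp) (use assms in simp)
  have Pf: "(\<Prod>i\<in>UNIV. f i (z $ i)) = of_real (gauss_density s z) * iexp (2 * pi * (k \<bullet> z))" for z :: "real ^ 'd"
  proof -
    have "(\<Prod>i\<in>UNIV. iexp (2 * pi * k $ i * z $ i)) = exp (\<Sum>i\<in>UNIV. \<i> * complex_of_real (2 * pi * k $ i * z $ i))"
      by (simp add: exp_sum)
    also have "(\<Sum>i\<in>UNIV. \<i> * complex_of_real (2 * pi * k $ i * z $ i)) = \<i> * complex_of_real (2 * pi * (k \<bullet> z))"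
      by (simp add: inner_vec_def sum_distrib_left mult.assoc)
    finally show ?thesis by (simp add: f_def prod.distrib gauss_density_def)
  qed
  have "(\<Prod>i\<in>UNIV. integral\<^sup>L lborel (f i)) = (\<Prod>i\<in>UNIV. complex_of_real (exp (- (sqrt s * (2 * pi * k $ i))\<^sup>2 / 2)))"
    unfolding f_def using assms by (subst integral_normal_density_iexp) auto
  also have "\<dots> = complex_of_real (exp (\<Sum>i\<in>UNIV. - (sqrt s * (2 * pi * k $ i))\<^sup>2 / 2))"
    by (simp add: exp_sum)
  also have "(\<Sum>i\<in>UNIV. - (sqrt s * (2 * pi * k $ i))\<^sup>2 / 2) = - 2 * pi\<^sup>2 * (k \<bullet> k) * s"
    using assms by (simp add: inner_vec_def sum_distrib_left sum_distrib_right sum_negf power_mult_distrib)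
      (simp add: power2_eq_square mult_ac)
  finally have "has_bochner_integral lborel (\<lambda>z. of_real (gauss_density s z) * iexp (2 * pi * (k \<bullet> z)))
      (complex_of_real (exp (- 2 * pi\<^sup>2 * (k \<bullet> k) * s)))"
    using integral_lborel_vec_prod[of f, OF fi] unfolding Pf has_bochner_integral_iff by simp
  then have "has_bochner_integral lborel (\<lambda>z. of_real (gauss_density s z) * iexp (2 * pi * (k \<bullet> z)) * iexp \<theta>)
      (complex_of_real (exp (- 2 * pi\<^sup>2 * (k \<bullet> k) * s)) * iexp \<theta>)"
    by (intro has_bochner_integral_mult_left)
  then have "has_bochner_integral lborel (\<lambda>z. Re (of_real (gauss_density s z) * iexp (2 * pi * (k \<bullet> z)) * iexp \<theta>))
      (Re (complex_of_real (exp (- 2 * pi\<^sup>2 * (k \<bullet> k) * s)) * iexp \<theta>))"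
    by (rule has_bochner_integral_bounded_linear[OF bounded_linear_Re])
  moreover have "Re (of_real (gauss_density s z) * iexp (2 * pi * (k \<bullet> z)) * iexp \<theta>)
      = gauss_density s z * cos (2 * pi * (k \<bullet> z) + \<theta>)" for z
  proof -
    have "iexp (2 * pi * (k \<bullet> z)) * iexp \<theta> = iexp (2 * pi * (k \<bullet> z) + \<theta>)"
      by (simp add: exp_add[symmetric] distrib_left)
    then show ?thesis by (simp add: mult.assoc Re_exp)
  qed
  ultimately show ?thesis by (simp add: Re_exp)
qed

section \<open>Trigonometric polynomials\<close>

text \<open>The list element \<open>(a, k, \<theta>)\<close> stands for the function \<open>a cos (2 \<pi> k \<bullet> x + \<theta>)\<close>.\<close>

definition tpoly :: "(real \<times> (real ^ 'd) \<times> real) list \<Rightarrow> real ^ 'd \<Rightarrow> real" where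
  "tpoly L x = (\<Sum>(a, k, \<theta>)\<leftarrow>L. a * cos (2 * pi * (k \<bullet> x) + \<theta>))"

text \<open>Frequencies are real vectors, so that inner products need no conversion; the integrality
  responsible for periodicity is kept apart.\<close>

definition int_freqs :: "(real \<times> (real ^ 'd) \<times> real) list \<Rightarrow> bool" where
  "int_freqs L \<longleftrightarrow> (\<forall>(a, k, \<theta>)\<in>set L. \<forall>i. k $ i \<in> \<int>)"

text \<open>Differentiating a cosine advances its phase by a quarter turn. This is why modes carry a
  phase: the class is closed under derivatives without separate sine terms.\<close>

definition tpoly_partial :: "'d \<Rightarrow> (real \<times> (real ^ 'd) \<times> real) list \<Rightarrow> (real \<times> (real ^ 'd) \<times> real) list" where
  "tpoly_partial i L = map (\<lambda>(a, k, \<theta>). (2 * pi * (k $ i) * a, k, \<theta> + pi / 2)) L"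

text \<open>The semigroup generated by the full Laplacian, whose eigenvalue at frequency k is - 4
  pi^2 (k \<bullet> k).\<close>

definition tpoly_heat :: "real \<Rightarrow> (real \<times> (real ^ 'd) \<times> real) list \<Rightarrow> (real \<times> (real ^ 'd) \<times> real) list" where
  "tpoly_heat t L = map (\<lambda>(a, k, \<theta>). (exp (- 4 * pi\<^sup>2 * (k \<bullet> k) * t) * a, k, \<theta>)) L"

lemma tpoly_simps [simp]:
  "tpoly [] x = 0" "tpoly ((a, k, \<theta>) # L) x = a * cos (2 * pi * (k \<bullet> x) + \<theta>) + tpoly L x"
  by (auto simp: tpoly_def)

lemma tpoly_append [simp]: "tpoly (L @ M) x = tpoly L x + tpoly M x"
  by (simp add: tpoly_def)

lemma int_freqs_simps [simp]:
  "int_freqs []" "int_freqs ((a, k, \<theta>) # L) \<longleftrightarrow> (\<forall>i. k $ i \<in> \<int>) \<and> int_freqs L"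
  "int_freqs (L @ M) \<longleftrightarrow> int_freqs L \<and> int_freqs M"
  by (simp_all add: int_freqs_def ball_Un)

lemma tpoly_partial_simps [simp]:
  "tpoly_partial i [] = []"
  "tpoly_partial i ((a, k, \<theta>) # L) = (2 * pi * (k $ i) * a, k, \<theta> + pi / 2) # tpoly_partial i L"
  by (auto simp: tpoly_partial_def)

lemma tpoly_heat_simps [simp]:
  "tpoly_heat t [] = []"
  "tpoly_heat t ((a, k, \<theta>) # L) = (exp (- 4 * pi\<^sup>2 * (k \<bullet> k) * t) * a, k, \<theta>) # tpoly_heat t L"
  by (auto simp: tpoly_heat_def)

lemma int_freqs_partial [simp]: "int_freqs (tpoly_partial i L) \<longleftrightarrow> int_freqs L"
  by (auto simp: int_freqs_def tpoly_partial_def)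

lemma int_freqs_heat [simp]: "int_freqs (tpoly_heat t L) \<longleftrightarrow> int_freqs L"
  by (auto simp: int_freqs_def tpoly_heat_def)

lemma tpoly_heat_partial: "tpoly_heat t (tpoly_partial i L) = tpoly_partial i (tpoly_heat t L)"
  by (auto simp: tpoly_partial_def tpoly_heat_def)

lemma continuous_on_tpoly [continuous_intros]:
  fixes f :: "'b :: t2_space \<Rightarrow> real ^ 'd"
  assumes "continuous_on S f"
  shows "continuous_on S (\<lambda>z. tpoly L (f z))"
proof (induction L)
  case (Cons p L)
  obtain a k \<theta> where p: "p = (a, k, \<theta>)" by (cases p)
  show ?case unfolding p tpoly_simps tpoly_heat_simps by (intro continuous_intros assms Cons)
qed simp

lemma continuous_on_tpoly_heat:
  fixes f :: "'b :: t2_space \<Rightarrow> real ^ 'd"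
  assumes "continuous_on S f" "continuous_on S g"
  shows "continuous_on S (\<lambda>z. tpoly (tpoly_heat (g z) L) (f z))"
proof (induction L)
  case (Cons p L)
  obtain a k \<theta> where p: "p = (a, k, \<theta>)" by (cases p)
  show ?case unfolding p tpoly_simps tpoly_heat_simps by (intro continuous_intros assms Cons)
qed simp

lemma cos_shift_int_frequency:
  fixes k :: "real ^ 'd"
  assumes "\<And>i. k $ i \<in> \<int>"
  shows "cos (2 * pi * (k \<bullet> (x + axis i 1)) + \<theta>) = cos (2 * pi * (k \<bullet> x) + \<theta>)"
proof -
  obtain m where m: "k $ i = of_int m" using assms Ints_cases by blast
  have "2 * pi * (k \<bullet> (x + axis i 1)) + \<theta> = (2 * pi * (k \<bullet> x) + \<theta>) + 2 * pi * of_int m"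
    by (simp add: inner_add_right inner_axis m algebra_simps)
  then show ?thesis
    using cos_int_2pin[of m] sin_int_2pin[of m]
    by (simp only: cos_add[of "2 * pi * (k \<bullet> x) + \<theta>"])
qed

lemma periodic_tpoly: "int_freqs L \<Longrightarrow> periodic (tpoly L)"
proof (induction L)
  case (Cons p L)
  then show ?case by (cases p) (auto simp: periodic_def cos_shift_int_frequency)
qed (simp add: periodic_def)

lemma has_partial_tpoly: "has_partial i (tpoly L) (tpoly (tpoly_partial i L))"
proof (induction L)
  case (Cons p L)
  obtain a k \<theta> where p: "p = (a, k, \<theta>)" by (cases p)
  have "cos (2 * pi * (k \<bullet> x) + (\<theta> + pi / 2)) = - sin (2 * pi * (k \<bullet> x) + \<theta>)" for x
    using minus_sin_cos_eq[of "2 * pi * (k \<bullet> x) + \<theta>"] by (simp add: add.assoc)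
  then show ?case using Cons
    by (auto simp: p has_partial_def inner_add_right inner_axis intro!: derivative_eq_intros)
qed (simp add: has_partial_def)

lemma differentiable_tpoly: "tpoly L differentiable (at x)"
proof -
  have "(\<lambda>y. tpoly L y) differentiable (at x)"
  proof (induction L)
    case (Cons p L)
    obtain a k \<theta> where p: "p = (a, k, \<theta>)" by (cases p)
    have "(\<lambda>y. a * cos (2 * pi * (k \<bullet> y) + \<theta>)) differentiable (at x)"
      by (rule differentiableI) (rule derivative_eq_intros refl)+
    then show ?case using Cons p by (auto intro: differentiable_add)
  qed simp
  then show ?thesis by simp
qed

lemma partial_tpoly: "partial i (tpoly L) = tpoly (tpoly_partial i L)"
  by (rule partial_eqI) (auto intro: has_partial_tpoly differentiable_tpoly)

lemma torus_smooth_tpoly: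
  assumes "int_freqs L"
  shows "torus_smooth (tpoly L)"
proof -
  have "Ck n (tpoly L)" for n
    by (induction n arbitrary: L) (auto simp: partial_tpoly differentiable_tpoly intro!: continuous_intros)
  then show ?thesis by (simp add: torus_smooth_def torus_Ck_def periodic_tpoly assms)
qed

lemma tpoly_laplacian:
  "(\<Sum>i\<in>UNIV. tpoly (tpoly_partial i (tpoly_partial i L)) x)
    = (\<Sum>(a, k, \<theta>)\<leftarrow>L. - 4 * pi\<^sup>2 * (k \<bullet> k) * (a * cos (2 * pi * (k \<bullet> x) + \<theta>)))"
proof (induction L)
  case (Cons p L)
  obtain a k \<theta> where p: "p = (a, k, \<theta>)" by (cases p)
  have "cos (2 * pi * (k \<bullet> x) + (\<theta> + pi / 2 + pi / 2)) = - cos (2 * pi * (k \<bullet> x) + \<theta>)"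
    using cos_periodic_pi[of "2 * pi * (k \<bullet> x) + \<theta>"] by (simp add: add.assoc)
  then have "(\<Sum>i\<in>UNIV. 2 * pi * k $ i * (2 * pi * k $ i * a) * cos (2 * pi * (k \<bullet> x) + (\<theta> + pi / 2 + pi / 2)))
      = - 4 * pi\<^sup>2 * (k \<bullet> k) * (a * cos (2 * pi * (k \<bullet> x) + \<theta>))"
    by (simp add: inner_vec_def sum_distrib_left sum_distrib_right power2_eq_square mult_ac sum_negf)
  then show ?case using Cons p by (simp add: sum.distrib add.assoc)
qed simp

lemma DERIV_tpoly_heat:
  "((\<lambda>t. tpoly (tpoly_heat t L) x) has_real_derivative
     (\<Sum>i\<in>UNIV. tpoly (tpoly_partial i (tpoly_partial i (tpoly_heat t L))) x)) (at t within S)"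
  unfolding tpoly_laplacian
proof (induction L)
  case (Cons p L)
  obtain a k \<theta> where p: "p = (a, k, \<theta>)" by (cases p)
  show ?case unfolding p using Cons by (auto intro!: derivative_eq_intros)
qed simp

text \<open>The heat flow is the convolution with a Gaussian, hence positive.\<close>

lemma tpoly_heat_lower_bound:
  fixes L :: "(real \<times> (real ^ 'd) \<times> real) list"
  assumes "\<And>x. c \<le> tpoly L x" "0 \<le> t"
  shows "c \<le> tpoly (tpoly_heat t L) x"
proof (cases "t = 0")
  case True
  have "tpoly_heat 0 L = L" by (induction L) auto
  then show ?thesis using assms True by simp
next
  case False
  \<comment> \<open>The generator is the full Laplacian and not half of it, so time t corresponds to
    variance 2 t.\<close>
  then have t: "0 < 2 * t" using assms by simp
  have *: "has_bochner_integral lborel (\<lambda>z. gauss_density (2 * t) z * tpoly L (x + z)) (tpoly (tpoly_heat t L) x)"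
  proof (induction L)
    case (Cons p L)
    obtain a k \<theta> where p: "p = (a, k, \<theta>)" by (cases p)
    have "has_bochner_integral lborel (\<lambda>z. a * (gauss_density (2 * t) z * cos (2 * pi * (k \<bullet> z) + (2 * pi * (k \<bullet> x) + \<theta>))))
       (a * (exp (- 2 * pi\<^sup>2 * (k \<bullet> k) * (2 * t)) * cos (2 * pi * (k \<bullet> x) + \<theta>)))"
      by (intro has_bochner_integral_mult_right gauss_density_cos t)
    from has_bochner_integral_add[OF this Cons] show ?case
      unfolding p by (simp add: algebra_simps inner_add_right)
  qed (simp add: has_bochner_integral_zero)
  have "has_bochner_integral lborel (\<lambda>z :: real ^ 'd. gauss_density (2 * t) z) 1"
    using gauss_density_cos[OF t, of 0 0] by simp
  then have "has_bochner_integral lborel (\<lambda>z :: real ^ 'd. gauss_density (2 * t) z * c) (1 * c)"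
    by (intro has_bochner_integral_mult_left)
  then have "has_bochner_integral lborel (\<lambda>z :: real ^ 'd. gauss_density (2 * t) z * c) c" by simp
  moreover have "integral\<^sup>L lborel (\<lambda>z :: real ^ 'd. gauss_density (2 * t) z * c)
      \<le> (\<integral>z. gauss_density (2 * t) z * tpoly L (x + z) \<partial>lborel)"
    by (rule integral_mono) (use calculation * in \<open>auto simp: has_bochner_integral_iff intro!: mult_left_mono assms gauss_density_nonneg\<close>)
  ultimately show ?thesis
    using * by (cases "c = 0") (auto simp: has_bochner_integral_iff)
qed

section \<open>The logarithmic Sobolev inequality for positive trigonometric polynomials\<close>

lemma torus_curvature_inequality:
  fixes u a c :: "real ^ 'd \<Rightarrow> real"
  assumes D: "has_partial i u a" "has_partial i a c"
    and cont: "continuous_on UNIV u" "continuous_on UNIV a" "continuous_on UNIV c"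
    and per: "periodic u" and pos: "\<And>x. u x > 0"
  shows "4 * pi\<^sup>2 * (\<integral>x. (a x)\<^sup>2 / u x \<partial>torus) \<le> (\<integral>x. (c x - (a x)\<^sup>2 / u x)\<^sup>2 / u x \<partial>torus)"
proof -
  have per': "periodic a" "periodic c"
    using periodic_has_partial D per by blast+
  have u0: "u x \<noteq> 0" for x using pos[of x] by simp
  have c1: "continuous_on UNIV (\<lambda>x. (a x)\<^sup>2 / u x)" "continuous_on UNIV (\<lambda>x. (c x - (a x)\<^sup>2 / u x)\<^sup>2 / u x)"
    by (intro continuous_intros cont; simp add: u0)+
  have p1: "periodic (\<lambda>x. (a x)\<^sup>2 / u x)" "periodic (\<lambda>x. (c x - (a x)\<^sup>2 / u x)\<^sup>2 / u x)"
    using per per' by (auto simp: periodic_def)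
  have "4 * pi\<^sup>2 * (\<integral>x. (a x)\<^sup>2 / u x \<partial>torus)
      = (\<integral>x. 4 * pi\<^sup>2 * integral {0..1} (\<lambda>s. (a (x + s *\<^sub>R axis i 1))\<^sup>2 / u (x + s *\<^sub>R axis i 1)) \<partial>torus)"
    using integral_torus_slice[OF p1(1) c1(1), of i] by simp
  also have "\<dots> \<le> (\<integral>x. integral {0..1} (\<lambda>s. (c (x + s *\<^sub>R axis i 1) - (a (x + s *\<^sub>R axis i 1))\<^sup>2 / u (x + s *\<^sub>R axis i 1))\<^sup>2
        / u (x + s *\<^sub>R axis i 1)) \<partial>torus)"
  proof (rule integral_mono)
    have slice_per: "periodic (\<lambda>x. integral {0..1} (\<lambda>s. f (x + s *\<^sub>R axis i 1)))"
      if "periodic f" for f :: "real ^ 'd \<Rightarrow> real"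
    proof -
      have "f (x + axis j 1 + s *\<^sub>R axis i 1) = f (x + s *\<^sub>R axis i 1)" for x j s
        using that unfolding periodic_def by (metis (no_types, lifting) add.assoc add.commute)
      then show ?thesis by (simp add: periodic_def)
    qed
    show "integrable torus (\<lambda>x. 4 * pi\<^sup>2 * integral {0..1} (\<lambda>s. (a (x + s *\<^sub>R axis i 1))\<^sup>2 / u (x + s *\<^sub>R axis i 1)))"
      using integrable_torus[OF slice_per[OF p1(1)] continuous_on_slice_integral[OF c1(1)]] by simp
    show "integrable torus (\<lambda>x. integral {0..1} (\<lambda>s. (c (x + s *\<^sub>R axis i 1) - (a (x + s *\<^sub>R axis i 1))\<^sup>2 / u (x + s *\<^sub>R axis i 1))\<^sup>2
        / u (x + s *\<^sub>R axis i 1)))"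
      using integrable_torus[OF slice_per[OF p1(2)] continuous_on_slice_integral[OF c1(2)]] by simp
    fix x
    have per_line: "f (x + (s + 1) *\<^sub>R axis i 1) = f (x + s *\<^sub>R axis i 1)" if "periodic f" for f :: "real ^ 'd \<Rightarrow> real" and s
      using that by (simp add: periodic_def scaleR_left_distrib add.assoc[symmetric])
    show "4 * pi\<^sup>2 * integral {0..1} (\<lambda>s. (a (x + s *\<^sub>R axis i 1))\<^sup>2 / u (x + s *\<^sub>R axis i 1))
      \<le> integral {0..1} (\<lambda>s. (c (x + s *\<^sub>R axis i 1) - (a (x + s *\<^sub>R axis i 1))\<^sup>2 / u (x + s *\<^sub>R axis i 1))\<^sup>2
        / u (x + s *\<^sub>R axis i 1))"
      by (rule circle_curvature_inequality)
         (intro has_partial_line[OF D(1)] has_partial_line[OF D(2)] continuous_on_line cont pos per_line per per')+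
  qed
  also have "\<dots> = (\<integral>x. (c x - (a x)\<^sup>2 / u x)\<^sup>2 / u x \<partial>torus)"
    using integral_torus_slice[OF p1(2) c1(2), of i] by simp
  finally show ?thesis .
qed

text \<open>For a = \<partial>_i u the left-hand side is the change of the i-th Fisher information
  when u moves in the direction \<partial>_j \<partial>_j u. On the right, c - a b / u is u times
  the mixed second derivative of ln u, so the integrand is u times the square of that
  derivative.\<close>

lemma torus_integral_by_parts_hessian:
  fixes u a b c d e :: "real ^ 'd \<Rightarrow> real"
  assumes D: "has_partial j u b" "has_partial j a c" "has_partial j b d" "has_partial j c e"
    and cont: "continuous_on UNIV u" "continuous_on UNIV a" "continuous_on UNIV b"
      "continuous_on UNIV c" "continuous_on UNIV d" "continuous_on UNIV e"
    and per: "periodic u" "periodic a" and pos: "\<And>x. u x > 0"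
  shows "(\<integral>x. 2 * a x * e x / u x - (a x)\<^sup>2 * d x / (u x)\<^sup>2 \<partial>torus)
      = - 2 * (\<integral>x. (c x - a x * b x / u x)\<^sup>2 / u x \<partial>torus)"
proof -
  have per': "periodic b" "periodic c" using D per periodic_has_partial by blast+
  have per'': "periodic d" "periodic e" using D per' periodic_has_partial by blast+
  have u0: "u x \<noteq> 0" for x using pos[of x] by simp
  define F' where "F' x = (2 * a x * e x / u x - (a x)\<^sup>2 * d x / (u x)\<^sup>2)
      + 2 * ((c x - a x * b x / u x)\<^sup>2 / u x)" for x
  have hp: "has_partial j (\<lambda>x. 2 * a x * c x / u x - (a x)\<^sup>2 * b x / (u x)\<^sup>2) F'"
    unfolding has_partial_def
  proof
    fix x
    note [derivative_intros] = D[unfolded has_partial_def, THEN spec, of x]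
    show "((\<lambda>s. 2 * a (x + s *\<^sub>R axis j 1) * c (x + s *\<^sub>R axis j 1) / u (x + s *\<^sub>R axis j 1)
        - (a (x + s *\<^sub>R axis j 1))\<^sup>2 * b (x + s *\<^sub>R axis j 1) / (u (x + s *\<^sub>R axis j 1))\<^sup>2) has_real_derivative F' x) (at 0)"
      unfolding F'_def
      by (rule derivative_eq_intros refl | simp add: u0)+
         (use u0[of x] in \<open>simp add: field_simps power2_eq_square power4_eq_xxxx\<close>)
  qed
  have "integral\<^sup>L torus F' = 0"
    by (rule integral_torus_partial[OF hp])
       (use per per' in \<open>auto simp: F'_def periodic_def u0 intro!: continuous_intros cont\<close>)
  moreover have "integral\<^sup>L torus F' = (\<integral>x. 2 * a x * e x / u x - (a x)\<^sup>2 * d x / (u x)\<^sup>2 \<partial>torus)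
      + 2 * (\<integral>x. (c x - a x * b x / u x)\<^sup>2 / u x \<partial>torus)"
    unfolding F'_def integral_mult_right_zero[symmetric]
    by (rule Bochner_Integration.integral_add; rule integrable_torus)
       (use per per' per'' in \<open>auto simp: periodic_def u0 intro!: continuous_intros cont\<close>)
  ultimately show ?thesis by simp
qed

text \<open>Entropy dissipation: the contribution of direction j to the decay of the entropy along
  the heat flow is the j-th Fisher information.\<close>

lemma torus_integral_by_parts_log:
  fixes u b d :: "real ^ 'd \<Rightarrow> real"
  assumes D: "has_partial j u b" "has_partial j b d"
    and cont: "continuous_on UNIV u" "continuous_on UNIV b" "continuous_on UNIV d"
    and per: "periodic u" and pos: "\<And>x. u x > 0"
  shows "(\<integral>x. (ln (u x) + 1) * d x \<partial>torus) = - (\<integral>x. (b x)\<^sup>2 / u x \<partial>torus)"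
proof -
  have per': "periodic b" using D per periodic_has_partial by blast
  have per'': "periodic d" using D per' periodic_has_partial by blast
  have u0: "u x \<noteq> 0" for x using pos[of x] by simp
  define F' where "F' x = (ln (u x) + 1) * d x + (b x)\<^sup>2 / u x" for x
  have hp: "has_partial j (\<lambda>x. (ln (u x) + 1) * b x) F'"
    unfolding has_partial_def
  proof
    fix x
    note [derivative_intros] = D[unfolded has_partial_def, THEN spec, of x]
    show "((\<lambda>s. (ln (u (x + s *\<^sub>R axis j 1)) + 1) * b (x + s *\<^sub>R axis j 1)) has_real_derivative F' x) (at 0)"
      unfolding F'_def
      by (rule derivative_eq_intros refl | simp add: pos)+
         (use u0[of x] in \<open>simp add: field_simps power2_eq_square power4_eq_xxxx\<close>)
  qed
  have "integral\<^sup>L torus F' = 0"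
    by (rule integral_torus_partial[OF hp])
       (use per per' in \<open>auto simp: F'_def periodic_def u0 intro!: continuous_intros cont\<close>)
  moreover have "integral\<^sup>L torus F' = (\<integral>x. (ln (u x) + 1) * d x \<partial>torus) + (\<integral>x. (b x)\<^sup>2 / u x \<partial>torus)"
    unfolding F'_def
    by (rule Bochner_Integration.integral_add; rule integrable_torus)
       (use per per' per'' in \<open>auto simp: periodic_def u0 intro!: continuous_intros cont\<close>)
  ultimately show ?thesis by simp
qed

text \<open>Entropy density minus Fisher information density, with weight 1 / (8 pi^2), a quarter of
  the constant 1 / (2 pi^2). The integral has to be bounded by m ln m, where m is the mean.\<close>

definition lsi_deficit :: "(real \<times> (real ^ 'd) \<times> real) list \<Rightarrow> real ^ 'd \<Rightarrow> real" where
  "lsi_deficit L x = tpoly L x * ln (tpoly L x)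
     - (\<Sum>i\<in>UNIV. (tpoly (tpoly_partial i L) x)\<^sup>2 / tpoly L x) / (8 * pi\<^sup>2)"

text \<open>The time derivative of \<^term>\<open>lsi_deficit\<close> along the heat flow.\<close>

definition lsi_deficit_rate :: "(real \<times> (real ^ 'd) \<times> real) list \<Rightarrow> real ^ 'd \<Rightarrow> real" where
  "lsi_deficit_rate L x =
     (\<Sum>j\<in>UNIV. (ln (tpoly L x) + 1) * tpoly (tpoly_partial j (tpoly_partial j L)) x)
     - (\<Sum>i\<in>UNIV. \<Sum>j\<in>UNIV. 2 * tpoly (tpoly_partial i L) x * tpoly (tpoly_partial j (tpoly_partial j (tpoly_partial i L))) x / tpoly L x
        - (tpoly (tpoly_partial i L) x)\<^sup>2 * tpoly (tpoly_partial j (tpoly_partial j L)) x / (tpoly L x)\<^sup>2) / (8 * pi\<^sup>2)"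

text \<open>The entropy decreases at the rate sum of I i, the Fisher information at the rate 2 times
  the sum of H i j. The diagonal terms alone suffice: H i i is at least 4 pi^2 I i, and 2 times 4
  pi^2 is exactly the 8 pi^2 in the weight.\<close>

lemma integral_lsi_deficit_rate_nonneg:
  fixes L :: "(real \<times> (real ^ 'd) \<times> real) list"
  assumes L: "int_freqs L" and pos: "\<And>x. tpoly L x > 0"
  shows "0 \<le> integral\<^sup>L torus (lsi_deficit_rate L)"
proof -
  let ?u = "tpoly L" and ?D = "\<lambda>i. tpoly_partial i"
  have u0: "?u x \<noteq> 0" for x using pos[of x] by simp
  note P = periodic_tpoly[unfolded periodic_def]
  define H where "H i j = (\<integral>x. (tpoly (?D j (?D i L)) x - tpoly (?D i L) x * tpoly (?D j L) x / ?u x)\<^sup>2 / ?u x \<partial>torus)" for i j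
  define I where "I i = (\<integral>x. (tpoly (?D i L) x)\<^sup>2 / ?u x \<partial>torus)" for i
  have ct: "continuous_on UNIV (tpoly M)" for M :: "(real \<times> (real ^ 'd) \<times> real) list"
    by (intro continuous_intros)
  have 1: "(\<integral>x. 2 * tpoly (?D i L) x * tpoly (?D j (?D j (?D i L))) x / ?u x
        - (tpoly (?D i L) x)\<^sup>2 * tpoly (?D j (?D j L)) x / (?u x)\<^sup>2 \<partial>torus) = - 2 * H i j" for i j
    unfolding H_def
    by (rule torus_integral_by_parts_hessian[of j]) (auto intro!: has_partial_tpoly ct periodic_tpoly L pos)
  have 2: "(\<integral>x. (ln (?u x) + 1) * tpoly (?D j (?D j L)) x \<partial>torus) = - I j" for j
    unfolding I_def
    by (rule torus_integral_by_parts_log[of j]) (auto intro!: has_partial_tpoly ct periodic_tpoly L pos)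
  have 3: "4 * pi\<^sup>2 * I i \<le> H i i" for i
    unfolding I_def H_def power2_eq_square[of "tpoly (?D i L) _", symmetric]
    by (rule torus_curvature_inequality[of i]) (auto intro!: has_partial_tpoly ct periodic_tpoly L pos)
  have H: "H i i \<le> (\<Sum>j\<in>UNIV. H i j)" for i
    by (rule member_le_sum) (auto simp: H_def pos less_imp_le intro!: Bochner_Integration.integral_nonneg)
  have int1: "integrable torus (\<lambda>x. (ln (?u x) + 1) * tpoly (?D j (?D j L)) x)" for j
    by (rule integrable_torus) (use P[OF L] P[of "?D j (?D j L)"] L u0 in \<open>auto simp: periodic_def intro!: continuous_intros ct\<close>)
  have int2: "integrable torus (\<lambda>x. 2 * tpoly (?D i L) x * tpoly (?D j (?D j (?D i L))) x / ?u x
        - (tpoly (?D i L) x)\<^sup>2 * tpoly (?D j (?D j L)) x / (?u x)\<^sup>2)" for i j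
    by (rule integrable_torus)
       (use P[OF L] P[of "?D i L"] P[of "?D j (?D j L)"] P[of "?D j (?D j (?D i L))"] L u0
         in \<open>auto simp: periodic_def intro!: continuous_intros ct\<close>)
  have "integral\<^sup>L torus (lsi_deficit_rate L) = (\<Sum>j\<in>UNIV. - I j) - (\<Sum>i\<in>UNIV. \<Sum>j\<in>UNIV. - 2 * H i j) / (8 * pi\<^sup>2)"
    unfolding lsi_deficit_rate_def
    by (subst Bochner_Integration.integral_diff)
       (use int1 int2 in \<open>simp_all add: Bochner_Integration.integral_sum 1 2\<close>)
  also have "\<dots> = (\<Sum>i\<in>UNIV. 2 * (\<Sum>j\<in>UNIV. H i j) / (8 * pi\<^sup>2) - I i)"
    by (simp add: sum_subtractf sum_negf sum_divide_distrib sum_distrib_left)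
  also have "\<dots> \<ge> 0"
  proof (rule sum_nonneg)
    fix i
    have "8 * pi\<^sup>2 * I i \<le> 2 * (\<Sum>j\<in>UNIV. H i j)" using 3[of i] H[of i] by linarith
    then show "0 \<le> 2 * (\<Sum>j\<in>UNIV. H i j) / (8 * pi\<^sup>2) - I i"
      by (simp add: field_simps)
  qed
  finally show ?thesis .
qed

section \<open>Long-time behaviour of the heat flow and the entropy bound\<close>

lemma integral_tpoly:
  fixes L :: "(real \<times> (real ^ 'd) \<times> real) list"
  assumes "int_freqs L"
  shows "integral\<^sup>L torus (tpoly L) = (\<Sum>(a, k, \<theta>)\<leftarrow>L. if k = 0 then a * cos \<theta> else 0)"
  using assms
proof (induction L)
  case (Cons p L)
  obtain a k \<theta> where p: "p = (a, k, \<theta>)" by (cases p)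
  have L: "int_freqs [(a, k, \<theta>)]" "int_freqs L" using Cons.prems p by auto
  have single: "integral\<^sup>L torus (tpoly [(a, k, \<theta>)]) = (if k = 0 then a * cos \<theta> else 0)"
  proof (cases "k = 0")
    case True
    then have "tpoly [(a, k, \<theta>)] = (\<lambda>_. a * cos \<theta>)" by (simp add: fun_eq_iff)
    then show ?thesis using True by (simp add: torus.prob_space del: space_torus tpoly_simps)
  next
    case False
    then obtain i where i: "k $ i \<noteq> 0" by (auto simp: vec_eq_iff)
    \<comment> \<open>A mode with nonzero i-th frequency is the i-th derivative of the mode with
      phase turned back by a quarter turn and amplitude divided by 2 pi k_i.\<close>
    have eq: "tpoly [(a, k, \<theta>)] = tpoly (tpoly_partial i [(a / (2 * pi * k $ i), k, \<theta> - pi / 2)])"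
      using i by auto
    have "integral\<^sup>L torus (tpoly [(a, k, \<theta>)]) = 0"
      unfolding eq
      by (rule integral_torus_partial[OF has_partial_tpoly])
         (use L in \<open>auto intro!: periodic_tpoly continuous_intros simp del: tpoly_simps tpoly_partial_simps\<close>)
    then show ?thesis using False by simp
  qed
  have "integral\<^sup>L torus (tpoly (p # L)) = (\<integral>x. tpoly [(a, k, \<theta>)] x + tpoly L x \<partial>torus)"
    by (rule arg_cong[of _ _ "integral\<^sup>L torus"]) (simp add: p fun_eq_iff)
  also have "\<dots> = integral\<^sup>L torus (tpoly [(a, k, \<theta>)]) + integral\<^sup>L torus (tpoly L)"
    by (rule Bochner_Integration.integral_add; rule integrable_torus; intro periodic_tpoly continuous_intros L)
  finally show ?case using single Cons.IH L p by (simp del: tpoly_simps)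
qed (simp add: tpoly_def[abs_def])

text \<open>All modes of nonzero frequency decay, and by \<open>integral_tpoly\<close> what is left
  is the mean.\<close>

lemma tpoly_heat_tendsto:
  "(\<lambda>n. tpoly (tpoly_heat (real n) L) x) \<longlonglongrightarrow> (\<Sum>(a, k, \<theta>)\<leftarrow>L. if k = 0 then a * cos \<theta> else 0)"
proof (induction L)
  case (Cons p L)
  obtain a k \<theta> where p: "p = (a, k, \<theta>)" by (cases p)
  have "(\<lambda>n. exp (- 4 * pi\<^sup>2 * (k \<bullet> k) * real n) * a * cos (2 * pi * (k \<bullet> x) + \<theta>))
     \<longlonglongrightarrow> (if k = 0 then a * cos \<theta> else 0)"
  proof (cases "k = 0")
    case False
    define c where "c = 4 * pi\<^sup>2 * (k \<bullet> k)"
    have "c > 0" using False by (simp add: c_def)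
    then have "(\<lambda>n. exp (- c * real n)) \<longlonglongrightarrow> 0"
      by real_asymp
    then have "(\<lambda>n. exp (- c * real n) * a * cos (2 * pi * (k \<bullet> x) + \<theta>)) \<longlonglongrightarrow> 0 * a * cos (2 * pi * (k \<bullet> x) + \<theta>)"
      by (intro tendsto_intros)
    then show ?thesis using False by (simp add: c_def)
  qed simp
  from tendsto_add[OF this Cons.IH] show ?case unfolding p by simp
qed simp

lemma tpoly_heat_bounded:
  "0 \<le> t \<Longrightarrow> \<bar>tpoly (tpoly_heat t L) x\<bar> \<le> (\<Sum>(a, k, \<theta>)\<leftarrow>L. \<bar>a\<bar>)"
proof (induction L)
  case (Cons p L)
  obtain a k \<theta> where p: "p = (a, k, \<theta>)" by (cases p)
  have "\<bar>exp (- 4 * pi\<^sup>2 * (k \<bullet> k) * t) * a * cos (2 * pi * (k \<bullet> x) + \<theta>)\<bar> \<le> 1 * \<bar>a\<bar> * 1"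
    unfolding abs_mult using Cons.prems by (intro mult_mono) auto
  then show ?case unfolding p using Cons by simp
qed simp

lemma DERIV_mult_ln:
  fixes f :: "real \<Rightarrow> real"
  assumes "(f has_real_derivative f') (at s within S)" "f s > 0"
  shows "((\<lambda>t. f t * ln (f t)) has_real_derivative (ln (f s) + 1) * f') (at s within S)"
  using assms by (auto intro!: derivative_eq_intros simp: field_simps)

lemma DERIV_square_divide:
  fixes f g :: "real \<Rightarrow> real"
  assumes "(g has_real_derivative g') (at s within S)" "(f has_real_derivative f') (at s within S)" "f s > 0"
  shows "((\<lambda>t. (g t)\<^sup>2 / f t) has_real_derivative 2 * g s * g' / f s - (g s)\<^sup>2 * f' / (f s)\<^sup>2) (at s within S)"
  using assms by (auto intro!: derivative_eq_intros simp: field_simps power2_eq_square)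

text \<open>The integrated deficit is nondecreasing along the flow. At a late time its Fisher part
  is dropped by sign, so no decay of the Fisher information has to be shown, and the entropy
  converges to m ln m because the flow stays between two positive constants.\<close>

theorem tpoly_log_Sobolev:
  fixes L :: "(real \<times> (real ^ 'd) \<times> real) list"
  assumes L: "int_freqs L" and pos: "\<And>x. tpoly L x > 0"
  shows "(\<integral>x. tpoly L x * ln (tpoly L x) \<partial>torus)
      \<le> integral\<^sup>L torus (tpoly L) * ln (integral\<^sup>L torus (tpoly L))
        + (\<Sum>i\<in>UNIV. \<integral>x. (tpoly (tpoly_partial i L) x)\<^sup>2 / tpoly L x \<partial>torus) / (8 * pi\<^sup>2)"
proof -
  define u where "u t = tpoly (tpoly_heat t L)" for t
  define m where "m = integral\<^sup>L torus (tpoly L)"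
  have ct: "continuous_on UNIV (tpoly M)" for M :: "(real \<times> (real ^ 'd) \<times> real) list"
    by (intro continuous_intros)
  obtain c where c: "c > 0" "\<And>x. c \<le> tpoly L x"
    using periodic_continuous_positive[OF periodic_tpoly[OF L] ct pos] by blast
  have uc: "c \<le> u t x" if "t \<ge> 0" for t x
    unfolding u_def by (rule tpoly_heat_lower_bound) (use c that in auto)
  have upos: "u t x > 0" if "t \<ge> 0" for t x using uc[OF that, of x] c by simp
  have Lt: "int_freqs (tpoly_heat t L)" for t using L by simp
  have u0: "tpoly_heat 0 L = L" for L :: "(real \<times> (real ^ 'd) \<times> real) list" by (induction L) auto
  note P = periodic_tpoly[unfolded periodic_def]
  have cont_d: "continuous_on UNIV (lsi_deficit (tpoly_heat t L))"
    and per_d: "periodic (lsi_deficit (tpoly_heat t L))" if "t \<ge> 0" for t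
    using P[OF Lt] P[of "tpoly_partial _ (tpoly_heat t L)"] L upos[OF that, unfolded u_def]
    by (auto simp: periodic_def lsi_deficit_def less_imp_neq[symmetric] intro!: continuous_intros ct)
  have "integral (cbox 0 1) (lsi_deficit (tpoly_heat 0 L)) \<le> integral (cbox 0 1) (lsi_deficit (tpoly_heat (real n) L))" for n
  proof -
    let ?J = "\<lambda>t. integral (cbox 0 1) (lsi_deficit (tpoly_heat t L))"
    \<comment> \<open>The derivative is one-sided at time 0, where the flow starts from L;
      positivity of the flow is available for nonnegative times.\<close>
    have der: "(?J has_real_derivative integral (cbox 0 1) (lsi_deficit_rate (tpoly_heat t L))) (at t within {0..})"
      if "t \<ge> 0" for t
    proof (rule leibniz_rule_field_derivative)
      fix s :: real and x :: "real ^ 'd" assume s: "s \<in> {0..}"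
      then have us: "u s x \<noteq> 0" "u s x > 0" using upos[of s x] by auto
      have d1: "((\<lambda>t. tpoly (tpoly_heat t L) x) has_real_derivative
          (\<Sum>j\<in>UNIV. tpoly (tpoly_partial j (tpoly_partial j (tpoly_heat s L))) x)) (at s within {0..})"
        by (rule DERIV_tpoly_heat)
      have d2: "((\<lambda>t. tpoly (tpoly_partial i (tpoly_heat t L)) x) has_real_derivative
          (\<Sum>j\<in>UNIV. tpoly (tpoly_partial j (tpoly_partial j (tpoly_partial i (tpoly_heat s L)))) x)) (at s within {0..})" for i
        using DERIV_tpoly_heat[of "tpoly_partial i L" x s "{0..}"] by (simp add: tpoly_heat_partial)
      have d3: "((\<lambda>t. tpoly (tpoly_heat t L) x * ln (tpoly (tpoly_heat t L) x)) has_real_derivative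
          (\<Sum>j\<in>UNIV. (ln (u s x) + 1) * tpoly (tpoly_partial j (tpoly_partial j (tpoly_heat s L))) x)) (at s within {0..})"
        using DERIV_mult_ln[OF d1] us unfolding u_def by (simp only: sum_distrib_left)
      have d4: "((\<lambda>t. (tpoly (tpoly_partial i (tpoly_heat t L)) x)\<^sup>2 / tpoly (tpoly_heat t L) x) has_real_derivative
          (\<Sum>j\<in>UNIV. 2 * tpoly (tpoly_partial i (tpoly_heat s L)) x * tpoly (tpoly_partial j (tpoly_partial j (tpoly_partial i (tpoly_heat s L)))) x / u s x
        - (tpoly (tpoly_partial i (tpoly_heat s L)) x)\<^sup>2 * tpoly (tpoly_partial j (tpoly_partial j (tpoly_heat s L))) x / (u s x)\<^sup>2)) (at s within {0..})" for i
        using DERIV_square_divide[OF d2 d1, of i] us unfolding u_def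
        by (simp only: sum_distrib_left sum_divide_distrib sum_subtractf)
      show "((\<lambda>t. lsi_deficit (tpoly_heat t L) x) has_real_derivative lsi_deficit_rate (tpoly_heat s L) x) (at s within {0..})"
        unfolding lsi_deficit_def lsi_deficit_rate_def
        by (intro DERIV_diff DERIV_cdivide DERIV_sum d3[unfolded u_def] d4[unfolded u_def])
    next
      show "lsi_deficit (tpoly_heat s L) integrable_on cbox 0 1" if "s \<in> {0..}" for s
        by (rule integrable_continuous, rule continuous_on_subset[OF cont_d]) (use that in auto)
    next
      show "continuous_on ({0..} \<times> cbox 0 1) (\<lambda>(s, x). lsi_deficit_rate (tpoly_heat s L) x)"
        unfolding split_beta lsi_deficit_rate_def tpoly_heat_partial[symmetric]
        by (intro continuous_intros continuous_on_tpoly_heat)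
           (use upos[unfolded u_def] in \<open>auto simp: less_imp_neq[symmetric]\<close>)
    qed (use that in auto)
    show ?thesis
    proof (rule DERIV_nonneg_imp_increasing_open[where f = ?J and a = 0 and b = "real n"])
      fix t :: real assume t: "0 < t" "t < real n"
      then have "at t within {0..} = at t" by (intro at_within_interior) auto
      moreover have "0 \<le> integral (cbox 0 1) (lsi_deficit_rate (tpoly_heat t L))"
      proof -
        have "continuous_on UNIV (lsi_deficit_rate (tpoly_heat t L))"
          unfolding lsi_deficit_rate_def
          by (intro continuous_intros ct) (use t upos[of t, unfolded u_def] in \<open>auto simp: less_imp_neq[symmetric]\<close>)
        then show ?thesis
          using integral_lsi_deficit_rate_nonneg[OF Lt[of t]] t upos[of t, unfolded u_def]
          by (simp add: integral_torus_cbox)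
      qed
      ultimately show "\<exists>y. (?J has_real_derivative y) (at t) \<and> 0 \<le> y"
        using der[of t] t by auto
    next
      show "continuous_on {0..real n} ?J"
        by (rule DERIV_continuous_on[where D="\<lambda>t. integral (cbox 0 1) (lsi_deficit_rate (tpoly_heat t L))"])
           (auto intro: DERIV_subset[OF der])
    qed simp
  qed
  then have mono: "integral\<^sup>L torus (lsi_deficit L) \<le> integral\<^sup>L torus (lsi_deficit (tpoly_heat (real n) L))" for n
    using cont_d[of 0] cont_d[of "real n"] by (simp add: integral_torus_cbox u0)
  have cu: "continuous_on UNIV (\<lambda>x. u t x * ln (u t x))" and pu: "periodic (\<lambda>x. u t x * ln (u t x))" if "t \<ge> 0" for t
    using P[OF Lt] upos[OF that] unfolding u_def
    by (auto simp: periodic_def less_imp_neq[symmetric] intro!: continuous_intros ct)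
  have "integral\<^sup>L torus (lsi_deficit (tpoly_heat (real n) L)) \<le> (\<integral>x. u (real n) x * ln (u (real n) x) \<partial>torus)" for n
  proof (rule integral_mono)
    show "integrable torus (lsi_deficit (tpoly_heat (real n) L))"
      by (rule integrable_torus[OF per_d cont_d]) auto
    show "integrable torus (\<lambda>x. u (real n) x * ln (u (real n) x))"
      by (rule integrable_torus[OF pu cu]) auto
    fix x
    show "lsi_deficit (tpoly_heat (real n) L) x \<le> u (real n) x * ln (u (real n) x)"
      using upos[of "real n" x] unfolding lsi_deficit_def u_def
      by (auto intro!: sum_nonneg divide_nonneg_pos)
  qed
  with mono have le: "integral\<^sup>L torus (lsi_deficit L) \<le> (\<integral>x. u (real n) x * ln (u (real n) x) \<partial>torus)" for n
    using order_trans by blast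
  have lim: "(\<lambda>n. u (real n) x) \<longlonglongrightarrow> m" for x
    unfolding m_def u_def integral_tpoly[OF L] by (rule tpoly_heat_tendsto)
  have "m \<ge> c" using lim[of undefined] by (rule LIMSEQ_le_const) (use uc in auto)
  define C where "C = (\<Sum>(a, k, \<theta>)\<leftarrow>L. \<bar>a\<bar>)"
  have "(\<lambda>n. \<integral>x. u (real n) x * ln (u (real n) x) \<partial>torus) \<longlonglongrightarrow> (\<integral>x. m * ln m \<partial>(torus :: (real ^ 'd) measure))"
  proof (rule integral_dominated_convergence[where w="\<lambda>_. C * (\<bar>ln c\<bar> + \<bar>ln C\<bar>)"])
    show "AE x in torus. (\<lambda>n. u (real n) x * ln (u (real n) x)) \<longlonglongrightarrow> m * ln m"
      using lim \<open>m \<ge> c\<close> c by (auto intro!: tendsto_intros)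
    show "AE x in torus. norm (u (real n) x * ln (u (real n) x)) \<le> C * (\<bar>ln c\<bar> + \<bar>ln C\<bar>)" for n
    proof (intro AE_I2)
      fix x
      have 1: "c \<le> u (real n) x" "u (real n) x \<le> C" "u (real n) x > 0"
        using uc[of "real n" x] tpoly_heat_bounded[of "real n" L x] c unfolding u_def C_def by auto
      then have "ln c \<le> ln (u (real n) x)" "ln (u (real n) x) \<le> ln C" using c by auto
      then have "\<bar>ln (u (real n) x)\<bar> \<le> \<bar>ln c\<bar> + \<bar>ln C\<bar>" by linarith
      then show "norm (u (real n) x * ln (u (real n) x)) \<le> C * (\<bar>ln c\<bar> + \<bar>ln C\<bar>)"
        using 1 by (simp add: abs_mult mult_mono)
    qed
  qed (use measurable_torus_continuous[OF cu] in auto)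
  then have "integral\<^sup>L torus (lsi_deficit L) \<le> (\<integral>x. m * ln m \<partial>(torus :: (real ^ 'd) measure))"
    by (rule LIMSEQ_le_const) (use le in auto)
  also have "\<dots> = m * ln m" by (simp add: torus.prob_space del: space_torus)
  finally have fin: "integral\<^sup>L torus (lsi_deficit L) \<le> m * ln m" .
  have i1: "integrable torus (\<lambda>x. tpoly L x * ln (tpoly L x))"
    using integrable_torus[OF pu[of 0] cu[of 0]] by (simp add: u_def u0)
  have i2: "integrable torus (\<lambda>x. (tpoly (tpoly_partial i L) x)\<^sup>2 / tpoly L x)" for i
    by (rule integrable_torus)
       (use P[OF L] P[of "tpoly_partial i L"] L pos in \<open>auto simp: periodic_def less_imp_neq[symmetric] intro!: continuous_intros ct\<close>)
  have "integral\<^sup>L torus (lsi_deficit L) = (\<integral>x. tpoly L x * ln (tpoly L x) \<partial>torus)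
      - (\<Sum>i\<in>UNIV. \<integral>x. (tpoly (tpoly_partial i L) x)\<^sup>2 / tpoly L x \<partial>torus) / (8 * pi\<^sup>2)"
    unfolding lsi_deficit_def
    by (subst Bochner_Integration.integral_diff) (use i1 i2 in \<open>simp_all add: Bochner_Integration.integral_sum\<close>)
  then show ?thesis using fin unfolding m_def by simp
qed

section \<open>Approximate identities\<close>

lemma tpoly_scale: "tpoly (map (\<lambda>(a, k, \<theta>). (c * a, k, \<theta>)) L) x = c * tpoly L x"
  by (induction L) (auto simp: algebra_simps)

text \<open>The product-to-sum formula, mode by mode; it adds and subtracts frequencies and so keeps
  them integral.\<close>

lemma tpoly_mult_exists:
  assumes "int_freqs L" "int_freqs M"
  shows "\<exists>N. int_freqs N \<and> (\<forall>x. tpoly N x = tpoly L x * tpoly M x)"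
  using assms(1)
proof (induction L)
  case Nil
  show ?case by (rule exI[of _ "[]"]) simp
next
  case (Cons p L)
  obtain a k \<theta> where p: "p = (a, k, \<theta>)" by (cases p)
  have "\<exists>N. int_freqs N \<and> (\<forall>x. tpoly N x = a * cos (2 * pi * (k \<bullet> x) + \<theta>) * tpoly M x)"
    using assms(2)
  proof (induction M)
    case Nil
    show ?case by (rule exI[of _ "[]"]) simp
  next
    case (Cons q M)
    obtain b l \<eta> where q: "q = (b, l, \<eta>)" by (cases q)
    obtain N where N: "int_freqs N" "\<And>x. tpoly N x = a * cos (2 * pi * (k \<bullet> x) + \<theta>) * tpoly M x"
      using Cons q by auto
    have "a * cos (2 * pi * (k \<bullet> x) + \<theta>) * (b * cos (2 * pi * (l \<bullet> x) + \<eta>))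
      = a * b / 2 * cos (2 * pi * ((k - l) \<bullet> x) + (\<theta> - \<eta>)) + a * b / 2 * cos (2 * pi * ((k + l) \<bullet> x) + (\<theta> + \<eta>))" for x
    proof -
      let ?A = "2 * pi * (k \<bullet> x) + \<theta>" and ?B = "2 * pi * (l \<bullet> x) + \<eta>"
      have e: "2 * pi * ((k - l) \<bullet> x) + (\<theta> - \<eta>) = ?A - ?B" "2 * pi * ((k + l) \<bullet> x) + (\<theta> + \<eta>) = ?A + ?B"
        by (simp_all add: inner_left_distrib inner_diff_left algebra_simps)
      show ?thesis unfolding e cos_add[of ?A ?B] cos_diff[of ?A ?B] by (simp add: algebra_simps)
    qed
    then show ?case
      using N q \<open>int_freqs (q # M)\<close> \<open>int_freqs (p # L)\<close> p
      by (intro exI[of _ "(a * b / 2, k - l, \<theta> - \<eta>) # (a * b / 2, k + l, \<theta> + \<eta>) # N"])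
         (auto simp: algebra_simps)
  qed
  then obtain N1 where N1: "int_freqs N1" "\<And>x. tpoly N1 x = a * cos (2 * pi * (k \<bullet> x) + \<theta>) * tpoly M x" by blast
  obtain N2 where N2: "int_freqs N2" "\<And>x. tpoly N2 x = tpoly L x * tpoly M x" using Cons p by auto
  show ?case using N1 N2 by (intro exI[of _ "N1 @ N2"]) (simp add: p ring_distribs)
qed

lemma tpoly_power_exists:
  assumes "int_freqs L"
  shows "\<exists>N. int_freqs N \<and> (\<forall>x. tpoly N x = tpoly L x ^ n)"
proof (induction n)
  case 0
  show ?case by (rule exI[of _ "[(1, 0, 0)]"]) simp
next
  case (Suc n)
  then show ?case using tpoly_mult_exists[OF assms] by (metis power_Suc)
qed

text \<open>The product of the factors (2 + cos (2 pi x_i)) / 3 has these properties. The summand 2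
  in place of 1 keeps every factor strictly positive, and a product of factors at most 1 equals 1
  only if each factor does.\<close>

lemma peaked_tpoly_exists:
  obtains L :: "(real \<times> (real ^ 'd) \<times> real) list" where "int_freqs L" "\<And>x. 0 < tpoly L x" "\<And>x. tpoly L x \<le> 1"
    "tpoly L 0 = 1" "\<And>x i. tpoly L x = 1 \<Longrightarrow> x $ i \<in> \<int>"
proof -
  have "\<exists>L :: (real \<times> (real ^ 'd) \<times> real) list. int_freqs L \<and> (\<forall>x. tpoly L x = (\<Prod>i\<in>I. (2 + cos (2 * pi * x $ i)) / 3))"
    if "finite I" for I
    using that
  proof (induction I)
    case empty
    show ?case by (rule exI[of _ "[(1, 0, 0)]"]) simp
  next
    case (insert i I)
    obtain L :: "(real \<times> (real ^ 'd) \<times> real) list" where L: "int_freqs L" "\<And>x. tpoly L x = (\<Prod>i\<in>I. (2 + cos (2 * pi * x $ i)) / 3)"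
      using insert by blast
    define M :: "(real \<times> (real ^ 'd) \<times> real) list" where "M = [(2 / 3, 0, 0), (1 / 3, axis i 1, 0)]"
    have M: "int_freqs M" "\<And>x. tpoly M x = (2 + cos (2 * pi * x $ i)) / 3"
      by (simp_all add: M_def inner_axis') (simp add: axis_def)
    show ?case using tpoly_mult_exists[OF M(1) L(1)] unfolding M(2) L(2) prod.insert[OF insert(1,2)] .
  qed
  from this[of UNIV] obtain L :: "(real \<times> (real ^ 'd) \<times> real) list" where L: "int_freqs L"
    "\<And>x. tpoly L x = (\<Prod>i\<in>UNIV. (2 + cos (2 * pi * x $ i)) / 3)" by auto
  have f: "0 < (2 + cos t) / 3" "(2 + cos t) / 3 \<le> 1" for t :: real
  proof -
    have "0 < 2 + cos t" using cos_ge_minus_one[of t] by linarith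
    then show "0 < (2 + cos t) / 3" "(2 + cos t) / 3 \<le> 1" using cos_le_one[of t] by simp_all
  qed
  show ?thesis
  proof (rule that[OF L(1)])
    show "0 < tpoly L x" for x unfolding L using f by (simp add: prod_pos)
    show "tpoly L x \<le> 1" for x unfolding L using f by (intro prod_le_1) (auto intro: less_imp_le)
    show "tpoly L 0 = 1" by (simp add: L)
    show "x $ i \<in> \<int>" if "tpoly L x = 1" for x i
    proof -
      have "1 = (2 + cos (2 * pi * x $ i)) / 3 * (\<Prod>i\<in>UNIV - {i}. (2 + cos (2 * pi * x $ i)) / 3)"
        using that unfolding L by (subst prod.remove[of UNIV i, symmetric]) auto
      also have "\<dots> \<le> (2 + cos (2 * pi * x $ i)) / 3 * 1"
        using f by (intro mult_left_mono prod_le_1) (auto intro: less_imp_le)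
      finally have "1 \<le> cos (2 * pi * x $ i)" by simp
      then have "cos (2 * pi * x $ i) = 1" using cos_le_one[of "2 * pi * x $ i"] by (rule antisym[rotated])
      then obtain m :: int where "2 * pi * x $ i = of_int m * 2 * pi" using cos_one_2pi_int by auto
      then have "x $ i = of_int m" by simp
      then show ?thesis by simp
    qed
  qed
qed

text \<open>The base point is a corner of the closed cube, and by continuity the function is
  positive on a piece of the cube near it. Other points are reached by translation.\<close>

lemma integral_torus_positive:
  fixes f :: "real ^ 'd \<Rightarrow> real"
  assumes "continuous_on UNIV f" "\<And>x. 0 \<le> f x" "f 0 > 0"
  shows "integral\<^sup>L torus f > 0"
proof -
  have "box (0 :: real ^ 'd) 1 \<noteq> {}" by (auto simp: box_ne_empty Basis_vec_def inner_axis)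
  moreover have "(0 :: real ^ 'd) \<in> cbox 0 1" by (auto simp: mem_box_cart)
  ultimately have "integral (cbox 0 1) f \<noteq> 0"
    using integral_cbox_eq_0_iff[of 0 1 f] assms continuous_on_subset by (metis less_irrefl subset_UNIV)
  moreover have "integral\<^sup>L torus f \<ge> 0" using assms by simp
  ultimately show ?thesis using integral_torus_cbox[OF assms(1)] by linarith
qed

text \<open>Concentration is required at 0 only; translation gives it at every point. Strict
  positivity makes the mollified densities positive, so that their logarithms are smooth.\<close>

definition approx_identity :: "(nat \<Rightarrow> (real \<times> (real ^ 'd) \<times> real) list) \<Rightarrow> bool" where
  "approx_identity K \<longleftrightarrow> (\<forall>n. int_freqs (K n) \<and> (\<forall>x. 0 < tpoly (K n) x) \<and> integral\<^sup>L torus (tpoly (K n)) = 1) \<and>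
     (\<forall>\<psi>. periodic \<psi> \<longrightarrow> continuous_on UNIV \<psi> \<longrightarrow> (\<lambda>n. \<integral>x. tpoly (K n) x * \<psi> x \<partial>torus) \<longlonglongrightarrow> \<psi> 0)"

text \<open>Normalised powers of a function k that peaks on the lattice. Away from the peak k^n is
  at most q^n, while the normalising integral \<open>Z n\<close> is at least a constant times r^n
  for some r > q.\<close>

lemma approx_identity_exists: "\<exists>K :: nat \<Rightarrow> (real \<times> (real ^ 'd) \<times> real) list. approx_identity K"
proof -
  obtain L :: "(real \<times> (real ^ 'd) \<times> real) list" where L: "int_freqs L" "\<And>x. 0 < tpoly L x" "\<And>x. tpoly L x \<le> 1"
    "tpoly L 0 = 1" "\<And>x i. tpoly L x = 1 \<Longrightarrow> x $ i \<in> \<int>"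
    using peaked_tpoly_exists by metis
  define k where "k = tpoly L"
  have ck: "continuous_on UNIV k" unfolding k_def by (intro continuous_intros)
  have pk: "periodic k" unfolding k_def by (rule periodic_tpoly) fact
  obtain P where P: "\<And>n. int_freqs (P n)" "\<And>n x. tpoly (P n) x = k x ^ n"
    using tpoly_power_exists[OF L(1)] unfolding k_def by metis
  define Z where "Z n = (\<integral>x. k x ^ n \<partial>torus)" for n
  have intk: "integrable torus (\<lambda>x. k x ^ n * \<phi> x)" if "periodic \<phi>" "continuous_on UNIV \<phi>" for n and \<phi> :: "real ^ 'd \<Rightarrow> real"
    by (rule integrable_torus) (use that pk in \<open>auto simp: periodic_def intro!: continuous_intros ck\<close>)
  have intk1: "integrable torus (\<lambda>x. k x ^ n)" for n
    using intk[of "\<lambda>_. 1" n] by (simp add: periodic_def)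
  have Zpos: "Z n > 0" for n
    unfolding Z_def by (rule integral_torus_positive) (use L in \<open>auto simp: k_def less_imp_le intro!: continuous_intros\<close>)
  define K where "K n = map (\<lambda>(a, k, \<theta>). (1 / Z n * a, k, \<theta>)) (P n)" for n
  have K: "tpoly (K n) x = k x ^ n / Z n" for n x
    unfolding K_def tpoly_scale P by simp
  have "int_freqs (K n)" for n using P(1)[of n] by (auto simp: K_def int_freqs_def)
  moreover have "0 < tpoly (K n) x" for n x unfolding K using L(2) Zpos by (simp add: k_def)
  moreover have "integral\<^sup>L torus (tpoly (K n)) = 1" for n
    using Zpos[of n] unfolding K by (simp add: Z_def)
  moreover have "(\<lambda>n. \<integral>x. tpoly (K n) x * \<psi> x \<partial>torus) \<longlonglongrightarrow> \<psi> 0"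
    if \<psi>: "periodic \<psi>" "continuous_on UNIV \<psi>" for \<psi>
  proof (rule LIMSEQ_I)
    fix \<epsilon> :: real assume "\<epsilon> > 0"
    define e where "e = \<epsilon> / 2"
    have e: "e > 0" using \<open>\<epsilon> > 0\<close> by (simp add: e_def)
    obtain C where C: "C > 0" "\<And>x. \<bar>\<psi> x\<bar> \<le> C" using periodic_continuous_bounded[OF \<psi>] by blast
    \<comment> \<open>The bad set is defined by \<psi> and not by the distance from 0: since \<psi>
      is periodic, all corners of the cube, where k = 1, are excluded at once.\<close>
    define A where "A = cbox 0 1 \<inter> {x. e \<le> \<bar>\<psi> x - \<psi> 0\<bar>}"
    have "closed {x. e \<le> \<bar>\<psi> x - \<psi> 0\<bar>}"
      by (intro closed_Collect_le continuous_intros \<psi>)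
    then have "compact A" unfolding A_def by (intro compact_Int_closed compact_cbox)
    have k1: "k x < 1" if "x \<in> A" for x
    proof (rule ccontr)
      assume "\<not> k x < 1"
      then have "k x = 1" using L(3)[of x] by (simp add: k_def)
      then have "\<psi> (0 + x) = \<psi> 0" using L(5) \<psi>(1) unfolding k_def by (intro periodic_shift_Ints) auto
      then show False using that e by (simp add: A_def)
    qed
    have "\<exists>q<1. 0 \<le> q \<and> (\<forall>x\<in>A. k x \<le> q)"
    proof (cases "A = {}")
      case True
      then show ?thesis by (intro exI[of _ 0]) auto
    next
      case False
      obtain x where "x \<in> A" "\<And>y. y \<in> A \<Longrightarrow> k y \<le> k x"
        using continuous_attains_sup[OF \<open>compact A\<close> False continuous_on_subset[OF ck]] by auto
      then show ?thesis using k1 L(2)[of x] by (intro exI[of _ "k x"]) (auto simp: k_def less_imp_le)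
    qed
    then obtain q where q: "q < 1" "0 \<le> q" "\<And>x. x \<in> A \<Longrightarrow> k x \<le> q" by blast
    \<comment> \<open>Any level strictly between q and 1 would do. The integral \<open>p\<close> of
      the part of k above r is a continuous substitute for the measure of the set where k exceeds
      r.\<close>
    define r where "r = (q + 1) / 2"
    have r: "q < r" "r < 1" "0 < r" using q by (auto simp: r_def)
    define p where "p = (\<integral>x. max 0 (k x - r) \<partial>torus)"
    have cmax: "continuous_on UNIV (\<lambda>x. max 0 (k x - r))" by (intro continuous_intros ck)
    have "p > 0" unfolding p_def by (rule integral_torus_positive) (use cmax r L(4) in \<open>auto simp: k_def\<close>)
    have Zp: "r ^ n * p \<le> Z n" for n
    proof -
      have "(\<integral>x. r ^ n * max 0 (k x - r) \<partial>torus) \<le> (\<integral>x. k x ^ n \<partial>torus)"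
      proof (rule integral_mono[OF _ intk1])
        show "integrable torus (\<lambda>x. r ^ n * max 0 (k x - r))"
          using integrable_torus[of "\<lambda>x. max 0 (k x - r)"] cmax pk by (simp add: periodic_def)
        fix x
        show "r ^ n * max 0 (k x - r) \<le> k x ^ n"
        proof (cases "r \<le> k x")
          case True
          then have "r ^ n * (k x - r) \<le> k x ^ n * 1"
            using r L(3)[of x] by (intro mult_mono power_mono) (auto simp: k_def)
          then show ?thesis using True by simp
        qed (use L(2)[of x] in \<open>simp add: k_def less_imp_le\<close>)
      qed
      then show ?thesis by (simp add: p_def Z_def)
    qed
    have bound: "\<bar>(\<integral>x. tpoly (K n) x * \<psi> x \<partial>torus) - \<psi> 0\<bar> \<le> e + 2 * C / p * (q / r) ^ n" for n
    proof -
      have "(\<integral>x. k x ^ n * (\<psi> x - \<psi> 0) \<partial>torus) = Z n * ((\<integral>x. tpoly (K n) x * \<psi> x \<partial>torus) - \<psi> 0)"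
        using Zpos[of n] intk[OF \<psi>] intk1 unfolding K Z_def[symmetric]
        by (simp add: right_diff_distrib Z_def[symmetric])
      then have "Z n * \<bar>(\<integral>x. tpoly (K n) x * \<psi> x \<partial>torus) - \<psi> 0\<bar> = \<bar>\<integral>x. k x ^ n * (\<psi> x - \<psi> 0) \<partial>torus\<bar>"
        using Zpos[of n] by (simp add: abs_mult)
      also have "\<dots> \<le> (\<integral>x. \<bar>k x ^ n * (\<psi> x - \<psi> 0)\<bar> \<partial>torus)"
        by (rule integral_abs_bound)
      also have "\<dots> \<le> (\<integral>x. e * k x ^ n + 2 * C * q ^ n \<partial>torus)"
      proof (rule integral_mono)
        show "integrable torus (\<lambda>x. \<bar>k x ^ n * (\<psi> x - \<psi> 0)\<bar>)"
          by (rule integrable_abs, rule intk) (use \<psi> in \<open>auto simp: periodic_def intro!: continuous_intros\<close>)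
        show "integrable torus (\<lambda>x. e * k x ^ n + 2 * C * q ^ n)" using intk1 by simp
        fix x :: "real ^ 'd" assume "x \<in> space torus"
        then have x: "x \<in> cbox 0 1" using unit_cube_subset_cbox by auto
        have kp: "0 < k x" using L(2) by (simp add: k_def)
        show "\<bar>k x ^ n * (\<psi> x - \<psi> 0)\<bar> \<le> e * k x ^ n + 2 * C * q ^ n"
        proof (cases "x \<in> A")
          case True
          have "k x ^ n * \<bar>\<psi> x - \<psi> 0\<bar> \<le> q ^ n * (2 * C)"
            using q(3)[OF True] kp C(2)[of x] C(2)[of 0] q(2) by (intro mult_mono power_mono) auto
          moreover have "0 \<le> e * k x ^ n" using kp e by simp
          ultimately show ?thesis using kp by (simp add: abs_mult mult.commute)
        next
          case False
          then have "\<bar>\<psi> x - \<psi> 0\<bar> \<le> e" using x by (simp add: A_def)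
          then have "k x ^ n * \<bar>\<psi> x - \<psi> 0\<bar> \<le> k x ^ n * e" using kp by (intro mult_left_mono) auto
          moreover have "0 \<le> 2 * C * q ^ n" using C q by simp
          moreover have "\<bar>k x ^ n * (\<psi> x - \<psi> 0)\<bar> = k x ^ n * \<bar>\<psi> x - \<psi> 0\<bar>" using kp by (simp add: abs_mult)
          ultimately show ?thesis by (simp only: mult.commute[of e])
        qed
      qed
      also have "\<dots> = e * Z n + 2 * C * q ^ n"
        using intk1[of n] by (simp add: Z_def torus.prob_space del: space_torus)
      also have "\<dots> \<le> e * Z n + Z n * (2 * C / p * (q / r) ^ n)"
      proof -
        have "2 * C * q ^ n = (r ^ n * p) * (2 * C / p * (q / r) ^ n)"
          using \<open>p > 0\<close> r by (simp add: power_divide)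
        also have "\<dots> \<le> Z n * (2 * C / p * (q / r) ^ n)"
          using Zp[of n] C \<open>p > 0\<close> q r by (intro mult_right_mono) auto
        finally show ?thesis by simp
      qed
      finally have "Z n * \<bar>(\<integral>x. tpoly (K n) x * \<psi> x \<partial>torus) - \<psi> 0\<bar> \<le> Z n * (e + 2 * C / p * (q / r) ^ n)"
        by (simp add: algebra_simps)
      then show ?thesis using Zpos[of n] by simp
    qed
    have "(\<lambda>n. 2 * C / p * (q / r) ^ n) \<longlonglongrightarrow> 2 * C / p * 0"
      using q r by (intro tendsto_mult tendsto_const LIMSEQ_power_zero) simp
    then have "eventually (\<lambda>n. 2 * C / p * (q / r) ^ n < e) sequentially"
      using e by (auto intro: order_tendstoD)
    then obtain N where N: "\<And>n. n \<ge> N \<Longrightarrow> 2 * C / p * (q / r) ^ n < e"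
      unfolding eventually_sequentially by blast
    show "\<exists>N. \<forall>n\<ge>N. norm ((\<integral>x. tpoly (K n) x * \<psi> x \<partial>torus) - \<psi> 0) < \<epsilon>"
    proof (intro exI[of _ N] allI impI)
      fix n assume "N \<le> n"
      then show "norm ((\<integral>x. tpoly (K n) x * \<psi> x \<partial>torus) - \<psi> 0) < \<epsilon>"
        using bound[of n] N[of n] unfolding e_def by simp
    qed
  qed
  ultimately have "approx_identity K" unfolding approx_identity_def by blast
  then show ?thesis by blast
qed

text \<open>The kernel is taken at x - y and integrated in x, so that translating x by y reduces the
  limit to the one at 0.\<close>

lemma approx_identity_conv:
  fixes \<phi> :: "real ^ 'd \<Rightarrow> real"
  assumes K: "approx_identity K" and \<phi>: "periodic \<phi>" "continuous_on UNIV \<phi>"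
  shows "(\<lambda>n. \<integral>x. tpoly (K n) (x - y) * \<phi> x \<partial>torus) \<longlonglongrightarrow> \<phi> y"
    and "integral\<^sup>L torus (\<lambda>x. tpoly (K n) (x - y)) = 1"
    and "(\<And>x. \<bar>\<phi> x\<bar> \<le> C) \<Longrightarrow> \<bar>\<integral>x. tpoly (K n) (x - y) * \<phi> x \<partial>torus\<bar> \<le> C"
proof -
  have Kn: "int_freqs (K n)" "0 < tpoly (K n) x" "integral\<^sup>L torus (tpoly (K n)) = 1" for n x
    using K by (auto simp: approx_identity_def)
  have pK: "periodic (tpoly (K n))" for n by (rule periodic_tpoly) (rule Kn)
  have shift: "integral\<^sup>L torus (\<lambda>x. tpoly (K n) (x - y) * \<psi> x) = integral\<^sup>L torus (\<lambda>x. tpoly (K n) x * \<psi> (x + y))"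
    if "periodic \<psi>" "continuous_on UNIV \<psi>" for n \<psi>
  proof -
    have "periodic (\<lambda>x. tpoly (K n) x * \<psi> (x + y))"
      using pK[of n] periodic_shift[OF that(1), of y] by (simp add: periodic_def)
    moreover have "continuous_on UNIV (\<lambda>x. tpoly (K n) x * \<psi> (x + y))"
      by (intro continuous_intros continuous_on_shift that)
    ultimately show ?thesis using integral_torus_shift[of "\<lambda>x. tpoly (K n) x * \<psi> (x + y)" "- y"] by simp
  qed
  have "(\<lambda>n. \<integral>x. tpoly (K n) x * \<phi> (x + y) \<partial>torus) \<longlonglongrightarrow> \<phi> (0 + y)"
    using K periodic_shift[OF \<phi>(1), of y] continuous_on_shift[OF \<phi>(2), of y] unfolding approx_identity_def by blast
  then show "(\<lambda>n. \<integral>x. tpoly (K n) (x - y) * \<phi> x \<partial>torus) \<longlonglongrightarrow> \<phi> y"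
    unfolding shift[OF \<phi>] by simp
  show 1: "integral\<^sup>L torus (\<lambda>x. tpoly (K n) (x - y)) = 1"
    using shift[of "\<lambda>_. 1" n] Kn(3) by (simp add: periodic_def)
  assume C: "\<And>x. \<bar>\<phi> x\<bar> \<le> C"
  have iK: "integrable torus (\<lambda>x. tpoly (K n) (x - y))"
    using periodic_shift[OF pK[of n], of "- y"] by (intro integrable_torus continuous_intros) auto
  have "\<bar>\<integral>x. tpoly (K n) (x - y) * \<phi> x \<partial>torus\<bar> \<le> (\<integral>x. \<bar>tpoly (K n) (x - y) * \<phi> x\<bar> \<partial>torus)"
    by (rule integral_abs_bound)
  also have "\<dots> \<le> (\<integral>x. tpoly (K n) (x - y) * C \<partial>torus)"
  proof (rule integral_mono)
    have "periodic (\<lambda>x. tpoly (K n) (x - y) * \<phi> x)"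
      using periodic_shift[OF pK[of n], of "- y"] \<phi>(1) by (simp add: periodic_def)
    then show "integrable torus (\<lambda>x. \<bar>tpoly (K n) (x - y) * \<phi> x\<bar>)"
      by (intro integrable_abs integrable_torus continuous_intros \<phi>)
    show "integrable torus (\<lambda>x. tpoly (K n) (x - y) * C)" using iK by simp
    show "\<bar>tpoly (K n) (x - y) * \<phi> x\<bar> \<le> tpoly (K n) (x - y) * C" for x
      using Kn(2)[of n "x - y"] C[of x] by (simp add: abs_mult mult_left_mono)
  qed
  also have "\<dots> = C" using 1 iK by simp
  finally show "\<bar>\<integral>x. tpoly (K n) (x - y) * \<phi> x \<partial>torus\<bar> \<le> C" .
qed

subsection \<open>Convolution of a trigonometric polynomial with a measure\<close>

text \<open>The list for the function sending x to the integral of L (x - y) g y over \<rho>. By the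
  addition theorem each mode splits into two, with the cosine and sine moments of g \<rho> as
  coefficients, so the mollification is itself a trigonometric polynomial for an arbitrary
  \<rho>.\<close>

definition tpoly_conv :: "(real ^ 'd) measure \<Rightarrow> (real ^ 'd \<Rightarrow> real) \<Rightarrow> (real \<times> (real ^ 'd) \<times> real) list
    \<Rightarrow> (real \<times> (real ^ 'd) \<times> real) list" where
  "tpoly_conv \<rho> g L = concat (map (\<lambda>(a, k, \<theta>).
     [(a * (\<integral>y. cos (2 * pi * (k \<bullet> y)) * g y \<partial>\<rho>), k, \<theta>),
      (a * (\<integral>y. sin (2 * pi * (k \<bullet> y)) * g y \<partial>\<rho>), k, \<theta> - pi / 2)]) L)"

lemma tpoly_conv_simps [simp]:
  "tpoly_conv \<rho> g [] = []"
  "tpoly_conv \<rho> g ((a, k, \<theta>) # L) =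
     (a * (\<integral>y. cos (2 * pi * (k \<bullet> y)) * g y \<partial>\<rho>), k, \<theta>) #
     (a * (\<integral>y. sin (2 * pi * (k \<bullet> y)) * g y \<partial>\<rho>), k, \<theta> - pi / 2) # tpoly_conv \<rho> g L"
  by (auto simp: tpoly_conv_def)

lemma int_freqs_conv [simp]: "int_freqs L \<Longrightarrow> int_freqs (tpoly_conv \<rho> g L)"
  by (induction L) auto

lemma tpoly_partial_conv: "tpoly (tpoly_partial i (tpoly_conv \<rho> g L)) x = tpoly (tpoly_conv \<rho> g (tpoly_partial i L)) x"
  by (induction L) auto

lemma integrable_bounded_continuous_mult:
  fixes \<phi> :: "real ^ 'd \<Rightarrow> real" and g :: "real ^ 'd \<Rightarrow> 'b :: {banach, second_countable_topology}"
  assumes "sets \<rho> = sets torus" "integrable \<rho> g" "continuous_on UNIV \<phi>" "\<And>x. \<bar>\<phi> x\<bar> \<le> C"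
  shows "integrable \<rho> (\<lambda>y. \<phi> y *\<^sub>R g y)"
proof (rule Bochner_Integration.integrable_bound)
  show "integrable \<rho> (\<lambda>y. C *\<^sub>R g y)" using assms(2) by simp
  have "\<phi> \<in> borel_measurable \<rho>"
    using measurable_torus_continuous[OF assms(3)] measurable_cong_sets[OF assms(1) refl] by blast
  then show "(\<lambda>y. \<phi> y *\<^sub>R g y) \<in> borel_measurable \<rho>" using assms(2) by simp
  have "\<bar>\<phi> x\<bar> \<le> \<bar>C\<bar>" for x using assms(4)[of x] by simp
  then show "AE x in \<rho>. norm (\<phi> x *\<^sub>R g x) \<le> norm (C *\<^sub>R g x)" by (simp add: mult_right_mono)
qed

lemma integrable_trig_mult:
  fixes g :: "real ^ 'd \<Rightarrow> real"
  assumes "sets \<rho> = sets torus" "integrable \<rho> g"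
  shows "integrable \<rho> (\<lambda>y. cos (2 * pi * (k \<bullet> y)) * g y)" "integrable \<rho> (\<lambda>y. sin (2 * pi * (k \<bullet> y)) * g y)"
proof -
  have c: "continuous_on UNIV (\<lambda>y. cos (2 * pi * (k \<bullet> y)))" "continuous_on UNIV (\<lambda>y. sin (2 * pi * (k \<bullet> y)))"
    by (intro continuous_intros)+
  show "integrable \<rho> (\<lambda>y. cos (2 * pi * (k \<bullet> y)) * g y)" "integrable \<rho> (\<lambda>y. sin (2 * pi * (k \<bullet> y)) * g y)"
    using integrable_bounded_continuous_mult[OF assms c(1), of 1] integrable_bounded_continuous_mult[OF assms c(2), of 1] by auto
qed

lemma tpoly_conv_integral:
  fixes g :: "real ^ 'd \<Rightarrow> real"
  assumes "sets \<rho> = sets torus" "integrable \<rho> g"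
  shows "has_bochner_integral \<rho> (\<lambda>y. tpoly L (x - y) * g y) (tpoly (tpoly_conv \<rho> g L) x)"
proof (induction L)
  case (Cons p L)
  obtain a k \<theta> where p: "p = (a, k, \<theta>)" by (cases p)
  let ?A = "2 * pi * (k \<bullet> x) + \<theta>"
  have "has_bochner_integral \<rho> (\<lambda>y. a * cos ?A * (cos (2 * pi * (k \<bullet> y)) * g y) + a * sin ?A * (sin (2 * pi * (k \<bullet> y)) * g y))
     (a * cos ?A * (\<integral>y. cos (2 * pi * (k \<bullet> y)) * g y \<partial>\<rho>) + a * sin ?A * (\<integral>y. sin (2 * pi * (k \<bullet> y)) * g y \<partial>\<rho>))"
    using integrable_trig_mult[OF assms, of k]
    by (intro has_bochner_integral_add has_bochner_integral_mult_right has_bochner_integral_integrable)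
  from has_bochner_integral_add[OF this Cons]
  have *: "has_bochner_integral \<rho> (\<lambda>y. a * cos ?A * (cos (2 * pi * (k \<bullet> y)) * g y) + a * sin ?A * (sin (2 * pi * (k \<bullet> y)) * g y) + tpoly L (x - y) * g y)
     (a * cos ?A * (\<integral>y. cos (2 * pi * (k \<bullet> y)) * g y \<partial>\<rho>) + a * sin ?A * (\<integral>y. sin (2 * pi * (k \<bullet> y)) * g y \<partial>\<rho>) + tpoly (tpoly_conv \<rho> g L) x)" .
  have "2 * pi * (k \<bullet> (x - y)) + \<theta> = ?A - 2 * pi * (k \<bullet> y)" for y
    by (simp add: inner_diff_right algebra_simps)
  then have c: "cos (2 * pi * (k \<bullet> (x - y)) + \<theta>) = cos ?A * cos (2 * pi * (k \<bullet> y)) + sin ?A * sin (2 * pi * (k \<bullet> y))" for y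
    by (simp only: cos_diff)
  have s: "cos (2 * pi * (k \<bullet> x) + (\<theta> - pi / 2)) = sin ?A"
    using cos_diff[of ?A "pi / 2"] by (simp add: algebra_simps)
  show ?case
    using * unfolding p tpoly_simps tpoly_conv_simps c s by (simp add: algebra_simps)
qed (simp add: has_bochner_integral_zero)

text \<open>Fubini's theorem for kernels of finite rank: each mode separates x from y, so that
  linearity replaces product measures.\<close>

lemma tpoly_conv_swap:
  fixes g \<phi> :: "real ^ 'd \<Rightarrow> real"
  assumes \<rho>: "sets \<rho> = sets torus" "integrable \<rho> g" and \<phi>: "periodic \<phi>" "continuous_on UNIV \<phi>" and L: "int_freqs L"
  shows "has_bochner_integral \<rho> (\<lambda>y. (\<integral>x. tpoly L (x - y) * \<phi> x \<partial>torus) * g y)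
     (\<integral>x. tpoly (tpoly_conv \<rho> g L) x * \<phi> x \<partial>torus)"
  using L
proof (induction L)
  case (Cons p L)
  obtain a k \<theta> where p: "p = (a, k, \<theta>)" by (cases p)
  have L: "int_freqs L" using Cons p by simp
  let ?A = "\<lambda>x. 2 * pi * (k \<bullet> x) + \<theta>"
  have int\<phi>: "integrable torus \<phi>" by (rule integrable_torus) fact+
  define P Q where "P = (\<integral>x. cos (?A x) * \<phi> x \<partial>torus)" and "Q = (\<integral>x. sin (?A x) * \<phi> x \<partial>torus)"
  have iP: "integrable torus (\<lambda>x. cos (?A x) * \<phi> x)" "integrable torus (\<lambda>x. sin (?A x) * \<phi> x)"
  proof -
    have c: "continuous_on UNIV (\<lambda>x. cos (?A x))" "continuous_on UNIV (\<lambda>x. sin (?A x))"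
      by (intro continuous_intros)+
    show "integrable torus (\<lambda>x. cos (?A x) * \<phi> x)" "integrable torus (\<lambda>x. sin (?A x) * \<phi> x)"
      using integrable_bounded_continuous_mult[OF refl int\<phi> c(1), of 1] integrable_bounded_continuous_mult[OF refl int\<phi> c(2), of 1] by auto
  qed
  have iL: "integrable torus (\<lambda>x. tpoly M x * \<phi> x)" if M: "int_freqs M" for M
  proof -
    obtain C where "\<And>x. \<bar>tpoly M x\<bar> \<le> C"
      by (rule periodic_continuous_bounded[OF periodic_tpoly[OF M] continuous_on_tpoly[OF continuous_on_id]]) blast
    from integrable_bounded_continuous_mult[OF refl int\<phi> continuous_on_tpoly[OF continuous_on_id] this] show ?thesis by simp
  qed
  have iLs: "integrable torus (\<lambda>x. tpoly L (x - y) * \<phi> x)" for y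
  proof -
    obtain C where "\<And>x. \<bar>tpoly L x\<bar> \<le> C"
      by (rule periodic_continuous_bounded[OF periodic_tpoly[OF L] continuous_on_tpoly[OF continuous_on_id]]) blast
    moreover have "continuous_on UNIV (\<lambda>x. tpoly L (x - y))" by (intro continuous_intros)
    ultimately show ?thesis using integrable_bounded_continuous_mult[OF refl int\<phi>, of "\<lambda>x. tpoly L (x - y)" C] by simp
  qed
  have c: "cos (2 * pi * (k \<bullet> (x - y)) + \<theta>) = cos (?A x) * cos (2 * pi * (k \<bullet> y)) + sin (?A x) * sin (2 * pi * (k \<bullet> y))" for x y
    using cos_diff[of "?A x" "2 * pi * (k \<bullet> y)"] by (simp add: inner_diff_right algebra_simps)
  have s: "cos (2 * pi * (k \<bullet> x) + (\<theta> - pi / 2)) = sin (?A x)" for x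
    using cos_diff[of "?A x" "pi / 2"] by (simp add: algebra_simps)
  have inner: "(\<integral>x. tpoly (p # L) (x - y) * \<phi> x \<partial>torus)
      = a * (cos (2 * pi * (k \<bullet> y)) * P + sin (2 * pi * (k \<bullet> y)) * Q) + (\<integral>x. tpoly L (x - y) * \<phi> x \<partial>torus)" for y
  proof -
    have "(\<integral>x. tpoly (p # L) (x - y) * \<phi> x \<partial>torus)
      = (\<integral>x. (a * cos (2 * pi * (k \<bullet> y))) * (cos (?A x) * \<phi> x) + (a * sin (2 * pi * (k \<bullet> y))) * (sin (?A x) * \<phi> x)
            + tpoly L (x - y) * \<phi> x \<partial>torus)"
      unfolding p tpoly_simps c by (simp add: algebra_simps)
    also have "\<dots> = (a * cos (2 * pi * (k \<bullet> y))) * P + (a * sin (2 * pi * (k \<bullet> y))) * Q + (\<integral>x. tpoly L (x - y) * \<phi> x \<partial>torus)"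
      using iP iLs[of y] unfolding P_def Q_def by simp
    finally show ?thesis by (simp add: algebra_simps)
  qed
  define Cg Sg where "Cg = (\<integral>y. cos (2 * pi * (k \<bullet> y)) * g y \<partial>\<rho>)" and "Sg = (\<integral>y. sin (2 * pi * (k \<bullet> y)) * g y \<partial>\<rho>)"
  have "(\<integral>x. tpoly (tpoly_conv \<rho> g (p # L)) x * \<phi> x \<partial>torus)
      = (\<integral>x. (a * Cg) * (cos (?A x) * \<phi> x) + (a * Sg) * (sin (?A x) * \<phi> x) + tpoly (tpoly_conv \<rho> g L) x * \<phi> x \<partial>torus)"
    unfolding p tpoly_conv_simps tpoly_simps s Cg_def[symmetric] Sg_def[symmetric] by (simp add: algebra_simps)
  also have "\<dots> = (a * Cg) * P + (a * Sg) * Q + (\<integral>x. tpoly (tpoly_conv \<rho> g L) x * \<phi> x \<partial>torus)"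
    using iP iL[OF int_freqs_conv[OF L]] unfolding P_def Q_def by simp
  finally have outer: "(\<integral>x. tpoly (tpoly_conv \<rho> g (p # L)) x * \<phi> x \<partial>torus)
      = (a * P) * Cg + (a * Q) * Sg + (\<integral>x. tpoly (tpoly_conv \<rho> g L) x * \<phi> x \<partial>torus)" by (simp add: algebra_simps)
  have "has_bochner_integral \<rho> (\<lambda>y. (a * P) * (cos (2 * pi * (k \<bullet> y)) * g y) + (a * Q) * (sin (2 * pi * (k \<bullet> y)) * g y)
      + (\<integral>x. tpoly L (x - y) * \<phi> x \<partial>torus) * g y) (\<integral>x. tpoly (tpoly_conv \<rho> g (p # L)) x * \<phi> x \<partial>torus)"
    unfolding outer Cg_def Sg_def
    using integrable_trig_mult[OF \<rho>, of k]
    by (intro has_bochner_integral_add has_bochner_integral_mult_right has_bochner_integral_integrable Cons.IH L)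
  then show ?case unfolding inner by (simp add: algebra_simps)
qed (simp add: has_bochner_integral_zero)

section \<open>The logarithmic Sobolev inequality on the torus\<close>

subsection \<open>Approximation of bounded measurable functions\<close>

lemma continuous_torus_proj:
  fixes x :: "real ^ 'd"
  assumes "\<And>i. x $ i \<notin> \<int>"
  shows "continuous (at x) torus_proj"
proof -
  have "((\<lambda>y. frac (y $ i)) \<longlongrightarrow> frac (x $ i)) (at x)" for i
    using continuous_frac[OF assms] by (rule isCont_tendsto_compose) (auto intro!: tendsto_intros)
  then show ?thesis
    unfolding continuous_at torus_proj_def[abs_def] by (intro tendsto_vec_lambda)
qed

text \<open>The cut-off vanishes exactly where \<^const>\<open>torus_proj\<close> is discontinuous.\<close>

lemma continuous_on_cutoff_periodize:
  fixes g :: "real ^ 'd \<Rightarrow> real"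
  assumes g: "continuous_on UNIV g" "\<And>x. \<bar>g x\<bar> \<le> C" and "0 \<le> c"
  shows "continuous_on UNIV (\<lambda>x. g (torus_proj x) * min 1 (c * (\<Prod>i\<in>UNIV. (sin (pi * x $ i))\<^sup>2)))"
    (is "continuous_on UNIV (\<lambda>x. ?G x * ?\<chi> x)")
proof (rule continuous_at_imp_continuous_on, intro ballI)
  fix x :: "real ^ 'd"
  have \<chi>: "continuous_on UNIV ?\<chi>" by (intro continuous_intros)
  show "isCont (\<lambda>x. ?G x * ?\<chi> x) x"
  proof (cases "\<exists>i. x $ i \<in> \<int>")
    case True
    then obtain i where i: "x $ i \<in> \<int>" by blast
    then have "sin (pi * x $ i) = 0" by (metis Ints_cases mult.commute sin_npi_int)
    then have "(\<Prod>i\<in>UNIV. (sin (pi * x $ i))\<^sup>2) = 0"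
      by (subst prod_zero_iff) auto
    then have \<chi>0: "?\<chi> x = 0" by (simp only: mult_zero_right)
    have "(?\<chi> \<longlongrightarrow> 0) (at x)" using \<chi> \<chi>0 unfolding continuous_on_def by (metis UNIV_I)
    then have lim: "((\<lambda>y. C * ?\<chi> y) \<longlongrightarrow> 0) (at x)" by (rule tendsto_mult_right_zero)
    have "norm (?G y * ?\<chi> y) \<le> C * ?\<chi> y" for y
    proof -
      have "0 \<le> ?\<chi> y" using \<open>0 \<le> c\<close> by (auto intro!: mult_nonneg_nonneg prod_nonneg)
      then show ?thesis using g(2)[of "torus_proj y"] by (simp only: real_norm_def abs_mult abs_of_nonneg) (rule mult_right_mono)
    qed
    then have "((\<lambda>y. ?G y * ?\<chi> y) \<longlongrightarrow> 0) (at x)"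
      by (intro Lim_null_comparison[OF always_eventually[OF allI] lim])
    then show ?thesis unfolding continuous_at by (simp only: \<chi>0 mult_zero_right)
  next
    case False
    then have "isCont torus_proj x" by (intro continuous_torus_proj) blast
    moreover have "isCont g (torus_proj x)" using g(1) by (simp only: continuous_on_eq_continuous_at open_UNIV) blast
    ultimately have "isCont ?G x" by (rule isCont_o2)
    moreover have "isCont ?\<chi> x" using \<chi> by (simp only: continuous_on_eq_continuous_at open_UNIV) blast
    ultimately show ?thesis by (rule isCont_mult)
  qed
qed

lemma AE_torus_box: "AE x in torus. (x :: real ^ 'd) \<in> box 0 1"
proof -
  have "AE x in lborel. (x :: real ^ 'd) \<notin> cbox 0 1 - box 0 1"
    by (rule AE_not_in[OF null_sets_cbox_Diff_box])
  then have "AE x in lborel. (x :: real ^ 'd) \<in> unit_cube \<longrightarrow> x \<in> box 0 1"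
    by eventually_elim (use unit_cube_subset_cbox in auto)
  then show ?thesis
    unfolding torus_def by (subst AE_restrict_space_iff) auto
qed

text \<open>Measurability in the gauge sense supplies continuous functions that converge off a
  negligible set. Clipping keeps the bound N; the cut-off makes them continuous after periodisation
  and becomes 1 eventually at each point of the open cube.\<close>

lemma bounded_measurable_limit_of_continuous:
  fixes f :: "real ^ 'd \<Rightarrow> real"
  assumes f: "f \<in> borel_measurable torus" and N: "\<And>x. \<bar>f x\<bar> \<le> N"
  obtains \<phi> where "\<And>j :: nat. periodic (\<phi> j)" "\<And>j. continuous_on UNIV (\<phi> j)" "\<And>j x. \<bar>\<phi> j x\<bar> \<le> N"
    "AE x in torus. (\<lambda>j. \<phi> j x) \<longlonglongrightarrow> f x"
proof -
  have N0: "0 \<le> N" using N[of 0] by simp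
  have "(\<lambda>x. indicator unit_cube x *\<^sub>R f x) \<in> borel_measurable lborel"
    using f unfolding torus_def by (subst (asm) borel_measurable_restrict_space_iff) auto
  then have "(\<lambda>x. indicator unit_cube x *\<^sub>R f x) \<in> borel_measurable lebesgue"
    by (rule measurable_completion)
  then have "(\<lambda>x. indicator unit_cube x *\<^sub>R f x) measurable_on UNIV"
    by (rule lebesgue_measurable_imp_measurable_on) simp
  then obtain A g where A: "negligible A" and g: "\<And>n. continuous_on UNIV (g n)"
    "\<And>x. x \<notin> A \<Longrightarrow> (\<lambda>n. g n x) \<longlonglongrightarrow> indicator unit_cube x *\<^sub>R f x"
    unfolding measurable_on_def by auto
  define clip where "clip t = max (- N) (min N t)" for t :: real
  have clip: "\<bar>clip t\<bar> \<le> N" "\<bar>t\<bar> \<le> N \<Longrightarrow> clip t = t" for t using N0 by (auto simp: clip_def)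
  have clip_cont: "continuous_on UNIV (\<lambda>x. clip (g j x))" for j
    unfolding clip_def by (intro continuous_intros g)
  define p :: "real ^ 'd \<Rightarrow> real" where "p x = (\<Prod>i\<in>UNIV. (sin (pi * x $ i))\<^sup>2)" for x
  define \<phi> where "\<phi> j x = clip (g j (torus_proj x)) * min 1 (real j * p x)" for j x
  have pp: "periodic p"
    unfolding periodic_def
  proof (intro allI)
    fix x :: "real ^ 'd" and i
    have "(sin (pi * (x + axis i 1) $ j))\<^sup>2 = (sin (pi * x $ j))\<^sup>2" for j
      by (cases "i = j") (auto simp: axis_def distrib_left sin_add)
    then show "p (x + axis i 1) = p x" by (simp add: p_def)
  qed
  have p0: "0 \<le> p x" for x by (auto simp: p_def intro: prod_nonneg)
  show ?thesis
  proof (rule that)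
    fix j
    have "torus_proj (x + axis i 1) = torus_proj x" for x :: "real ^ 'd" and i
      by (auto simp: torus_proj_def vec_eq_iff axis_def frac_1_eq)
    then show "periodic (\<phi> j)" using pp by (simp add: periodic_def \<phi>_def)
    show "continuous_on UNIV (\<phi> j)"
      unfolding \<phi>_def p_def
      by (rule continuous_on_cutoff_periodize[where g="\<lambda>x. clip (g j x)" and C=N])
         (auto simp: clip(1) intro!: continuous_intros clip_cont)
    fix x
    have "\<bar>min 1 (real j * p x)\<bar> \<le> 1" using p0[of x] by (simp add: abs_le_iff min_def)
    then have "\<bar>\<phi> j x\<bar> \<le> N * 1" unfolding \<phi>_def abs_mult using clip N0 by (intro mult_mono) auto
    then show "\<bar>\<phi> j x\<bar> \<le> N" by simp
  next
    have "A \<in> null_sets lebesgue" using A by (simp add: negligible_iff_null_sets)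
    then have "AE x in lebesgue. x \<notin> A" by (rule AE_not_in)
    then have "AE x in lborel. x \<notin> A" by (simp add: AE_completion_iff)
    then have "AE x in torus. x \<notin> A"
      unfolding torus_def by (subst AE_restrict_space_iff) (auto elim: eventually_mono)
    with AE_torus_box show "AE x in torus. (\<lambda>j. \<phi> j x) \<longlonglongrightarrow> f x"
    proof eventually_elim
      case (elim x)
      have xi: "0 < x $ i" "x $ i < 1" for i using elim(1) by (auto simp: mem_box_cart)
      then have xc: "x \<in> unit_cube" by (simp add: unit_cube_def less_imp_le)
      have tp: "torus_proj x = x" using xi by (simp add: torus_proj_def vec_eq_iff frac_eq less_imp_le)
      have "0 < sin (pi * x $ i)" for i
        using xi[of i] by (intro sin_gt_zero) (auto simp: mult_less_cancel_left1)
      then have "0 < p x" unfolding p_def by (intro prod_pos) (simp add: less_imp_neq[symmetric])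
      have "(\<lambda>j. clip (g j x)) \<longlonglongrightarrow> clip (indicator unit_cube x *\<^sub>R f x)"
        unfolding clip_def using g(2)[OF elim(2)] by (intro tendsto_intros)
      then have 1: "(\<lambda>j. clip (g j x)) \<longlonglongrightarrow> f x" using xc clip(2)[OF N] by simp
      have "eventually (\<lambda>j. 1 \<le> real j * p x) sequentially"
      proof -
        obtain m :: nat where m: "1 / p x < real m" using reals_Archimedean2 by blast
        have "1 \<le> real j * p x" if "m \<le> j" for j
        proof -
          have "1 / p x \<le> real j" using m that by linarith
          then show ?thesis using \<open>0 < p x\<close> by (simp add: field_simps)
        qed
        then show ?thesis unfolding eventually_sequentially by blast
      qed
      then have "eventually (\<lambda>j. clip (g j x) = \<phi> j x) sequentially"
        by eventually_elim (simp add: \<phi>_def tp)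
      then show ?case using 1 by (rule Lim_transform_eventually[rotated])
    qed
  qed
qed

subsection \<open>Mollification does not increase the Fisher information\<close>

text \<open>The weighted variance of \<open>g\<close> about its weighted mean \<open>c\<close> is
  nonnegative.\<close>

lemma weighted_Cauchy_Schwarz:
  fixes w g :: "'a \<Rightarrow> real"
  assumes int: "integrable M w" "integrable M (\<lambda>x. w x * g x)" "integrable M (\<lambda>x. w x * (g x)\<^sup>2)"
    and nonneg: "\<And>x. 0 \<le> w x" and pos: "0 < integral\<^sup>L M w"
  shows "(\<integral>x. w x * g x \<partial>M)\<^sup>2 / integral\<^sup>L M w \<le> (\<integral>x. w x * (g x)\<^sup>2 \<partial>M)"
proof -
  define c where "c = (\<integral>x. w x * g x \<partial>M) / integral\<^sup>L M w"
  have "0 \<le> (\<integral>x. w x * (g x - c)\<^sup>2 \<partial>M)" using nonneg by (intro Bochner_Integration.integral_nonneg) auto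
  also have "\<dots> = (\<integral>x. w x * (g x)\<^sup>2 - 2 * c * (w x * g x) + c\<^sup>2 * w x \<partial>M)"
    by (simp add: power2_diff algebra_simps)
  also have "\<dots> = (\<integral>x. w x * (g x)\<^sup>2 \<partial>M) - 2 * c * (\<integral>x. w x * g x \<partial>M) + c\<^sup>2 * integral\<^sup>L M w"
    using int by simp
  also have "\<dots> = (\<integral>x. w x * (g x)\<^sup>2 \<partial>M) - (\<integral>x. w x * g x \<partial>M)\<^sup>2 / integral\<^sup>L M w"
    using pos by (simp add: c_def field_simps power2_eq_square)
  finally show ?thesis by simp
qed

text \<open>Brings L (x - y), as a function of y, into the form of a trigonometric polynomial, so
  that it can be a test function in weak equations.\<close>

definition tpoly_reflect :: "real ^ 'd \<Rightarrow> (real \<times> (real ^ 'd) \<times> real) list \<Rightarrow> (real \<times> (real ^ 'd) \<times> real) list" where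
  "tpoly_reflect x L = map (\<lambda>(a, k, \<theta>). (a, k, - (2 * pi * (k \<bullet> x) + \<theta>))) L"

lemma tpoly_reflect: "tpoly (tpoly_reflect x L) y = tpoly L (x - y)"
proof (induction L)
  case (Cons p L)
  obtain a k \<theta> where p: "p = (a, k, \<theta>)" by (cases p)
  have "2 * pi * (k \<bullet> y) + - (2 * pi * (k \<bullet> x) + \<theta>) = - (2 * pi * (k \<bullet> (x - y)) + \<theta>)"
    by (simp add: inner_diff_right algebra_simps)
  then have "cos (2 * pi * (k \<bullet> y) + - (2 * pi * (k \<bullet> x) + \<theta>)) = cos (2 * pi * (k \<bullet> (x - y)) + \<theta>)"
    by (simp only: cos_minus)
  then show ?case using Cons p by (simp add: tpoly_reflect_def del: minus_add_distrib)
qed (simp add: tpoly_reflect_def)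

lemma tpoly_partial_reflect: "tpoly (tpoly_partial i (tpoly_reflect x L)) y = - tpoly (tpoly_partial i L) (x - y)"
proof (induction L)
  case (Cons p L)
  obtain a k \<theta> where p: "p = (a, k, \<theta>)" by (cases p)
  let ?A = "2 * pi * (k \<bullet> (x - y)) + \<theta>"
  have e: "2 * pi * (k \<bullet> y) + (- (2 * pi * (k \<bullet> x) + \<theta>) + pi / 2) = pi / 2 - ?A"
    "2 * pi * (k \<bullet> (x - y)) + (\<theta> + pi / 2) = ?A + pi / 2"
    by (simp_all add: inner_diff_right algebra_simps)
  have "cos (pi / 2 - ?A) = - cos (?A + pi / 2)"
    unfolding cos_diff cos_add by simp
  then have "cos (2 * pi * (k \<bullet> y) + (- (2 * pi * (k \<bullet> x) + \<theta>) + pi / 2)) = - cos (2 * pi * (k \<bullet> (x - y)) + (\<theta> + pi / 2))"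
    unfolding e .
  then show ?case using Cons p by (simp add: tpoly_reflect_def del: minus_add_distrib)
qed (simp add: tpoly_reflect_def)

lemma int_freqs_reflect [simp]: "int_freqs (tpoly_reflect x L) \<longleftrightarrow> int_freqs L"
  by (auto simp: int_freqs_def tpoly_reflect_def)

lemma tpoly_bounded:
  assumes "int_freqs L"
  obtains C where "\<And>x. \<bar>tpoly L x\<bar> \<le> C"
  by (rule periodic_continuous_bounded[OF periodic_tpoly[OF assms] continuous_on_tpoly[OF continuous_on_id]]) blast

lemma integrable_tpoly_mult:
  fixes g :: "real ^ 'd \<Rightarrow> 'b :: {banach, second_countable_topology}"
  assumes "sets \<rho> = sets torus" "integrable \<rho> g" "int_freqs L"
  shows "integrable \<rho> (\<lambda>y. tpoly L y *\<^sub>R g y)" "integrable \<rho> (\<lambda>y. tpoly L (x - y) *\<^sub>R g y)"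
proof -
  obtain C where C: "\<And>x. \<bar>tpoly L x\<bar> \<le> C" using tpoly_bounded[OF assms(3)] by blast
  show "integrable \<rho> (\<lambda>y. tpoly L y *\<^sub>R g y)"
    by (rule integrable_bounded_continuous_mult[OF assms(1,2) _ C]) (intro continuous_intros)
  show "integrable \<rho> (\<lambda>y. tpoly L (x - y) *\<^sub>R g y)"
    by (rule integrable_bounded_continuous_mult[OF assms(1,2) _ C]) (intro continuous_intros)
qed

text \<open>The weak gradient is tested with L (x - y) as a function of y. The sign in its
  definition cancels the one from differentiating in y instead of x.\<close>

lemma weak_gradient_conv:
  fixes h :: "real ^ 'd \<Rightarrow> real"
  assumes wg: "weak_gradient h G" and L: "int_freqs L"
  shows "tpoly (tpoly_partial i (tpoly_conv torus h L)) x = tpoly (tpoly_conv torus (\<lambda>y. G y $ i) L) x"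
proof -
  have int: "integrable torus h" "integrable torus G" using wg by (auto simp: weak_gradient_def)
  define \<phi> where "\<phi> = tpoly (tpoly_reflect x L)"
  have Gi: "integrable torus (\<lambda>y. G y $ i)"
    using integrable_inner_left[of "axis i 1" torus G] int(2) by (simp add: inner_axis)
  have "torus_smooth \<phi>" unfolding \<phi>_def using L by (intro torus_smooth_tpoly) simp
  then have "(\<integral>y. h y *\<^sub>R grad \<phi> y \<partial>torus) = - (\<integral>y. \<phi> y *\<^sub>R G y \<partial>torus)"
    using wg by (simp add: weak_gradient_def)
  then have "(\<integral>y. h y *\<^sub>R grad \<phi> y \<partial>torus) \<bullet> axis i 1 = - (\<integral>y. \<phi> y *\<^sub>R G y \<partial>torus) \<bullet> axis i 1" by simp
  moreover have "(\<integral>y. h y *\<^sub>R grad \<phi> y \<partial>torus) \<bullet> axis i 1 = (\<integral>y. h y * - tpoly (tpoly_partial i L) (x - y) \<partial>torus)"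
  proof -
    have "h y *\<^sub>R grad \<phi> y = (\<Sum>j\<in>UNIV. (tpoly (tpoly_partial j (tpoly_reflect x L)) y *\<^sub>R h y) *\<^sub>R axis j 1)" for y
      by (simp add: vec_eq_iff grad_def \<phi>_def partial_tpoly axis_def if_distrib[of "(*) _"] cong: if_cong)
    moreover have "integrable torus (\<lambda>y. \<Sum>j\<in>UNIV. (tpoly (tpoly_partial j (tpoly_reflect x L)) y *\<^sub>R h y) *\<^sub>R (axis j 1 :: real ^ 'd))"
      by (intro Bochner_Integration.integrable_sum integrable_scaleR_left integrable_tpoly_mult(1)[OF refl int(1)]) (simp add: L)
    ultimately have "integrable torus (\<lambda>y. h y *\<^sub>R grad \<phi> y)" by simp
    then have "(\<integral>y. h y *\<^sub>R grad \<phi> y \<partial>torus) \<bullet> axis i 1 = (\<integral>y. (h y *\<^sub>R grad \<phi> y) \<bullet> axis i 1 \<partial>torus)"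
      by (intro integral_inner_left[symmetric]) simp
    then show ?thesis
      by (simp add: inner_axis grad_def \<phi>_def partial_tpoly tpoly_partial_reflect)
  qed
  moreover have "(\<integral>y. \<phi> y *\<^sub>R G y \<partial>torus) \<bullet> axis i 1 = (\<integral>y. tpoly L (x - y) * G y $ i \<partial>torus)"
  proof -
    have "integrable torus (\<lambda>y. \<phi> y *\<^sub>R G y)"
      unfolding \<phi>_def by (rule integrable_tpoly_mult(1)[OF refl int(2)]) (simp add: L)
    then have "(\<integral>y. \<phi> y *\<^sub>R G y \<partial>torus) \<bullet> axis i 1 = (\<integral>y. (\<phi> y *\<^sub>R G y) \<bullet> axis i 1 \<partial>torus)"
      by (intro integral_inner_left[symmetric]) simp
    then show ?thesis by (simp add: inner_axis \<phi>_def tpoly_reflect)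
  qed
  ultimately have "(\<integral>y. tpoly (tpoly_partial i L) (x - y) * h y \<partial>torus) = (\<integral>y. tpoly L (x - y) * G y $ i \<partial>torus)"
    by (simp add: mult.commute)
  then show ?thesis
    using tpoly_conv_integral[OF refl int(1), of "tpoly_partial i L" x] tpoly_conv_integral[OF refl Gi, of L x]
    by (simp add: tpoly_partial_conv has_bochner_integral_iff)
qed

lemma tpoly_conv_positive:
  fixes h :: "real ^ 'd \<Rightarrow> real"
  assumes \<rho>: "sets \<rho> = sets torus" "integrable \<rho> h" "\<And>x. 0 \<le> h x" "0 < integral\<^sup>L \<rho> h"
    and L: "int_freqs L" "\<And>x. 0 < tpoly L x"
  shows "0 < tpoly (tpoly_conv \<rho> h L) x"
proof -
  obtain c where c: "c > 0" "\<And>x. c \<le> tpoly L x"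
    by (rule periodic_continuous_positive[OF periodic_tpoly[OF L(1)] continuous_on_tpoly[OF continuous_on_id] L(2)]) blast
  have "0 < c * integral\<^sup>L \<rho> h" using c \<rho> by simp
  also have "\<dots> = (\<integral>y. c * h y \<partial>\<rho>)" by simp
  also have "\<dots> \<le> (\<integral>y. tpoly L (x - y) * h y \<partial>\<rho>)"
    using tpoly_conv_integral[OF \<rho>(1,2), of L x] \<rho> c
    by (intro integral_mono) (auto simp: has_bochner_integral_iff intro: mult_right_mono)
  also have "\<dots> = tpoly (tpoly_conv \<rho> h L) x"
    using tpoly_conv_integral[OF \<rho>(1,2), of L x] by (simp add: has_bochner_integral_iff)
  finally show ?thesis .
qed

text \<open>Jensen's inequality for the convex function p^2 / h of the pair (p, h), under the
  averaging with L.\<close>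

lemma tpoly_conv_Cauchy_Schwarz:
  fixes h g :: "real ^ 'd \<Rightarrow> real"
  assumes \<rho>: "sets \<rho> = sets torus" and int: "integrable \<rho> h" "integrable \<rho> (\<lambda>y. h y * g y)" "integrable \<rho> (\<lambda>y. h y * (g y)\<^sup>2)"
    and h: "\<And>x. 0 \<le> h x" "0 < integral\<^sup>L \<rho> h"
    and L: "int_freqs L" "\<And>x. 0 < tpoly L x"
  shows "(tpoly (tpoly_conv \<rho> (\<lambda>y. h y * g y) L) x)\<^sup>2 / tpoly (tpoly_conv \<rho> h L) x \<le> tpoly (tpoly_conv \<rho> (\<lambda>y. h y * (g y)\<^sup>2) L) x"
proof -
  have b: "has_bochner_integral \<rho> (\<lambda>y. tpoly L (x - y) * h y) (tpoly (tpoly_conv \<rho> h L) x)"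
    "has_bochner_integral \<rho> (\<lambda>y. tpoly L (x - y) * h y * g y) (tpoly (tpoly_conv \<rho> (\<lambda>y. h y * g y) L) x)"
    "has_bochner_integral \<rho> (\<lambda>y. tpoly L (x - y) * h y * (g y)\<^sup>2) (tpoly (tpoly_conv \<rho> (\<lambda>y. h y * (g y)\<^sup>2) L) x)"
    using tpoly_conv_integral[OF \<rho> int(1), of L x] tpoly_conv_integral[OF \<rho> int(2), of L x] tpoly_conv_integral[OF \<rho> int(3), of L x]
    by (simp_all add: mult.assoc)
  show ?thesis
    using weighted_Cauchy_Schwarz[of \<rho> "\<lambda>y. tpoly L (x - y) * h y" g] b h L tpoly_conv_positive[OF \<rho> int(1) h L, of x]
    by (simp add: has_bochner_integral_iff less_imp_le)
qed

lemma integral_tpoly_conv: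
  fixes h :: "real ^ 'd \<Rightarrow> real"
  assumes \<rho>: "sets \<rho> = sets torus" "integrable \<rho> h" and L: "int_freqs L" "integral\<^sup>L torus (tpoly L) = 1"
  shows "integral\<^sup>L torus (tpoly (tpoly_conv \<rho> h L)) = integral\<^sup>L \<rho> h"
proof -
  have "integral\<^sup>L torus (\<lambda>x. tpoly L (x - y)) = 1" for y
    using integral_torus_shift[OF periodic_tpoly[OF L(1)] continuous_on_tpoly[OF continuous_on_id], of "- y"] L(2) by simp
  then show ?thesis
    using tpoly_conv_swap[OF \<rho> _ _ L(1), of "\<lambda>_. 1"] by (simp add: periodic_def has_bochner_integral_iff)
qed

text \<open>The gradient of the mollified h is the mollification of h v, so the bound holds
  pointwise by Jensen's inequality, and mollification with a kernel of mass 1 preserves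
  integrals.\<close>

lemma mollified_Fisher_information_le:
  fixes h :: "real ^ 'd \<Rightarrow> real"
  assumes h: "\<And>x. 0 \<le> h x" "0 < integral\<^sup>L torus h" and lg: "log_gradient h v"
    and fin: "integrable torus (\<lambda>x. h x * (norm (v x))\<^sup>2)"
    and L: "int_freqs L" "\<And>x. 0 < tpoly L x" "integral\<^sup>L torus (tpoly L) = 1"
  shows "(\<Sum>i\<in>UNIV. \<integral>x. (tpoly (tpoly_partial i (tpoly_conv torus h L)) x)\<^sup>2 / tpoly (tpoly_conv torus h L) x \<partial>torus)
     \<le> (\<integral>x. h x * (norm (v x))\<^sup>2 \<partial>torus)"
proof -
  have wg: "weak_gradient h (\<lambda>x. h x *\<^sub>R v x)" and vm: "v \<in> borel_measurable torus" using lg by (auto simp: log_gradient_def)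
  have int: "integrable torus h" "integrable torus (\<lambda>x. h x *\<^sub>R v x)" using wg by (auto simp: weak_gradient_def)
  have vim: "(\<lambda>x. v x $ i) \<in> borel_measurable torus" for i
  proof -
    have "(\<lambda>x. v x \<bullet> axis i 1) \<in> borel_measurable torus" using vm by measurable
    then show ?thesis by (simp add: inner_axis)
  qed
  have hm: "h \<in> borel_measurable torus" using int by simp
  have i1: "integrable torus (\<lambda>y. h y * v y $ i)" for i
    using integrable_inner_left[of "axis i 1" torus "\<lambda>x. h x *\<^sub>R v x"] int(2) by (simp add: inner_axis)
  have i2: "integrable torus (\<lambda>y. h y * (v y $ i)\<^sup>2)" for i
  proof (rule Bochner_Integration.integrable_bound[OF fin])
    show "(\<lambda>y. h y * (v y $ i)\<^sup>2) \<in> borel_measurable torus" using hm vim by simp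
    have "(v y $ i)\<^sup>2 \<le> (norm (v y))\<^sup>2" for y
      using component_le_norm_cart[of "v y" i] by (metis abs_le_square_iff abs_norm_cancel)
    then show "AE y in torus. norm (h y * (v y $ i)\<^sup>2) \<le> norm (h y * (norm (v y))\<^sup>2)"
      using h(1) by (auto simp: abs_mult intro!: mult_left_mono)
  qed
  have norm_eq: "(norm (v y))\<^sup>2 = (\<Sum>i\<in>UNIV. (v y $ i)\<^sup>2)" for y
    by (simp add: norm_vec_def L2_set_def sum_nonneg)
  have pt: "(tpoly (tpoly_partial i (tpoly_conv torus h L)) x)\<^sup>2 / tpoly (tpoly_conv torus h L) x
      \<le> tpoly (tpoly_conv torus (\<lambda>y. h y * (v y $ i)\<^sup>2) L) x" for i x
    using tpoly_conv_Cauchy_Schwarz[OF refl int(1) i1 i2 h L(1,2)] weak_gradient_conv[OF wg L(1), of i x] by simp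
  have cf: "int_freqs (tpoly_conv torus g L)" for g :: "real ^ 'd \<Rightarrow> real" using L(1) by simp
  have ct: "continuous_on UNIV (tpoly M)" for M :: "(real \<times> (real ^ 'd) \<times> real) list" by (intro continuous_intros)
  have pos: "0 < tpoly (tpoly_conv torus h L) x" for x by (rule tpoly_conv_positive[OF refl int(1) h L(1,2)])
  have "(\<integral>x. (tpoly (tpoly_partial i (tpoly_conv torus h L)) x)\<^sup>2 / tpoly (tpoly_conv torus h L) x \<partial>torus)
     \<le> (\<integral>y. h y * (v y $ i)\<^sup>2 \<partial>torus)" for i
  proof -
    have "(\<integral>x. (tpoly (tpoly_partial i (tpoly_conv torus h L)) x)\<^sup>2 / tpoly (tpoly_conv torus h L) x \<partial>torus)
       \<le> integral\<^sup>L torus (tpoly (tpoly_conv torus (\<lambda>y. h y * (v y $ i)\<^sup>2) L))"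
    proof (rule integral_mono[OF _ _ pt])
      show "integrable torus (tpoly (tpoly_conv torus (\<lambda>y. h y * (v y $ i)\<^sup>2) L))"
        by (intro integrable_torus periodic_tpoly cf ct)
      have "periodic (\<lambda>x. (tpoly (tpoly_partial i (tpoly_conv torus h L)) x)\<^sup>2 / tpoly (tpoly_conv torus h L) x)"
        using periodic_tpoly[OF cf[of h]] periodic_tpoly[of "tpoly_partial i (tpoly_conv torus h L)"] cf[of h] by (simp add: periodic_def)
      then show "integrable torus (\<lambda>x. (tpoly (tpoly_partial i (tpoly_conv torus h L)) x)\<^sup>2 / tpoly (tpoly_conv torus h L) x)"
        by (intro integrable_torus continuous_intros ct) (use pos in \<open>auto simp: less_imp_neq[symmetric]\<close>)
    qed
    then show ?thesis using integral_tpoly_conv[OF refl i2 L(1,3)] by simp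
  qed
  then have "(\<Sum>i\<in>UNIV. \<integral>x. (tpoly (tpoly_partial i (tpoly_conv torus h L)) x)\<^sup>2 / tpoly (tpoly_conv torus h L) x \<partial>torus)
      \<le> (\<Sum>i\<in>UNIV. \<integral>y. h y * (v y $ i)\<^sup>2 \<partial>torus)" by (intro sum_mono)
  also have "\<dots> = (\<integral>x. h x * (norm (v x))\<^sup>2 \<partial>torus)"
    unfolding norm_eq using i2 by (simp add: sum_distrib_left Bochner_Integration.integral_sum)
  finally show ?thesis .
qed

subsection \<open>Entropy and its dual description\<close>

text \<open>The Bregman form of the entropy. It is nonnegative for every m > 0, not just for the
  mean of the density, and therefore monotone under a change of reference measure. At t = 0 it takes
  the correct value m.\<close>

definition entropy_gap :: "real \<Rightarrow> real \<Rightarrow> real" where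
  "entropy_gap m t = t * ln (t / m) - t + m"

text \<open>Legendre duality: the left-hand side is concave in \<phi> and maximal at ln (t / m), by
  convexity of the exponential.\<close>

lemma entropy_gap_dual:
  assumes "m > 0" "t \<ge> 0"
  shows "t * \<phi> - m * (exp \<phi> - 1) \<le> entropy_gap m t"
proof (cases "t = 0")
  case True
  then show ?thesis using assms by (simp add: entropy_gap_def algebra_simps)
next
  case False
  define s where "s = ln (t / m)"
  have t: "t = m * exp s" using False assms by (simp add: s_def)
  have "1 + (\<phi> - s) \<le> exp (\<phi> - s)" by (rule exp_ge_add_one_self)
  then have "exp s * (1 + (\<phi> - s)) \<le> exp s * exp (\<phi> - s)" by (intro mult_left_mono) auto
  then have "exp s * (1 + (\<phi> - s)) \<le> exp \<phi>" by (simp add: exp_diff)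
  then have "m * (exp s * (1 + (\<phi> - s))) \<le> m * exp \<phi>" using assms by (intro mult_left_mono) auto
  then show ?thesis
    unfolding entropy_gap_def s_def[symmetric] unfolding t by (simp add: algebra_simps)
qed

lemma entropy_gap_nonneg: "m > 0 \<Longrightarrow> t \<ge> 0 \<Longrightarrow> 0 \<le> entropy_gap m t"
  using entropy_gap_dual[of m t 0] by simp

text \<open>The optimal dual variable, truncated to stay bounded. The value at t = 0 is set by hand,
  since ln 0 is 0 by convention where - \<infinity> would be needed.\<close>

definition clipped_log :: "nat \<Rightarrow> real \<Rightarrow> real \<Rightarrow> real" where
  "clipped_log N m t = (if t = 0 then - real N else max (- real N) (min (real N) (ln (t / m))))"

lemma clipped_log_bounded: "\<bar>clipped_log N m t\<bar> \<le> real N"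
  by (auto simp: clipped_log_def)

text \<open>The dual expression is concave in \<phi>, vanishes at 0 and is maximal at ln (t / m),
  and the truncation lies between these two points. Nonnegativity is what makes Fatou's lemma
  applicable later.\<close>

lemma clipped_log_dual_nonneg:
  assumes "m > 0" "t \<ge> 0"
  shows "0 \<le> t * clipped_log N m t - m * (exp (clipped_log N m t) - 1)"
proof -
  let ?\<phi> = "clipped_log N m t"
  have "0 \<le> (t - m * exp ?\<phi>) * ?\<phi>"
  proof (cases "t = 0")
    case True
    then show ?thesis using assms by (simp add: clipped_log_def)
  next
    case False
    define s where "s = ln (t / m)"
    have t: "t = m * exp s" using False assms by (simp add: s_def)
    have \<phi>: "?\<phi> = max (- real N) (min (real N) s)" using False by (simp add: clipped_log_def s_def)
    have "(0 \<le> ?\<phi> \<and> ?\<phi> \<le> s) \<or> (?\<phi> \<le> 0 \<and> s \<le> ?\<phi>)" unfolding \<phi> by auto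
    then show ?thesis
    proof
      assume "0 \<le> ?\<phi> \<and> ?\<phi> \<le> s"
      then show ?thesis unfolding t using assms by (intro mult_nonneg_nonneg) auto
    next
      assume "?\<phi> \<le> 0 \<and> s \<le> ?\<phi>"
      then show ?thesis unfolding t using assms by (intro mult_nonpos_nonpos) auto
    qed
  qed
  moreover have "0 \<le> m * (exp ?\<phi> * ?\<phi> - exp ?\<phi> + 1)"
  proof -
    have "1 + (- ?\<phi>) \<le> exp (- ?\<phi>)" by (rule exp_ge_add_one_self)
    then have "exp ?\<phi> * (1 + (- ?\<phi>)) \<le> exp ?\<phi> * exp (- ?\<phi>)" by (intro mult_left_mono) auto
    then have "0 \<le> exp ?\<phi> * ?\<phi> - exp ?\<phi> + 1" by (simp add: exp_minus algebra_simps)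
    then show ?thesis using assms by simp
  qed
  ultimately show ?thesis by (simp add: algebra_simps)
qed

lemma clipped_log_dual_tendsto:
  assumes "m > 0" "t \<ge> 0"
  shows "(\<lambda>N. t * clipped_log N m t - m * (exp (clipped_log N m t) - 1)) \<longlonglongrightarrow> entropy_gap m t"
proof (cases "t = 0")
  case True
  have "(\<lambda>N. exp (- real N)) \<longlonglongrightarrow> 0" by real_asymp
  then have "(\<lambda>N. - m * (exp (- real N) - 1)) \<longlonglongrightarrow> - m * (0 - 1)" by (intro tendsto_intros)
  then show ?thesis using True by (simp add: clipped_log_def entropy_gap_def)
next
  case False
  define s where "s = ln (t / m)"
  have t: "t = m * exp s" using False assms by (simp add: s_def)
  obtain N0 :: nat where N0: "\<bar>s\<bar> < real N0" using reals_Archimedean2 by blast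
  have "clipped_log N m t = s" if "N0 \<le> N" for N
  proof -
    have "\<bar>s\<bar> < real N" using N0 that by linarith
    then show ?thesis using False by (simp add: clipped_log_def s_def[symmetric])
  qed
  then have "eventually (\<lambda>N. t * clipped_log N m t - m * (exp (clipped_log N m t) - 1) = entropy_gap m t) sequentially"
    unfolding eventually_sequentially entropy_gap_def s_def[symmetric]
    by (intro exI[of _ N0]) (simp add: t algebra_simps)
  then show ?thesis by (rule tendsto_eventually)
qed

lemma measurable_clipped_log [measurable]: "clipped_log N m \<in> borel_measurable borel"
  unfolding clipped_log_def[abs_def] by measurable

text \<open>The mollifier is moved onto \<phi>, where it converges pointwise and boundedly; \<rho>
  may be any measure for which g is integrable.\<close>

lemma approx_identity_conv_tendsto:
  fixes g \<phi> :: "real ^ 'd \<Rightarrow> real"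
  assumes K: "approx_identity K" and \<rho>: "sets \<rho> = sets torus" "integrable \<rho> g" and \<phi>: "periodic \<phi>" "continuous_on UNIV \<phi>"
  shows "(\<lambda>n. \<integral>x. tpoly (tpoly_conv \<rho> g (K n)) x * \<phi> x \<partial>torus) \<longlonglongrightarrow> (\<integral>y. \<phi> y * g y \<partial>\<rho>)"
proof -
  have Kn: "int_freqs (K n)" for n using K by (auto simp: approx_identity_def)
  obtain C where C: "C > 0" "\<And>x. \<bar>\<phi> x\<bar> \<le> C" using periodic_continuous_bounded[OF \<phi>] by blast
  have "(\<lambda>n. \<integral>y. (\<integral>x. tpoly (K n) (x - y) * \<phi> x \<partial>torus) * g y \<partial>\<rho>) \<longlonglongrightarrow> (\<integral>y. \<phi> y * g y \<partial>\<rho>)"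
  proof (rule integral_dominated_convergence[where w="\<lambda>y. C * \<bar>g y\<bar>"])
    show "(\<lambda>y. (\<integral>x. tpoly (K n) (x - y) * \<phi> x \<partial>torus) * g y) \<in> borel_measurable \<rho>" for n
      using tpoly_conv_swap[OF \<rho> \<phi> Kn[of n]] by (auto simp: has_bochner_integral_iff)
    have "\<phi> \<in> borel_measurable \<rho>"
      using measurable_torus_continuous[OF \<phi>(2)] measurable_cong_sets[OF \<rho>(1) refl] by blast
    then show "(\<lambda>y. \<phi> y * g y) \<in> borel_measurable \<rho>" using \<rho>(2) by simp
    show "integrable \<rho> (\<lambda>y. C * \<bar>g y\<bar>)" using \<rho>(2) by simp
    show "AE y in \<rho>. (\<lambda>n. (\<integral>x. tpoly (K n) (x - y) * \<phi> x \<partial>torus) * g y) \<longlonglongrightarrow> \<phi> y * g y"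
      by (intro AE_I2 tendsto_mult tendsto_const approx_identity_conv(1)[OF K \<phi>])
    show "AE y in \<rho>. norm ((\<integral>x. tpoly (K n) (x - y) * \<phi> x \<partial>torus) * g y) \<le> C * \<bar>g y\<bar>" for n
      using approx_identity_conv(3)[OF K \<phi> C(2)] by (auto simp: abs_mult intro!: mult_right_mono)
  qed
  then show ?thesis using tpoly_conv_swap[OF \<rho> \<phi> Kn] by (simp add: has_bochner_integral_iff)
qed

text \<open>Lower semicontinuity of the entropy in dual form: for fixed \<phi> the left-hand side is
  linear in the mollified density and converges weakly, while the Fisher information of every
  mollification stays below that of h.\<close>

lemma entropy_le_Fisher_dual:
  fixes h :: "real ^ 'd \<Rightarrow> real"
  assumes h: "\<And>x. 0 \<le> h x" "0 < integral\<^sup>L torus h" and lg: "log_gradient h v"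
    and fin: "integrable torus (\<lambda>x. h x * (norm (v x))\<^sup>2)"
    and \<phi>: "periodic \<phi>" "continuous_on UNIV \<phi>"
  shows "(\<integral>x. h x * \<phi> x \<partial>torus) - integral\<^sup>L torus h * (\<integral>x. exp (\<phi> x) - 1 \<partial>torus)
     \<le> (\<integral>x. h x * (norm (v x))\<^sup>2 \<partial>torus) / (8 * pi\<^sup>2)"
proof -
  obtain K :: "nat \<Rightarrow> (real \<times> (real ^ 'd) \<times> real) list" where K: "approx_identity K"
    using approx_identity_exists by blast
  have Kn: "int_freqs (K n)" "0 < tpoly (K n) x" "integral\<^sup>L torus (tpoly (K n)) = 1" for n x
    using K by (auto simp: approx_identity_def)
  have int: "integrable torus h" using lg by (auto simp: log_gradient_def weak_gradient_def)
  define m where "m = integral\<^sup>L torus h"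
  define u where "u n = tpoly (tpoly_conv torus h (K n))" for n
  have upos: "0 < u n x" for n x unfolding u_def by (rule tpoly_conv_positive[OF refl int h Kn(1,2)])
  have ufreq: "int_freqs (tpoly_conv torus h (K n))" for n using Kn by simp
  have um: "integral\<^sup>L torus (u n) = m" for n
    unfolding u_def m_def by (rule integral_tpoly_conv[OF refl int Kn(1,3)])
  have cu: "continuous_on UNIV (u n)" for n unfolding u_def by (intro continuous_intros)
  have pu: "periodic (u n)" for n unfolding u_def by (rule periodic_tpoly[OF ufreq])
  have le: "(\<integral>x. u n x * \<phi> x \<partial>torus) - m * (\<integral>x. exp (\<phi> x) - 1 \<partial>torus) \<le> (\<integral>x. h x * (norm (v x))\<^sup>2 \<partial>torus) / (8 * pi\<^sup>2)" for n
  proof -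
    have i1: "integrable torus (\<lambda>x. u n x * \<phi> x)"
      by (rule integrable_torus) (use pu[of n] \<phi> in \<open>auto simp: periodic_def intro!: continuous_intros cu\<close>)
    have i2: "integrable torus (\<lambda>x. exp (\<phi> x) - 1)"
      by (rule integrable_torus) (use \<phi> in \<open>auto simp: periodic_def intro!: continuous_intros\<close>)
    have i3: "integrable torus (\<lambda>x. u n x * ln (u n x))"
      by (rule integrable_torus) (use pu[of n] upos[of n] in \<open>auto simp: periodic_def less_imp_neq[symmetric] intro!: continuous_intros cu\<close>)
    have i4: "integrable torus (u n)" by (rule integrable_torus[OF pu cu])
    have "(\<integral>x. u n x * \<phi> x \<partial>torus) - m * (\<integral>x. exp (\<phi> x) - 1 \<partial>torus) = (\<integral>x. u n x * \<phi> x - m * (exp (\<phi> x) - 1) \<partial>torus)"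
      using i1 i2 by simp
    also have "\<dots> \<le> (\<integral>x. u n x * ln (u n x) - ln m * u n x - u n x + m \<partial>torus)"
    proof (rule integral_mono)
      show "integrable torus (\<lambda>x. u n x * \<phi> x - m * (exp (\<phi> x) - 1))" using i1 i2 by simp
      show "integrable torus (\<lambda>x. u n x * ln (u n x) - ln m * u n x - u n x + m)" using i3 i4 by simp
      fix x
      have "m > 0" using h by (simp add: m_def)
      then have "entropy_gap m (u n x) = u n x * ln (u n x) - ln m * u n x - u n x + m"
        using upos[of n x] by (simp add: entropy_gap_def ln_div algebra_simps)
      then show "u n x * \<phi> x - m * (exp (\<phi> x) - 1) \<le> u n x * ln (u n x) - ln m * u n x - u n x + m"
        using entropy_gap_dual[OF \<open>m > 0\<close>, of "u n x" "\<phi> x"] upos[of n x] by simp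
    qed
    also have "\<dots> = (\<integral>x. u n x * ln (u n x) \<partial>torus) - m * ln m"
      using i3 i4 um[of n] by (simp add: torus.prob_space del: space_torus)
    also have "\<dots> \<le> (\<Sum>i\<in>UNIV. \<integral>x. (tpoly (tpoly_partial i (tpoly_conv torus h (K n))) x)\<^sup>2 / u n x \<partial>torus) / (8 * pi\<^sup>2)"
      using tpoly_log_Sobolev[OF ufreq upos[unfolded u_def], of n] um[of n] unfolding u_def by simp
    also have "\<dots> \<le> (\<integral>x. h x * (norm (v x))\<^sup>2 \<partial>torus) / (8 * pi\<^sup>2)"
      unfolding u_def by (intro divide_right_mono mollified_Fisher_information_le[OF h lg fin Kn(1) Kn(2) Kn(3)]) auto
    finally show ?thesis .
  qed
  have "(\<lambda>n. \<integral>x. u n x * \<phi> x \<partial>torus) \<longlonglongrightarrow> (\<integral>y. h y * \<phi> y \<partial>torus)"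
    using approx_identity_conv_tendsto[OF K refl int \<phi>] by (simp add: u_def mult.commute)
  then have "(\<lambda>n. (\<integral>x. u n x * \<phi> x \<partial>torus) - m * (\<integral>x. exp (\<phi> x) - 1 \<partial>torus))
      \<longlonglongrightarrow> (\<integral>y. h y * \<phi> y \<partial>torus) - m * (\<integral>x. exp (\<phi> x) - 1 \<partial>torus)"
    by (intro tendsto_intros)
  then show ?thesis unfolding m_def[symmetric] by (rule LIMSEQ_le_const2) (use le in auto)
qed

text \<open>The near-optimal dual variables, truncated logarithms of h, are bounded but only
  measurable; approximation almost everywhere by continuous ones extends the inequality to
  them.\<close>

lemma entropy_le_Fisher_dual_measurable:
  fixes h :: "real ^ 'd \<Rightarrow> real"
  assumes h: "\<And>x. 0 \<le> h x" "0 < integral\<^sup>L torus h" and lg: "log_gradient h v"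
    and fin: "integrable torus (\<lambda>x. h x * (norm (v x))\<^sup>2)"
    and f: "f \<in> borel_measurable torus" "\<And>x. \<bar>f x\<bar> \<le> N"
  shows "integrable torus (\<lambda>x. h x * f x - integral\<^sup>L torus h * (exp (f x) - 1))"
    and "(\<integral>x. h x * f x - integral\<^sup>L torus h * (exp (f x) - 1) \<partial>torus) \<le> (\<integral>x. h x * (norm (v x))\<^sup>2 \<partial>torus) / (8 * pi\<^sup>2)"
proof -
  have int: "integrable torus h" using lg by (auto simp: log_gradient_def weak_gradient_def)
  have hm: "h \<in> borel_measurable torus" using int by simp
  define m where "m = integral\<^sup>L torus h"
  have m0: "m > 0" using h by (simp add: m_def)
  have bound: "\<bar>h x * t - m * (exp t - 1)\<bar> \<le> N * h x + m * (exp N + 1)" if "\<bar>t\<bar> \<le> N" for x t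
  proof -
    have "\<bar>h x * t\<bar> \<le> N * h x" using that h(1)[of x] by (simp add: abs_mult mult.commute mult_right_mono)
    moreover have "\<bar>m * (exp t - 1)\<bar> \<le> m * (exp N + 1)"
    proof -
      have "exp t \<le> exp N" using that by simp
      then have "\<bar>exp t - 1\<bar> \<le> exp N + 1" using exp_gt_zero[of t] by linarith
      then show ?thesis using m0 by (simp add: abs_mult)
    qed
    ultimately show ?thesis by linarith
  qed
  have iw: "integrable torus (\<lambda>x. N * h x + m * (exp N + 1))" using int by simp
  have meas: "(\<lambda>x. h x * g x - m * (exp (g x) - 1)) \<in> borel_measurable torus" if "g \<in> borel_measurable torus" for g
    using hm that by measurable
  show "integrable torus (\<lambda>x. h x * f x - integral\<^sup>L torus h * (exp (f x) - 1))"
    unfolding m_def[symmetric]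
    by (rule Bochner_Integration.integrable_bound[OF iw meas[OF f(1)]])
       (use bound[OF f(2)] in \<open>auto intro!: order_trans[OF _ abs_ge_self]\<close>)
  obtain \<phi> where \<phi>: "\<And>j :: nat. periodic (\<phi> j)" "\<And>j. continuous_on UNIV (\<phi> j)" "\<And>j x. \<bar>\<phi> j x\<bar> \<le> N"
    "AE x in torus. (\<lambda>j. \<phi> j x) \<longlonglongrightarrow> f x"
    using bounded_measurable_limit_of_continuous[OF f] by blast
  have "(\<lambda>j. \<integral>x. h x * \<phi> j x - m * (exp (\<phi> j x) - 1) \<partial>torus) \<longlonglongrightarrow> (\<integral>x. h x * f x - m * (exp (f x) - 1) \<partial>torus)"
  proof (rule integral_dominated_convergence[OF meas[OF f(1)] meas iw])
    show "\<phi> j \<in> borel_measurable torus" for j by (rule measurable_torus_continuous[OF \<phi>(2)])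
    show "AE x in torus. (\<lambda>j. h x * \<phi> j x - m * (exp (\<phi> j x) - 1)) \<longlonglongrightarrow> h x * f x - m * (exp (f x) - 1)"
      using \<phi>(4) by eventually_elim (auto intro!: tendsto_intros)
    show "AE x in torus. norm (h x * \<phi> j x - m * (exp (\<phi> j x) - 1)) \<le> N * h x + m * (exp N + 1)" for j
      using bound[OF \<phi>(3)] by simp
  qed
  moreover have "(\<integral>x. h x * \<phi> j x - m * (exp (\<phi> j x) - 1) \<partial>torus) \<le> (\<integral>x. h x * (norm (v x))\<^sup>2 \<partial>torus) / (8 * pi\<^sup>2)" for j
  proof -
    have "integrable torus (\<lambda>x. exp (\<phi> j x) - 1)"
      by (rule integrable_torus) (use \<phi>(1)[of j] \<phi>(2)[of j] in \<open>auto simp: periodic_def intro!: continuous_intros\<close>)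
    moreover have "integrable torus (\<lambda>x. h x * \<phi> j x)"
      using integrable_bounded_continuous_mult[OF refl int \<phi>(2) \<phi>(3)] by (simp add: mult.commute)
    ultimately show ?thesis
      using entropy_le_Fisher_dual[OF h lg fin \<phi>(1) \<phi>(2), of j] by (simp add: m_def)
  qed
  ultimately show "(\<integral>x. h x * f x - integral\<^sup>L torus h * (exp (f x) - 1) \<partial>torus) \<le> (\<integral>x. h x * (norm (v x))\<^sup>2 \<partial>torus) / (8 * pi\<^sup>2)"
    unfolding m_def[symmetric] by (intro LIMSEQ_le_const2) auto
qed

text \<open>Each clipped logarithm is an admissible dual variable, and Fatou's lemma removes the
  clipping. The left-hand side is a nonnegative integral, so that integrability of h ln h is a
  consequence and not a prerequisite.\<close>

theorem torus_log_Sobolev: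
  fixes h :: "real ^ 'd \<Rightarrow> real"
  assumes h: "\<And>x. 0 \<le> h x" "0 < integral\<^sup>L torus h" and lg: "log_gradient h v"
    and fin: "integrable torus (\<lambda>x. h x * (norm (v x))\<^sup>2)"
  shows "(\<integral>\<^sup>+x. ennreal (entropy_gap (integral\<^sup>L torus h) (h x)) \<partial>torus)
     \<le> ennreal ((\<integral>x. h x * (norm (v x))\<^sup>2 \<partial>torus) / (8 * pi\<^sup>2))"
proof -
  have int: "integrable torus h" using lg by (auto simp: log_gradient_def weak_gradient_def)
  have hm [measurable]: "h \<in> borel_measurable torus" using int by simp
  define m where "m = integral\<^sup>L torus h"
  have m0: "m > 0" using h by (simp add: m_def)
  define f where "f N x = h x * clipped_log N m (h x) - m * (exp (clipped_log N m (h x)) - 1)" for N x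
  have cm: "(\<lambda>x. clipped_log N m (h x)) \<in> borel_measurable torus" for N by measurable
  have fm: "f N \<in> borel_measurable torus" for N unfolding f_def[abs_def] using cm by measurable
  have le: "(\<integral>\<^sup>+x. ennreal (f N x) \<partial>torus) \<le> ennreal ((\<integral>x. h x * (norm (v x))\<^sup>2 \<partial>torus) / (8 * pi\<^sup>2))" for N
  proof -
    note d = entropy_le_Fisher_dual_measurable[OF h lg fin cm clipped_log_bounded, of N, folded m_def]
    have "(\<integral>\<^sup>+x. ennreal (f N x) \<partial>torus) = ennreal (integral\<^sup>L torus (f N))"
      by (rule nn_integral_eq_integral) (use d(1) clipped_log_dual_nonneg[OF m0 h(1)] in \<open>auto simp: f_def[abs_def]\<close>)
    then show ?thesis using d(2) by (simp add: f_def[abs_def] ennreal_leI)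
  qed
  have "(\<integral>\<^sup>+x. ennreal (entropy_gap m (h x)) \<partial>torus) = (\<integral>\<^sup>+x. liminf (\<lambda>N. ennreal (f N x)) \<partial>torus)"
  proof (rule nn_integral_cong)
    fix x
    have "(\<lambda>N. ennreal (f N x)) \<longlonglongrightarrow> ennreal (entropy_gap m (h x))"
      unfolding f_def by (rule tendsto_ennrealI[OF clipped_log_dual_tendsto[OF m0 h(1)]])
    then show "ennreal (entropy_gap m (h x)) = liminf (\<lambda>N. ennreal (f N x))"
      by (rule lim_imp_Liminf[OF sequentially_bot, symmetric])
  qed
  also have "\<dots> \<le> liminf (\<lambda>N. \<integral>\<^sup>+x. ennreal (f N x) \<partial>torus)"
    by (rule nn_integral_liminf) (use fm in measurable)
  also have "\<dots> \<le> ennreal ((\<integral>x. h x * (norm (v x))\<^sup>2 \<partial>torus) / (8 * pi\<^sup>2))"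
    by (rule Liminf_le) (use le in auto)
  finally show ?thesis unfolding m_def .
qed

section \<open>Stationary measures of the drift-diffusion equation\<close>

subsection \<open>Periodic continuous functions determine a measure\<close>

text \<open>
  For \<open>0 \<le> a < 1\<close> the arc \<open>[0, a]\<close> of the circle is described by the periodic condition
  \<open>cos (\<pi> a) \<le> cos (2 \<pi> (t - a / 2))\<close>.
\<close>

definition arc_gap :: "real \<Rightarrow> real \<Rightarrow> real" where
  "arc_gap a t = max 0 (cos (pi * a) - cos (2 * pi * (t - a / 2)))"

lemma arc_gap_eq_0_iff:
  assumes a: "0 \<le> a" "a < 1" and t: "0 \<le> t" "t < 1"
  shows "arc_gap a t = 0 \<longleftrightarrow> t \<le> a"
proof -
  define z where "z = 2 * pi * \<bar>t - a / 2\<bar>"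
  have cz: "cos (2 * pi * (t - a / 2)) = cos z"
    using cos_abs_real[of "2 * pi * (t - a / 2)"] by (simp only: z_def abs_mult) simp
  have "arc_gap a t = 0 \<longleftrightarrow> cos (pi * a) \<le> cos z" by (auto simp: arc_gap_def cz)
  also have "\<dots> \<longleftrightarrow> t \<le> a"
  proof (cases "z \<le> pi")
    case True
    then have "cos (pi * a) \<le> cos z \<longleftrightarrow> z \<le> pi * a"
      using a by (intro cos_mono_le_eq) (auto simp: z_def mult_le_cancel_left1)
    also have "\<dots> \<longleftrightarrow> \<bar>t - a / 2\<bar> \<le> a / 2" unfolding z_def by (auto simp: field_simps)
    also have "\<dots> \<longleftrightarrow> t \<le> a" unfolding abs_le_iff using t by (auto simp: field_simps)
    finally show ?thesis .
  next
    case False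
    then have "1 / 2 < \<bar>t - a / 2\<bar>" by (simp add: z_def field_simps)
    then have ta: "1 / 2 + a / 2 < t" using a t by linarith
    have z: "z = 2 * pi * (t - a / 2)" using ta a by (simp add: z_def)
    \<comment> \<open>Beyond half a turn the cosine increases again, so z is replaced by its mirror
      angle.\<close>
    have "2 * pi - z \<le> pi" using False by simp
    moreover have "pi * a < 2 * pi - z"
    proof -
      have "2 * pi - z - pi * a = 2 * pi * (1 - t)" by (simp add: z algebra_simps)
      then show ?thesis using t by (smt (verit) mult_pos_pos pi_gt_zero)
    qed
    ultimately have "cos (2 * pi - z) < cos (pi * a)"
      using a by (intro cos_monotone_0_pi) auto
    then have "\<not> cos (pi * a) \<le> cos z" by (simp add: cos_2pi_minus)
    then show ?thesis using ta a by auto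
  qed
  finally show ?thesis .
qed

lemma tendsto_max_0_gap:
  fixes g :: real
  assumes "0 \<le> g"
  shows "(\<lambda>n. max 0 (1 - real n * g)) \<longlonglongrightarrow> (if g = 0 then 1 else 0)"
proof (cases "g = 0")
  case False
  then have g: "g > 0" using assms by simp
  obtain m :: nat where m: "1 / g < real m" using reals_Archimedean2 by blast
  have "max 0 (1 - real n * g) = 0" if "m \<le> n" for n
  proof -
    have "1 / g \<le> real n" using m that by linarith
    then show ?thesis using g by (simp add: field_simps)
  qed
  then show ?thesis using False by (intro tendsto_eventually) (auto simp: eventually_sequentially)
qed simp

lemma indicator_orthant_limit_of_continuous:
  fixes a :: "real ^ 'd"
  assumes a: "\<And>i. 0 \<le> a $ i"
  obtains \<phi> :: "nat \<Rightarrow> real ^ 'd \<Rightarrow> real" where "\<And>n. periodic (\<phi> n)" "\<And>n. continuous_on UNIV (\<phi> n)" "\<And>n x. \<bar>\<phi> n x\<bar> \<le> 1"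
    "\<And>x :: real ^ 'd. x \<in> unit_cube \<Longrightarrow> (\<lambda>n. \<phi> n x) \<longlonglongrightarrow> indicator {x. \<forall>i. x $ i \<le> a $ i} x"
proof -
  \<comment> \<open>For a_i \<ge> 1 the condition x_i \<le> a_i holds on the whole cube, and the
    description by arcs is confined to a_i < 1; hence the value 0.\<close>
  define G where "G i t = (if a $ i < 1 then arc_gap (a $ i) t else 0)" for i t
  have G0: "0 \<le> G i t" for i t by (simp add: G_def arc_gap_def)
  define \<phi> where "\<phi> n x = (\<Prod>i\<in>UNIV. max 0 (1 - real n * G i (x $ i)))" for n x
  show ?thesis
  proof (rule that)
    fix n
    have "G j ((x + axis i 1) $ j) = G j (x $ j)" for j i and x :: "real ^ 'd"
    proof (cases "i = j")
      case True
      have "2 * pi * (x $ j + 1 - a $ j / 2) = 2 * pi * (x $ j - a $ j / 2) + 2 * pi" by (simp add: algebra_simps)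
      then have "cos (2 * pi * (x $ j + 1 - a $ j / 2)) = cos (2 * pi * (x $ j - a $ j / 2))"
        by (simp only: cos_periodic)
      then show ?thesis using True by (simp add: G_def arc_gap_def)
    qed (simp add: axis_def)
    then show "periodic (\<phi> n)" by (simp add: periodic_def \<phi>_def)
    have "continuous_on UNIV (\<lambda>x :: real ^ 'd. G i (x $ i))" for i
      unfolding G_def arc_gap_def by (cases "a $ i < 1") (simp, intro continuous_intros, simp)
    then show "continuous_on UNIV (\<phi> n)" unfolding \<phi>_def by (intro continuous_intros)
    fix x :: "real ^ 'd"
    have "0 \<le> \<phi> n x" unfolding \<phi>_def by (intro prod_nonneg) auto
    moreover have "\<phi> n x \<le> 1" unfolding \<phi>_def using G0 by (intro prod_le_1) auto
    ultimately show "\<bar>\<phi> n x\<bar> \<le> 1" by simp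
  next
    fix x :: "real ^ 'd" assume x: "x \<in> unit_cube"
    have G: "G i (x $ i) = 0 \<longleftrightarrow> x $ i \<le> a $ i" for i
    proof (cases "a $ i < 1")
      case True
      have "0 \<le> x $ i" "x $ i < 1" using x by (auto simp: unit_cube_def)
      then show ?thesis using arc_gap_eq_0_iff[OF a[of i] True] True by (simp add: G_def)
    next
      case False
      moreover have "x $ i < 1" using x by (simp add: unit_cube_def)
      ultimately show ?thesis by (simp add: G_def)
    qed
    have "(\<lambda>n. \<phi> n x) \<longlonglongrightarrow> (\<Prod>i\<in>UNIV. if G i (x $ i) = 0 then 1 else 0)"
      unfolding \<phi>_def by (intro tendsto_prod tendsto_max_0_gap G0)
    also have "(\<Prod>i\<in>UNIV. if G i (x $ i) = 0 then 1 else (0 :: real)) = indicator {x. \<forall>i. x $ i \<le> a $ i} x"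
      unfolding G by (auto simp: indicator_def prod_zero_iff)
    finally show "(\<lambda>n. \<phi> n x) \<longlonglongrightarrow> indicator {x. \<forall>i. x $ i \<le> a $ i} x" .
  qed
qed

lemma sets_borel_vec_orthants:
  "sets borel = sigma_sets UNIV (range (\<lambda>a :: real ^ 'd. {x. \<forall>i. x $ i \<le> a $ i}))"
proof -
  have "(borel :: (real ^ 'd) measure) = sigma UNIV (range (\<lambda>a. {..a}))"
    by (rule borel_eq_atMost)
  moreover have "{..a} = {x. \<forall>i. x $ i \<le> a $ i}" for a :: "real ^ 'd"
    by (auto simp: less_eq_vec_def)
  ultimately have "(borel :: (real ^ 'd) measure) = sigma UNIV (range (\<lambda>a. {x. \<forall>i. x $ i \<le> a $ i}))" by simp
  then have "sets (borel :: (real ^ 'd) measure) = sets (sigma UNIV (range (\<lambda>a. {x. \<forall>i. x $ i \<le> a $ i})))"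
    by (rule arg_cong)
  also have "\<dots> = sigma_sets UNIV (range (\<lambda>a. {x. \<forall>i. x $ i \<le> a $ i}))"
    by (rule sets_measure_of) simp
  finally show ?thesis .
qed

text \<open>The orthants form an intersection-stable generator of the Borel sets. Their indicators
  on the cube are bounded limits of continuous periodic functions, and an orthant with a negative
  corner coordinate misses the cube.\<close>

lemma measure_eqI_periodic_continuous:
  fixes \<rho>1 \<rho>2 :: "(real ^ 'd) measure"
  assumes fin: "finite_measure \<rho>1" "finite_measure \<rho>2" and sets: "sets \<rho>1 = sets torus" "sets \<rho>2 = sets torus"
    and eq: "\<And>\<phi> :: real ^ 'd \<Rightarrow> real. periodic \<phi> \<Longrightarrow> continuous_on UNIV \<phi> \<Longrightarrow> integral\<^sup>L \<rho>1 \<phi> = integral\<^sup>L \<rho>2 \<phi>"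
  shows "\<rho>1 = \<rho>2"
proof -
  have sp: "space \<rho>1 = unit_cube" "space \<rho>2 = unit_cube" using sets sets_eq_imp_space_eq space_torus by metis+
  let ?O = "\<lambda>a :: real ^ 'd. {x. \<forall>i. x $ i \<le> a $ i}"
  have Om: "?O a \<in> sets borel" for a using sets_borel_vec_orthants by (auto intro: sigma_sets.Basic)
  have idm: "(\<lambda>x. x) \<in> \<rho> \<rightarrow>\<^sub>M borel" if "sets \<rho> = sets torus" for \<rho> :: "(real ^ 'd) measure"
  proof -
    have "(\<lambda>x. x) \<in> torus \<rightarrow>\<^sub>M (borel :: (real ^ 'd) measure)" by (rule borel_measurable_torus) simp
    then show ?thesis using measurable_cong_sets[OF that refl] by blast
  qed
  have lim: "(\<lambda>n. integral\<^sup>L \<rho> (\<phi> n)) \<longlonglongrightarrow> measure \<rho> (?O a \<inter> unit_cube)"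
    if \<rho>: "finite_measure \<rho>" "sets \<rho> = sets torus"
      and \<phi>: "\<And>n :: nat. periodic (\<phi> n)" "\<And>n. continuous_on UNIV (\<phi> n)" "\<And>n x. \<bar>\<phi> n x\<bar> \<le> 1"
        "\<And>x :: real ^ 'd. x \<in> unit_cube \<Longrightarrow> (\<lambda>n. \<phi> n x) \<longlonglongrightarrow> indicator (?O a) x" for \<rho> :: "(real ^ 'd) measure" and \<phi> :: "nat \<Rightarrow> real ^ 'd \<Rightarrow> real" and a
  proof -
    interpret finite_measure \<rho> by fact
    have sp\<rho>: "space \<rho> = unit_cube" using sets_eq_imp_space_eq[OF \<rho>(2)] by simp
    have "(\<lambda>n. integral\<^sup>L \<rho> (\<phi> n)) \<longlonglongrightarrow> integral\<^sup>L \<rho> (indicator (?O a))"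
    proof (rule integral_dominated_convergence[where w="\<lambda>_. 1"])
      show "(indicator (?O a) :: real ^ 'd \<Rightarrow> real) \<in> borel_measurable \<rho>"
        by (rule measurable_compose[OF idm[OF \<rho>(2)] borel_measurable_indicator[OF Om]])
      show "\<phi> n \<in> borel_measurable \<rho>" for n
        using measurable_torus_continuous[OF \<phi>(2)] measurable_cong_sets[OF \<rho>(2) refl] by blast
      show "AE x in \<rho>. (\<lambda>n. \<phi> n x) \<longlonglongrightarrow> indicator (?O a) x" by (rule AE_I2) (use \<phi>(4) sp\<rho> in auto)
    qed (use \<phi>(3) in auto)
    also have "integral\<^sup>L \<rho> (indicator (?O a)) = measure \<rho> (?O a \<inter> space \<rho>)" by simp
    finally show ?thesis unfolding sp\<rho> .
  qed
  have "distr \<rho>1 borel (\<lambda>x. x) = distr \<rho>2 borel (\<lambda>x. x)"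
  proof (rule measure_eqI_generator_eq[where E="range ?O" and \<Omega>=UNIV and A="\<lambda>n. ?O (\<chi> i. real n)"])
    show "Int_stable (range ?O)"
    proof (rule Int_stableI)
      fix A B assume "A \<in> range ?O" "B \<in> range ?O"
      then obtain a b where "A = ?O a" "B = ?O b" by auto
      then have "A \<inter> B = ?O (\<chi> i. min (a $ i) (b $ i))" by auto
      then show "A \<inter> B \<in> range ?O" by blast
    qed
    show "emeasure (distr \<rho>1 borel (\<lambda>x. x)) X = emeasure (distr \<rho>2 borel (\<lambda>x. x)) X" if "X \<in> range ?O" for X
    proof -
      obtain a where X: "X = ?O a" using \<open>X \<in> range ?O\<close> by auto
      have "measure \<rho>1 (?O a \<inter> unit_cube) = measure \<rho>2 (?O a \<inter> unit_cube)"
      proof (cases "\<forall>i. 0 \<le> a $ i")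
        case True
        then obtain \<phi> :: "nat \<Rightarrow> real ^ 'd \<Rightarrow> real" where \<phi>: "\<And>n. periodic (\<phi> n)" "\<And>n. continuous_on UNIV (\<phi> n)" "\<And>n x. \<bar>\<phi> n x\<bar> \<le> 1"
          "\<And>x :: real ^ 'd. x \<in> unit_cube \<Longrightarrow> (\<lambda>n. \<phi> n x) \<longlonglongrightarrow> indicator (?O a) x"
          using indicator_orthant_limit_of_continuous[of a] by blast
        have "integral\<^sup>L \<rho>1 (\<phi> n) = integral\<^sup>L \<rho>2 (\<phi> n)" for n by (rule eq[OF \<phi>(1,2)])
        then have "(\<lambda>n. integral\<^sup>L \<rho>1 (\<phi> n)) \<longlonglongrightarrow> measure \<rho>2 (?O a \<inter> unit_cube)"
          using lim[OF fin(2) sets(2) \<phi>] by (simp only:)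
        moreover have "(\<lambda>n. integral\<^sup>L \<rho>1 (\<phi> n)) \<longlonglongrightarrow> measure \<rho>1 (?O a \<inter> unit_cube)"
          by (rule lim[OF fin(1) sets(1) \<phi>])
        ultimately show ?thesis by (rule LIMSEQ_unique[rotated])
      next
        case False
        then obtain i where i: "a $ i < 0" by (auto simp: not_le)
        have "x \<notin> unit_cube" if "x \<in> ?O a" for x
        proof -
          have "x $ i \<le> a $ i" using that by simp
          then have "x $ i < 0" using i by linarith
          then show ?thesis unfolding unit_cube_def by (auto simp: not_le)
        qed
        then have "?O a \<inter> unit_cube = {}" by blast
        then show ?thesis by simp
      qed
      then have "emeasure \<rho>1 (?O a \<inter> unit_cube) = emeasure \<rho>2 (?O a \<inter> unit_cube)"
        using fin by (simp add: finite_measure.emeasure_eq_measure)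
      then show ?thesis
        using Om[of a] idm[OF sets(1)] idm[OF sets(2)] by (simp add: X emeasure_distr vimage_def sp Int_def)
    qed
    show "sets (distr \<rho>1 borel (\<lambda>x. x)) = sigma_sets UNIV (range ?O)" "sets (distr \<rho>2 borel (\<lambda>x. x)) = sigma_sets UNIV (range ?O)"
      using sets_borel_vec_orthants by simp_all
    show "(\<Union>n. ?O (\<chi> i. real n)) = UNIV"
    proof -
      have "\<exists>n. \<forall>i. x $ i \<le> real n" for x :: "real ^ 'd"
      proof -
        obtain n :: nat where "norm x \<le> real n" using real_arch_simple by blast
        then show ?thesis using component_le_norm_cart[of x] by (intro exI[of _ n]) (meson abs_le_D1 order_trans)
      qed
      then show ?thesis by auto
    qed
    show "emeasure (distr \<rho>1 borel (\<lambda>x. x)) (?O (\<chi> i. real n)) \<noteq> \<infinity>" for n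
      using finite_measure.emeasure_finite[OF finite_measure.finite_measure_distr[OF fin(1) idm[OF sets(1)]]] by simp
    show "range (\<lambda>n. ?O (\<chi> i. real n)) \<subseteq> range ?O"
      by (intro image_subsetI rangeI)
    show "range ?O \<subseteq> Pow UNIV" unfolding Pow_UNIV by (rule subset_UNIV)
  qed
  then have d: "emeasure \<rho>1 (A \<inter> unit_cube) = emeasure \<rho>2 (A \<inter> unit_cube)" if "A \<in> sets borel" for A
    using emeasure_distr[OF idm[OF sets(1)] that] emeasure_distr[OF idm[OF sets(2)] that] by (simp add: sp)
  show ?thesis
  proof (rule measure_eqI)
    show "sets \<rho>1 = sets \<rho>2" by (simp only: sets)
    fix A assume "A \<in> sets \<rho>1"
    then have "A \<in> sets (restrict_space borel unit_cube)" by (simp only: sets(1) sets_torus)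
    then obtain B where "B \<in> sets borel" "A = B \<inter> unit_cube"
      unfolding sets_restrict_space by auto
    then show "emeasure \<rho>1 A = emeasure \<rho>2 A" using d by simp
  qed
qed

subsection \<open>Stationary measures are Gibbs measures\<close>

lemma has_partialD: "has_partial i f f' \<Longrightarrow> ((\<lambda>s. f (x + s *\<^sub>R axis i 1)) has_real_derivative f' x) (at 0)"
  by (simp add: has_partial_def)

lemma tpoly_partial_partial_reflect:
  "tpoly (tpoly_partial i (tpoly_partial i (tpoly_reflect x L))) y = tpoly (tpoly_partial i (tpoly_partial i L)) (x - y)"
proof -
  have "tpoly (tpoly_partial i (tpoly_reflect x L)) = (\<lambda>y. - tpoly (tpoly_reflect x (tpoly_partial i L)) y)"
    by (simp add: fun_eq_iff tpoly_partial_reflect tpoly_reflect)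
  moreover have "has_partial i (\<lambda>y. - tpoly (tpoly_reflect x (tpoly_partial i L)) y)
      (\<lambda>y. - tpoly (tpoly_partial i (tpoly_reflect x (tpoly_partial i L))) y)"
    using has_partial_tpoly[of i "tpoly_reflect x (tpoly_partial i L)"]
    by (auto simp: has_partial_def intro: DERIV_minus)
  ultimately have "tpoly (tpoly_partial i (tpoly_partial i (tpoly_reflect x L)))
      = (\<lambda>y. - tpoly (tpoly_partial i (tpoly_reflect x (tpoly_partial i L))) y)"
    using has_partial_unique[OF has_partial_tpoly] by metis
  then show ?thesis by (simp add: tpoly_partial_reflect)
qed

text \<open>The dynamics with the measure inside the drift frozen, so that the equation for \<mu> is
  linear. Here b is the drift - \<nabla>U, and stationarity is the weak Fokker-Planck equation,
  tested with trigonometric polynomials because the process yields it mode by mode.\<close>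

locale stationary_drift =
  fixes \<beta> :: real and \<mu> :: "(real ^ 'd) measure" and b :: "'d \<Rightarrow> real ^ 'd \<Rightarrow> real" and U :: "real ^ 'd \<Rightarrow> real"
  assumes \<beta>: "\<beta> > 0" and prob: "prob_space \<mu>" and sets: "sets \<mu> = sets torus"
    and U: "periodic U" "continuous_on UNIV U" "\<And>i. has_partial i U (\<lambda>x. - b i x)"
    and b: "\<And>i. continuous_on UNIV (b i)"
    and stationary: "\<And>L. int_freqs L \<Longrightarrow>
      (\<integral>y. (\<Sum>i\<in>UNIV. tpoly (tpoly_partial i (tpoly_partial i L)) y / \<beta> + b i y * tpoly (tpoly_partial i L) y) \<partial>\<mu>) = 0"
begin

section \<open>The mollified stationary equation and its Fisher information\<close>

lemma fin: "finite_measure \<mu>" using prob by (simp add: prob_space.finite_measure)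

lemma b_periodic: "periodic (b i)"
  using periodic_has_partial[OF U(3) U(1), of i] by (simp add: periodic_def)

lemma integrable_\<mu>: "periodic f \<Longrightarrow> continuous_on UNIV f \<Longrightarrow> integrable \<mu> f" for f :: "real ^ 'd \<Rightarrow> real"
  by (rule integrable_periodic_continuous[OF fin sets])

lemma integrable_const: "integrable \<mu> (\<lambda>_. 1 :: real)" by (rule integrable_\<mu>) (auto simp: periodic_def)

abbreviation dens :: "(real \<times> (real ^ 'd) \<times> real) list \<Rightarrow> (real \<times> (real ^ 'd) \<times> real) list" where
  "dens L \<equiv> tpoly_conv \<mu> (\<lambda>_. 1) L"

definition score :: "(real \<times> (real ^ 'd) \<times> real) list \<Rightarrow> 'd \<Rightarrow> real ^ 'd \<Rightarrow> real" where
  "score L i x = tpoly (tpoly_partial i (dens L)) x / tpoly (dens L) x - \<beta> * b i x"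

definition commutator :: "(real \<times> (real ^ 'd) \<times> real) list \<Rightarrow> 'd \<Rightarrow> real ^ 'd \<Rightarrow> real" where
  "commutator L i x = tpoly (tpoly_conv \<mu> (b i) L) x - b i x * tpoly (dens L) x"

lemma dens_positive:
  assumes "int_freqs L" "\<And>x. 0 < tpoly L x"
  shows "0 < tpoly (dens L) x"
  by (rule tpoly_conv_positive[OF sets integrable_const _ _ assms]) (simp_all add: prob_space.prob_space[OF prob])

text \<open>Stationarity tested with L (x - y) as a function of y: the mollified flux has divergence
  zero. The drift term changes sign because y enters with a minus.\<close>

lemma div_free:
  assumes "int_freqs L"
  shows "(\<Sum>i\<in>UNIV. tpoly (tpoly_partial i (tpoly_partial i (dens L))) x / \<beta> - tpoly (tpoly_partial i (tpoly_conv \<mu> (b i) L)) x) = 0"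
proof -
  have bi: "integrable \<mu> (b i)" for i by (rule integrable_\<mu>[OF b_periodic b])
  have 1: "has_bochner_integral \<mu> (\<lambda>y. tpoly (tpoly_partial i (tpoly_partial i L)) (x - y) * 1 / \<beta>)
      (tpoly (tpoly_partial i (tpoly_partial i (dens L))) x / \<beta>)" for i
  proof -
    have "tpoly (tpoly_partial i (dens L)) = tpoly (dens (tpoly_partial i L))"
      by (simp add: fun_eq_iff tpoly_partial_conv)
    then have "tpoly (tpoly_partial i (tpoly_partial i (dens L))) = tpoly (tpoly_partial i (dens (tpoly_partial i L)))"
      using has_partial_unique has_partial_tpoly by metis
    then have "tpoly (tpoly_partial i (tpoly_partial i (dens L))) x = tpoly (dens (tpoly_partial i (tpoly_partial i L))) x"
      by (simp add: tpoly_partial_conv)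
    then show ?thesis
      using tpoly_conv_integral[OF sets integrable_const, of "tpoly_partial i (tpoly_partial i L)" x]
      by (intro has_bochner_integral_divide) simp
  qed
  have 2: "has_bochner_integral \<mu> (\<lambda>y. tpoly (tpoly_partial i L) (x - y) * b i y)
      (tpoly (tpoly_partial i (tpoly_conv \<mu> (b i) L)) x)" for i
    unfolding tpoly_partial_conv by (rule tpoly_conv_integral[OF sets bi])
  have "has_bochner_integral \<mu> (\<lambda>y. \<Sum>i\<in>UNIV. tpoly (tpoly_partial i (tpoly_partial i L)) (x - y) * 1 / \<beta> - tpoly (tpoly_partial i L) (x - y) * b i y)
     (\<Sum>i\<in>UNIV. tpoly (tpoly_partial i (tpoly_partial i (dens L))) x / \<beta> - tpoly (tpoly_partial i (tpoly_conv \<mu> (b i) L)) x)"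
    by (intro has_bochner_integral_sum has_bochner_integral_diff 1 2)
  moreover have "(\<integral>y. (\<Sum>i\<in>UNIV. tpoly (tpoly_partial i (tpoly_partial i L)) (x - y) * 1 / \<beta> - tpoly (tpoly_partial i L) (x - y) * b i y) \<partial>\<mu>) = 0"
    using stationary[of "tpoly_reflect x L"] assms
    by (simp add: tpoly_partial_partial_reflect tpoly_partial_reflect mult.commute)
  ultimately show ?thesis by (simp add: has_bochner_integral_iff)
qed

lemma score_periodic: "int_freqs L \<Longrightarrow> periodic (score L i)"
  using periodic_tpoly[of "dens L"] periodic_tpoly[of "tpoly_partial i (dens L)"] b_periodic[of i]
  by (simp add: periodic_def score_def)

lemma score_continuous:
  assumes "int_freqs L" "\<And>x. 0 < tpoly L x"
  shows "continuous_on UNIV (score L i)"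
proof -
  have "tpoly (dens L) x \<noteq> 0" for x using dens_positive[OF assms, of x] by simp
  then show ?thesis unfolding score_def by (intro continuous_intros b) auto
qed

text \<open>
  Testing the stationary equation of the mollified measure with \<open>log f + \<beta> U\<close>, whose gradient is
  the score, bounds the relative Fisher information by the commutator of the mollification with
  the drift.
\<close>

lemma score_commutator:
  assumes L: "int_freqs L" "\<And>x. 0 < tpoly L x"
  shows "(\<Sum>i\<in>UNIV. \<integral>x. (tpoly (dens L) x * score L i x / \<beta> - commutator L i x) * score L i x \<partial>torus) = 0"
proof -
  let ?f = "tpoly (dens L)"
  define H where "H x = ln (?f x) + \<beta> * U x" for x
  \<comment> \<open>The mollified flux. Since its divergence vanishes, integrating the gradient of H
    against it gives 0, and the flux is \<open>score\<close> times the density over \<beta>, up to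
    the commutator.\<close>
  define J where "J i x = tpoly (tpoly_partial i (dens L)) x / \<beta> - tpoly (tpoly_conv \<mu> (b i) L) x" for i x
  define J' where "J' i x = tpoly (tpoly_partial i (tpoly_partial i (dens L))) x / \<beta> - tpoly (tpoly_partial i (tpoly_conv \<mu> (b i) L)) x" for i x
  have pos: "0 < ?f x" for x by (rule dens_positive[OF L])
  have f0: "?f x \<noteq> 0" for x using pos[of x] by simp
  have J_eq: "J i x = ?f x * score L i x / \<beta> - commutator L i x" for i x
    using f0[of x] \<beta> by (simp add: J_def score_def commutator_def field_simps)
  have cH: "continuous_on UNIV H" unfolding H_def by (intro continuous_intros U) (auto simp: f0)
  have cJ: "continuous_on UNIV (J i)" "continuous_on UNIV (J' i)" for i unfolding J_def J'_def by (intro continuous_intros; use \<beta> in simp)+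
  have pH: "periodic H" using periodic_tpoly[of "dens L"] L U(1) by (simp add: H_def periodic_def)
  have pJ: "periodic (J i)" "periodic (J' i)" for i
    using periodic_tpoly[of "tpoly_partial i (dens L)"] periodic_tpoly[of "tpoly_conv \<mu> (b i) L"]
      periodic_tpoly[of "tpoly_partial i (tpoly_partial i (dens L))"] periodic_tpoly[of "tpoly_partial i (tpoly_conv \<mu> (b i) L)"] L
    by (auto simp: J_def J'_def periodic_def)
  have cs: "continuous_on UNIV (score L i)" for i by (rule score_continuous[OF L])
  have ps: "periodic (score L i)" for i by (rule score_periodic[OF L(1)])
  have hp: "has_partial i (\<lambda>x. H x * J i x) (\<lambda>x. H x * J' i x + J i x * score L i x)" for i
    unfolding has_partial_def
  proof
    fix x
    note d = has_partialD[OF has_partial_tpoly] has_partialD[OF U(3)]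
    have dH: "((\<lambda>s. H (x + s *\<^sub>R axis i 1)) has_real_derivative score L i x) (at 0)"
      unfolding H_def score_def by (rule derivative_eq_intros d refl | simp add: pos f0)+
    have dJ: "((\<lambda>s. J i (x + s *\<^sub>R axis i 1)) has_real_derivative J' i x) (at 0)"
      unfolding J_def J'_def by (intro DERIV_diff DERIV_cdivide d)
    from DERIV_mult[OF dH dJ]
    show "((\<lambda>s. H (x + s *\<^sub>R axis i 1) * J i (x + s *\<^sub>R axis i 1)) has_real_derivative (H x * J' i x + J i x * score L i x)) (at 0)"
      by (simp add: mult.commute add.commute)
  qed
  have i1: "integrable torus (\<lambda>x. H x * J' i x)" for i
    by (rule integrable_torus) (use pH pJ[of i] in \<open>auto simp: periodic_def intro!: continuous_intros cH cJ\<close>)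
  have i2: "integrable torus (\<lambda>x. J i x * score L i x)" for i
    by (rule integrable_torus) (use ps[of i] pJ[of i] in \<open>auto simp: periodic_def intro!: continuous_intros cs cJ\<close>)
  have "(\<integral>x. J i x * score L i x \<partial>torus) = - (\<integral>x. H x * J' i x \<partial>torus)" for i
  proof -
    have "(\<integral>x. H x * J' i x + J i x * score L i x \<partial>torus) = 0"
      by (rule integral_torus_partial[OF hp]) (use pH pJ[of i] in \<open>auto simp: periodic_def intro!: continuous_intros cH cJ cs\<close>)
    then show ?thesis using i1[of i] i2[of i] by simp
  qed
  then have "(\<Sum>i\<in>UNIV. \<integral>x. J i x * score L i x \<partial>torus) = - (\<integral>x. (\<Sum>i\<in>UNIV. H x * J' i x) \<partial>torus)"
    using i1 by (simp add: Bochner_Integration.integral_sum sum_negf)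
  also have "(\<lambda>x. \<Sum>i\<in>UNIV. H x * J' i x) = (\<lambda>x. 0)"
    using div_free[OF L(1)] unfolding J'_def by (simp add: sum_distrib_left[symmetric])
  finally show ?thesis unfolding J_eq by simp
qed

text \<open>The integral of L (x - y) (b y - b x)^2 over \<mu>, expanded. By Cauchy-Schwarz it
  dominates the squared commutator divided by the density; unlike that quotient it is linear in the
  mollified measures, so its limit follows from weak convergence.\<close>

definition defect :: "(real \<times> (real ^ 'd) \<times> real) list \<Rightarrow> 'd \<Rightarrow> real ^ 'd \<Rightarrow> real" where
  "defect L i x = tpoly (tpoly_conv \<mu> (\<lambda>y. (b i y)\<^sup>2) L) x - 2 * b i x * tpoly (tpoly_conv \<mu> (b i) L) x + (b i x)\<^sup>2 * tpoly (dens L) x"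

lemma commutator_le_defect:
  assumes L: "int_freqs L" "\<And>x. 0 < tpoly L x"
  shows "(commutator L i x)\<^sup>2 / tpoly (dens L) x \<le> defect L i x"
proof -
  have bi: "integrable \<mu> (b i)" by (rule integrable_\<mu>[OF b_periodic b])
  have b2: "integrable \<mu> (\<lambda>y. (b i y)\<^sup>2)"
    by (rule integrable_\<mu>) (use b_periodic[of i] in \<open>auto simp: periodic_def intro!: continuous_intros b\<close>)
  have hd: "has_bochner_integral \<mu> (\<lambda>y. tpoly L (x - y)) (tpoly (dens L) x)"
    using tpoly_conv_integral[OF sets integrable_const, of L x] by simp
  have h1: "has_bochner_integral \<mu> (\<lambda>y. tpoly L (x - y) * (b i y - b i x)) (commutator L i x)"
    using has_bochner_integral_diff[OF tpoly_conv_integral[OF sets bi, of L x] has_bochner_integral_mult_right[OF hd, of "b i x"]]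
    by (simp add: commutator_def algebra_simps)
  have h2: "has_bochner_integral \<mu> (\<lambda>y. tpoly L (x - y) * (b i y - b i x)\<^sup>2) (defect L i x)"
    using has_bochner_integral_add[OF has_bochner_integral_diff[OF tpoly_conv_integral[OF sets b2, of L x]
        has_bochner_integral_mult_right[OF tpoly_conv_integral[OF sets bi, of L x], of "2 * b i x"]] has_bochner_integral_mult_right[OF hd, of "(b i x)\<^sup>2"]]
    by (simp add: defect_def power2_diff algebra_simps)
  show ?thesis
    using weighted_Cauchy_Schwarz[of \<mu> "\<lambda>y. tpoly L (x - y)" "\<lambda>y. b i y - b i x"] hd h1 h2 L(2) dens_positive[OF L, of x]
    by (simp add: has_bochner_integral_iff less_imp_le)
qed

lemma defect_periodic_continuous:
  assumes "int_freqs L"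
  shows "periodic (defect L i)" "continuous_on UNIV (defect L i)"
proof -
  show "periodic (defect L i)"
    using periodic_tpoly[of "dens L"] periodic_tpoly[of "tpoly_conv \<mu> (b i) L"] periodic_tpoly[of "tpoly_conv \<mu> (\<lambda>y. (b i y)\<^sup>2) L"]
      b_periodic[of i] assms by (simp add: periodic_def defect_def)
  show "continuous_on UNIV (defect L i)" unfolding defect_def by (intro continuous_intros b)
qed

text \<open>By \<open>score_commutator\<close> the Fisher information is \<beta> times the integral
  of commutator times score. Writing f, s, r for density, score and commutator, (f s - \<beta> r)^2
  / f \<ge> 0 bounds that product, and half of the Fisher information is absorbed.\<close>

lemma relative_Fisher_information_le:
  assumes L: "int_freqs L" "\<And>x. 0 < tpoly L x"
  shows "(\<Sum>i\<in>UNIV. \<integral>x. tpoly (dens L) x * (score L i x)\<^sup>2 \<partial>torus) \<le> \<beta>\<^sup>2 * (\<Sum>i\<in>UNIV. integral\<^sup>L torus (defect L i))"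
proof -
  let ?f = "tpoly (dens L)"
  have pos: "0 < ?f x" for x by (rule dens_positive[OF L])
  have cs: "continuous_on UNIV (score L i)" for i by (rule score_continuous[OF L])
  have ps: "periodic (score L i)" for i by (rule score_periodic[OF L(1)])
  have cc: "continuous_on UNIV (commutator L i)" for i unfolding commutator_def by (intro continuous_intros b)
  have pc: "periodic (commutator L i)" for i
    using periodic_tpoly[of "dens L"] periodic_tpoly[of "tpoly_conv \<mu> (b i) L"] b_periodic[of i] L(1)
    by (simp add: periodic_def commutator_def)
  have pf: "periodic ?f" using L by (intro periodic_tpoly) simp
  have i1: "integrable torus (\<lambda>x. ?f x * (score L i x)\<^sup>2)" for i
    by (rule integrable_torus) (use pf ps[of i] in \<open>auto simp: periodic_def intro!: continuous_intros cs\<close>)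
  have i2: "integrable torus (\<lambda>x. (?f x * score L i x / \<beta> - commutator L i x) * score L i x)" for i
    by (rule integrable_torus) (use pf ps[of i] pc[of i] \<beta> in \<open>auto simp: periodic_def intro!: continuous_intros cs cc\<close>)
  have i3: "integrable torus (defect L i)" for i using defect_periodic_continuous[OF L(1)] by (rule integrable_torus)
  have pt: "?f x * (score L i x)\<^sup>2 \<le> 2 * \<beta> * ((?f x * score L i x / \<beta> - commutator L i x) * score L i x) + \<beta>\<^sup>2 * defect L i x" for i x
  proof -
    define s r f where "s = score L i x" and "r = commutator L i x" and "f = ?f x"
    have f: "f > 0" using pos by (simp add: f_def)
    have "0 \<le> (f * s - \<beta> * r)\<^sup>2 / f" using f by simp
    also have "(f * s - \<beta> * r)\<^sup>2 / f = f * s\<^sup>2 - 2 * \<beta> * (r * s) + \<beta>\<^sup>2 * (r\<^sup>2 / f)"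
      using f by (simp add: power2_eq_square field_simps)
    also have "\<beta>\<^sup>2 * (r\<^sup>2 / f) \<le> \<beta>\<^sup>2 * defect L i x"
      using commutator_le_defect[OF L, of i x] by (intro mult_left_mono) (auto simp: r_def f_def)
    finally have "0 \<le> f * s\<^sup>2 - 2 * \<beta> * (r * s) + \<beta>\<^sup>2 * defect L i x" by simp
    moreover have "2 * \<beta> * ((f * s / \<beta> - r) * s) = 2 * (f * s\<^sup>2) - 2 * \<beta> * (r * s)"
      using \<beta> by (simp add: field_simps power2_eq_square)
    ultimately show ?thesis unfolding s_def[symmetric] r_def[symmetric] f_def[symmetric] by linarith
  qed
  have "(\<integral>x. ?f x * (score L i x)\<^sup>2 \<partial>torus)
      \<le> 2 * \<beta> * (\<integral>x. (?f x * score L i x / \<beta> - commutator L i x) * score L i x \<partial>torus) + \<beta>\<^sup>2 * integral\<^sup>L torus (defect L i)" for i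
  proof -
    have "(\<integral>x. ?f x * (score L i x)\<^sup>2 \<partial>torus)
      \<le> (\<integral>x. 2 * \<beta> * ((?f x * score L i x / \<beta> - commutator L i x) * score L i x) + \<beta>\<^sup>2 * defect L i x \<partial>torus)"
      by (rule integral_mono[OF i1 _ pt]) (use i2 i3 in simp)
    then show ?thesis using i2[of i] i3[of i] by simp
  qed
  then have "(\<Sum>i\<in>UNIV. \<integral>x. ?f x * (score L i x)\<^sup>2 \<partial>torus)
      \<le> (\<Sum>i\<in>UNIV. 2 * \<beta> * (\<integral>x. (?f x * score L i x / \<beta> - commutator L i x) * score L i x \<partial>torus) + \<beta>\<^sup>2 * integral\<^sup>L torus (defect L i))"
    by (rule sum_mono)
  also have "\<dots> = 2 * \<beta> * (\<Sum>i\<in>UNIV. \<integral>x. (?f x * score L i x / \<beta> - commutator L i x) * score L i x \<partial>torus)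
      + \<beta>\<^sup>2 * (\<Sum>i\<in>UNIV. integral\<^sup>L torus (defect L i))"
    by (simp add: sum.distrib sum_distrib_left)
  finally show ?thesis using score_commutator[OF L] by simp
qed

text \<open>Each of the three terms of the expanded square converges to a multiple of the integral
  of b_i^2 over \<mu>, with the factors 1, -2 and 1.\<close>

lemma defect_tendsto_0:
  assumes K: "approx_identity K"
  shows "(\<lambda>n. \<Sum>i\<in>UNIV. integral\<^sup>L torus (defect (K n) i)) \<longlonglongrightarrow> 0"
proof -
  have Kn: "int_freqs (K n)" for n using K by (auto simp: approx_identity_def)
  have "(\<lambda>n. integral\<^sup>L torus (defect (K n) i)) \<longlonglongrightarrow> 0" for i
  proof -
    have bi: "integrable \<mu> (b i)" by (rule integrable_\<mu>[OF b_periodic b])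
    have p2: "periodic (\<lambda>y. (b i y)\<^sup>2)" "continuous_on UNIV (\<lambda>y. (b i y)\<^sup>2)"
      using b_periodic[of i] by (auto simp: periodic_def intro!: continuous_intros b)
    have p1: "periodic (\<lambda>y. 1 :: real)" by (simp add: periodic_def)
    have b2: "integrable \<mu> (\<lambda>y. (b i y)\<^sup>2)" by (rule integrable_\<mu>[OF p2])
    have "integral\<^sup>L torus (defect (K n) i) = (\<integral>x. tpoly (tpoly_conv \<mu> (\<lambda>y. (b i y)\<^sup>2) (K n)) x * 1 \<partial>torus)
        - 2 * (\<integral>x. tpoly (tpoly_conv \<mu> (b i) (K n)) x * b i x \<partial>torus) + (\<integral>x. tpoly (dens (K n)) x * (b i x)\<^sup>2 \<partial>torus)" for n
    proof -
      have "integrable torus (tpoly (tpoly_conv \<mu> (\<lambda>y. (b i y)\<^sup>2) (K n)))"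
        by (intro integrable_torus periodic_tpoly int_freqs_conv Kn continuous_intros)
      moreover have defect_eq: "defect (K n) i = (\<lambda>x. tpoly (tpoly_conv \<mu> (\<lambda>y. (b i y)\<^sup>2) (K n)) x * 1
          - 2 * (tpoly (tpoly_conv \<mu> (b i) (K n)) x * b i x) + tpoly (dens (K n)) x * (b i x)\<^sup>2)"
        by (simp add: fun_eq_iff defect_def)
      moreover have "integrable torus (\<lambda>x. tpoly (tpoly_conv \<mu> (b i) (K n)) x * b i x)"
        using periodic_tpoly[OF int_freqs_conv[OF Kn[of n]], of \<mu> "b i"] b_periodic[of i]
        by (intro integrable_torus continuous_intros b) (simp add: periodic_def)
      moreover have "integrable torus (\<lambda>x. tpoly (dens (K n)) x * (b i x)\<^sup>2)"
        using periodic_tpoly[OF int_freqs_conv[OF Kn[of n]], of \<mu> "\<lambda>_. 1"] b_periodic[of i]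
        by (intro integrable_torus continuous_intros b) (simp add: periodic_def)
      ultimately show ?thesis
        unfolding defect_eq by simp
    qed
    moreover have "(\<lambda>n. (\<integral>x. tpoly (tpoly_conv \<mu> (\<lambda>y. (b i y)\<^sup>2) (K n)) x * 1 \<partial>torus)
        - 2 * (\<integral>x. tpoly (tpoly_conv \<mu> (b i) (K n)) x * b i x \<partial>torus) + (\<integral>x. tpoly (dens (K n)) x * (b i x)\<^sup>2 \<partial>torus))
       \<longlonglongrightarrow> (\<integral>y. 1 * (b i y)\<^sup>2 \<partial>\<mu>) - 2 * (\<integral>y. b i y * b i y \<partial>\<mu>) + (\<integral>y. (b i y)\<^sup>2 * 1 \<partial>\<mu>)"
      by (intro tendsto_intros approx_identity_conv_tendsto[OF K sets b2 p1] approx_identity_conv_tendsto[OF K sets bi b_periodic b]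
          approx_identity_conv_tendsto[OF K sets integrable_const p2]) auto
    ultimately show ?thesis by (simp add: power2_eq_square)
  qed
  then have "(\<lambda>n. \<Sum>i\<in>UNIV. integral\<^sup>L torus (defect (K n) i)) \<longlonglongrightarrow> (\<Sum>i\<in>(UNIV :: 'd set). 0)"
    by (rule tendsto_sum)
  then show ?thesis by simp
qed

text \<open>The i-th component of \<nabla>\<mu> = \<beta> b \<mu> in weak form. For the mollified
  density f the integral equals minus that of f times score times \<phi>; Cauchy-Schwarz bounds its
  square by C^2 times the Fisher information, which tends to 0.\<close>

lemma first_order_equation:
  assumes \<phi>: "periodic \<phi>" "continuous_on UNIV \<phi>" "has_partial i \<phi> \<phi>'" "continuous_on UNIV \<phi>'"
  shows "(\<integral>y. \<phi>' y + \<beta> * b i y * \<phi> y \<partial>\<mu>) = 0"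
proof -
  obtain K :: "nat \<Rightarrow> (real \<times> (real ^ 'd) \<times> real) list" where K: "approx_identity K"
    using approx_identity_exists by blast
  have Kn: "int_freqs (K n)" "0 < tpoly (K n) x" "integral\<^sup>L torus (tpoly (K n)) = 1" for n x
    using K by (auto simp: approx_identity_def)
  have p': "periodic \<phi>'" by (rule periodic_has_partial[OF \<phi>(3,1)])
  let ?f = "\<lambda>n. tpoly (dens (K n))"
  define I where "I n = (\<integral>x. ?f n x * (\<phi>' x + \<beta> * b i x * \<phi> x) \<partial>torus)" for n
  have lim: "I \<longlonglongrightarrow> (\<integral>y. (\<phi>' y + \<beta> * b i y * \<phi> y) * 1 \<partial>\<mu>)"
    unfolding I_def
    by (rule approx_identity_conv_tendsto[OF K sets integrable_const])
       (use p' \<phi>(1) b_periodic[of i] in \<open>auto simp: periodic_def intro!: continuous_intros \<phi> b\<close>)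
  obtain C where C: "C > 0" "\<And>x. \<bar>\<phi> x\<bar> \<le> C" using periodic_continuous_bounded[OF \<phi>(1,2)] by blast
  have bound: "(I n)\<^sup>2 \<le> C\<^sup>2 * (\<beta>\<^sup>2 * (\<Sum>i\<in>UNIV. integral\<^sup>L torus (defect (K n) i)))" for n
  proof -
    have pos: "0 < ?f n x" for x by (rule dens_positive[OF Kn(1,2)])
    have pf: "periodic (?f n)" "periodic (tpoly (tpoly_partial i (dens (K n))))" using Kn by (auto intro!: periodic_tpoly)
    have f1: "integral\<^sup>L torus (?f n) = 1"
      using integral_tpoly_conv[OF sets integrable_const Kn(1,3)] prob_space.prob_space[OF prob] by simp
    note cs = score_continuous[OF Kn(1,2), of n] and ps = score_periodic[OF Kn(1), of n]
    have sc: "?f n x * score (K n) i x = tpoly (tpoly_partial i (dens (K n))) x - \<beta> * b i x * ?f n x" for x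
      using pos[of x] by (simp add: score_def field_simps)
    have "has_partial i (\<lambda>x. ?f n x * \<phi> x) (\<lambda>x. ?f n x * (\<phi>' x + \<beta> * b i x * \<phi> x) + ?f n x * (score (K n) i x * \<phi> x))"
      unfolding has_partial_def
    proof
      fix x
      have "((\<lambda>s. ?f n (x + s *\<^sub>R axis i 1) * \<phi> (x + s *\<^sub>R axis i 1)) has_real_derivative
          tpoly (tpoly_partial i (dens (K n))) x * \<phi> x + \<phi>' x * ?f n x) (at 0)"
        using DERIV_mult[OF has_partialD[OF has_partial_tpoly[of i "dens (K n)"], of x] has_partialD[OF \<phi>(3), of x]]
        by simp
      moreover have "tpoly (tpoly_partial i (dens (K n))) x * \<phi> x + \<phi>' x * ?f n x
         = ?f n x * (\<phi>' x + \<beta> * b i x * \<phi> x) + ?f n x * (score (K n) i x * \<phi> x)"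
        unfolding mult.assoc[symmetric] sc by (simp add: algebra_simps)
      ultimately show "((\<lambda>s. ?f n (x + s *\<^sub>R axis i 1) * \<phi> (x + s *\<^sub>R axis i 1)) has_real_derivative
         ?f n x * (\<phi>' x + \<beta> * b i x * \<phi> x) + ?f n x * (score (K n) i x * \<phi> x)) (at 0)" by simp
    qed
    then have "(\<integral>x. ?f n x * (\<phi>' x + \<beta> * b i x * \<phi> x) + ?f n x * (score (K n) i x * \<phi> x) \<partial>torus) = 0"
      by (rule integral_torus_partial) (use pf(1) \<phi>(1) in \<open>auto simp: periodic_def intro!: continuous_intros \<phi> b cs\<close>)
    moreover have i1: "integrable torus (\<lambda>x. ?f n x * (\<phi>' x + \<beta> * b i x * \<phi> x))"
      by (rule integrable_torus) (use pf(1) p' \<phi>(1) b_periodic[of i] in \<open>auto simp: periodic_def intro!: continuous_intros \<phi> b\<close>)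
    moreover have i2: "integrable torus (\<lambda>x. ?f n x * (score (K n) i x * \<phi> x))"
      by (rule integrable_torus) (use pf(1) \<phi>(1) ps[of i] in \<open>auto simp: periodic_def intro!: continuous_intros \<phi> cs\<close>)
    ultimately have In: "I n = - (\<integral>x. ?f n x * (score (K n) i x * \<phi> x) \<partial>torus)"
      unfolding I_def by simp
    have i3: "integrable torus (\<lambda>x. ?f n x * (score (K n) i x * \<phi> x)\<^sup>2)"
      by (rule integrable_torus) (use pf(1) \<phi>(1) ps[of i] in \<open>auto simp: periodic_def intro!: continuous_intros \<phi> cs\<close>)
    have i4: "integrable torus (\<lambda>x. ?f n x * (score (K n) j x)\<^sup>2)" for j
      by (rule integrable_torus) (use pf(1) ps[of j] in \<open>auto simp: periodic_def intro!: continuous_intros cs\<close>)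
    have i5: "integrable torus (?f n)" by (rule integrable_torus[OF pf(1)]) (intro continuous_intros)
    have "(I n)\<^sup>2 \<le> (\<integral>x. ?f n x * (score (K n) i x * \<phi> x)\<^sup>2 \<partial>torus)"
      using weighted_Cauchy_Schwarz[OF i5 i2 i3 less_imp_le[OF pos]] f1 unfolding In by simp
    also have "\<dots> \<le> (\<integral>x. C\<^sup>2 * (?f n x * (score (K n) i x)\<^sup>2) \<partial>torus)"
    proof (rule integral_mono[OF i3])
      show "integrable torus (\<lambda>x. C\<^sup>2 * (?f n x * (score (K n) i x)\<^sup>2))" using i4 by simp
      fix x
      have "(\<phi> x)\<^sup>2 \<le> C\<^sup>2" using C(2)[of x] by (metis abs_le_square_iff abs_of_pos C(1))
      then have "(?f n x * (score (K n) i x)\<^sup>2) * (\<phi> x)\<^sup>2 \<le> (?f n x * (score (K n) i x)\<^sup>2) * C\<^sup>2"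
        using pos[of x] by (intro mult_left_mono) auto
      then show "?f n x * (score (K n) i x * \<phi> x)\<^sup>2 \<le> C\<^sup>2 * (?f n x * (score (K n) i x)\<^sup>2)"
        by (simp add: power_mult_distrib mult_ac)
    qed
    also have "\<dots> = C\<^sup>2 * (\<integral>x. ?f n x * (score (K n) i x)\<^sup>2 \<partial>torus)" by simp
    also have "\<dots> \<le> C\<^sup>2 * (\<Sum>j\<in>UNIV. \<integral>x. ?f n x * (score (K n) j x)\<^sup>2 \<partial>torus)"
      using pos by (intro mult_left_mono member_le_sum[where f="\<lambda>j. \<integral>x. ?f n x * (score (K n) j x)\<^sup>2 \<partial>torus"])
         (auto simp: less_imp_le)
    also have "\<dots> \<le> C\<^sup>2 * (\<beta>\<^sup>2 * (\<Sum>i\<in>UNIV. integral\<^sup>L torus (defect (K n) i)))"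
      by (intro mult_left_mono relative_Fisher_information_le[OF Kn(1,2)]) auto
    finally show ?thesis .
  qed
  have "(\<lambda>n. C\<^sup>2 * (\<beta>\<^sup>2 * (\<Sum>i\<in>UNIV. integral\<^sup>L torus (defect (K n) i)))) \<longlonglongrightarrow> C\<^sup>2 * (\<beta>\<^sup>2 * 0)"
    by (intro tendsto_intros defect_tendsto_0[OF K])
  moreover have "(\<lambda>n. (I n)\<^sup>2) \<longlonglongrightarrow> (\<integral>y. (\<phi>' y + \<beta> * b i y * \<phi> y) * 1 \<partial>\<mu>)\<^sup>2"
    by (intro tendsto_intros lim)
  ultimately have "(\<integral>y. (\<phi>' y + \<beta> * b i y * \<phi> y) * 1 \<partial>\<mu>)\<^sup>2 \<le> C\<^sup>2 * (\<beta>\<^sup>2 * 0)"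
    by (intro LIMSEQ_le) (use bound in auto)
  then show ?thesis by simp
qed

text \<open>For \<phi> = M exp (\<beta> U) the derivative of the exponential cancels \<beta> b
  \<phi>, so \<open>first_order_equation\<close> says that the derivative of M has integral 0
  against exp (\<beta> U) \<mu>. Every mode of nonzero frequency is such a derivative.\<close>

lemma weighted_fourier_modes:
  assumes "int_freqs L"
  shows "(\<integral>y. tpoly L y * exp (\<beta> * U y) \<partial>\<mu>) = (\<integral>y. exp (\<beta> * U y) \<partial>\<mu>) * integral\<^sup>L torus (tpoly L)"
  using assms
proof (induction L)
  case Nil
  have "tpoly [] = (\<lambda>_ :: real ^ 'd. 0)" by (simp add: fun_eq_iff)
  then show ?case by simp
next
  case (Cons p L)
  obtain a k \<theta> where p: "p = (a, k, \<theta>)" by (cases p)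
  have L: "int_freqs [(a, k, \<theta>)]" "int_freqs L" using Cons.prems p by auto
  have single: "(\<integral>y. tpoly [(a, k, \<theta>)] y * exp (\<beta> * U y) \<partial>\<mu>) = (\<integral>y. exp (\<beta> * U y) \<partial>\<mu>) * integral\<^sup>L torus (tpoly [(a, k, \<theta>)])"
  proof (cases "k = 0")
    case True
    then have "tpoly [(a, k, \<theta>)] = (\<lambda>_. a * cos \<theta>)" by (simp add: fun_eq_iff)
    then show ?thesis by (simp add: torus.prob_space del: space_torus tpoly_simps)
  next
    case False
    then obtain i where i: "k $ i \<noteq> 0" by (auto simp: vec_eq_iff)
    define M where "M = [(a / (2 * pi * k $ i), k, \<theta> - pi / 2)]"
    have M: "int_freqs M" using L by (simp add: M_def)
    have eq: "tpoly [(a, k, \<theta>)] = tpoly (tpoly_partial i M)" using i by (auto simp: M_def)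
    define \<phi> where "\<phi> y = tpoly M y * exp (\<beta> * U y)" for y
    define \<phi>' where "\<phi>' y = (tpoly (tpoly_partial i M) y - \<beta> * b i y * tpoly M y) * exp (\<beta> * U y)" for y
    have "(\<integral>y. \<phi>' y + \<beta> * b i y * \<phi> y \<partial>\<mu>) = 0"
    proof (rule first_order_equation)
      show "periodic \<phi>" using periodic_tpoly[OF M] U(1) by (simp add: periodic_def \<phi>_def)
      show "continuous_on UNIV \<phi>" "continuous_on UNIV \<phi>'" unfolding \<phi>_def \<phi>'_def by (intro continuous_intros U b)+
      show "has_partial i \<phi> \<phi>'"
        unfolding has_partial_def
      proof
        fix x
        have "((\<lambda>s. tpoly M (x + s *\<^sub>R axis i 1) * exp (\<beta> * U (x + s *\<^sub>R axis i 1))) has_real_derivative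
          tpoly (tpoly_partial i M) x * exp (\<beta> * U (x + 0 *\<^sub>R axis i 1)) + (exp (\<beta> * U (x + 0 *\<^sub>R axis i 1)) * (\<beta> * - b i x)) * tpoly M (x + 0 *\<^sub>R axis i 1)) (at 0)"
          by (intro DERIV_mult DERIV_fun_exp DERIV_cmult has_partialD[OF has_partial_tpoly] has_partialD[OF U(3)])
        then show "((\<lambda>s. \<phi> (x + s *\<^sub>R axis i 1)) has_real_derivative \<phi>' x) (at 0)"
          unfolding \<phi>_def \<phi>'_def by (simp add: algebra_simps)
      qed
    qed
    also have "(\<lambda>y. \<phi>' y + \<beta> * b i y * \<phi> y) = (\<lambda>y. tpoly [(a, k, \<theta>)] y * exp (\<beta> * U y))"
      unfolding eq \<phi>_def \<phi>'_def by (simp add: fun_eq_iff algebra_simps)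
    finally have "(\<integral>y. tpoly [(a, k, \<theta>)] y * exp (\<beta> * U y) \<partial>\<mu>) = 0" .
    moreover have "integral\<^sup>L torus (tpoly [(a, k, \<theta>)]) = 0"
      using integral_tpoly[OF L(1)] False by (simp del: tpoly_simps)
    ultimately show ?thesis by (simp del: tpoly_simps)
  qed
  have pU: "periodic (\<lambda>y. tpoly M y * exp (\<beta> * U y))" if "int_freqs M" for M
    using periodic_tpoly[OF that] U(1) by (simp add: periodic_def)
  have i: "integrable \<mu> (\<lambda>y. tpoly M y * exp (\<beta> * U y))" "integrable torus (tpoly M)" if "int_freqs M" for M
    by (intro integrable_\<mu> pU that continuous_intros U, intro integrable_torus periodic_tpoly that continuous_intros)
  have eq: "tpoly (p # L) = (\<lambda>y. tpoly [(a, k, \<theta>)] y + tpoly L y)" by (simp add: p fun_eq_iff)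
  show ?case
    unfolding eq distrib_right
    using i[OF L(1)] i[OF L(2)] single Cons.IH[OF L(2)] by (simp add: distrib_left del: tpoly_simps)
qed

text \<open>The measures exp (\<beta> U) \<mu> and Z times Haar measure agree on trigonometric
  polynomials, hence on continuous periodic functions, hence as measures; division by the strictly
  positive exponential gives the density.\<close>

theorem density_Gibbs: "\<exists>c>0. \<mu> = density torus (\<lambda>x. ennreal (c * exp (- \<beta> * U x)))"
proof -
  define Z where "Z = (\<integral>y. exp (\<beta> * U y) \<partial>\<mu>)"
  define E where "E y = exp (\<beta> * U y)" for y
  have pE: "periodic E" "continuous_on UNIV E" using U(1) by (auto simp: periodic_def E_def intro!: continuous_intros U)
  have iE: "integrable \<mu> E" by (rule integrable_\<mu>[OF pE])
  have Epos: "E y > 0" for y by (simp add: E_def)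
  obtain e where e: "e > 0" "\<And>y. e \<le> E y" using periodic_continuous_positive[OF pE Epos] by blast
  have "e \<le> Z"
  proof -
    have "(\<integral>y. e \<partial>\<mu>) \<le> (\<integral>y. E y \<partial>\<mu>)"
      by (rule integral_mono) (use iE e integrable_const in \<open>auto simp: finite_measure.integrable_const[OF fin]\<close>)
    then show ?thesis using prob_space.prob_space[OF prob] by (simp add: Z_def E_def)
  qed
  then have Z0: "Z > 0" using e by simp
  have Em: "E \<in> borel_measurable \<mu>" using iE by simp
  have Emt: "E \<in> borel_measurable torus" by (rule measurable_torus_continuous[OF pE(2)])
  have "density \<mu> (\<lambda>x. ennreal (E x)) = density torus (\<lambda>x. ennreal Z)"
  proof (rule measure_eqI_periodic_continuous)
    show "finite_measure (density \<mu> (\<lambda>x. ennreal (E x)))"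
    proof
      have "emeasure (density \<mu> (\<lambda>x. ennreal (E x))) (space \<mu>) = (\<integral>\<^sup>+x. ennreal (E x) \<partial>\<mu>)"
        using Em by (subst emeasure_density) (auto intro!: nn_integral_cong simp: indicator_def)
      also have "\<dots> < \<infinity>"
        using iE Epos by (simp add: nn_integral_eq_integral less_imp_le)
      finally show "emeasure (density \<mu> (\<lambda>x. ennreal (E x))) (space (density \<mu> (\<lambda>x. ennreal (E x)))) \<noteq> \<infinity>" by simp
    qed
    show "finite_measure (density torus (\<lambda>x :: real ^ 'd. ennreal Z))"
      by standard (simp add: emeasure_density_const ennreal_mult_eq_top_iff torus.emeasure_space_1 del: space_torus)
    show "sets (density \<mu> (\<lambda>x. ennreal (E x))) = sets torus" using sets by simp
    show "sets (density torus (\<lambda>x :: real ^ 'd. ennreal Z)) = sets torus" by simp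
    fix \<phi> :: "real ^ 'd \<Rightarrow> real" assume \<phi>: "periodic \<phi>" "continuous_on UNIV \<phi>"
    have \<phi>m: "\<phi> \<in> borel_measurable \<mu>"
      using measurable_torus_continuous[OF \<phi>(2)] measurable_cong_sets[OF sets refl] by blast
    have \<phi>mt: "\<phi> \<in> borel_measurable torus" by (rule measurable_torus_continuous[OF \<phi>(2)])
    obtain K :: "nat \<Rightarrow> (real \<times> (real ^ 'd) \<times> real) list" where K: "approx_identity K"
      using approx_identity_exists by blast
    have Kn: "int_freqs (K n)" for n using K by (auto simp: approx_identity_def)
    have int1: "integrable torus (\<lambda>_ :: real ^ 'd. 1 :: real)" by simp
    \<comment> \<open>The mollified measures agree exactly for every n, because only integrals of
      trigonometric polynomials enter. Letting n tend to infinity then compares the integrals of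
      \<phi>.\<close>
    have conv_eq: "tpoly (tpoly_conv \<mu> E (K n)) x = Z * tpoly (tpoly_conv torus (\<lambda>_. 1) (K n)) x" for n x
    proof -
      have "tpoly (tpoly_conv \<mu> E (K n)) x = (\<integral>y. tpoly (tpoly_reflect x (K n)) y * E y \<partial>\<mu>)"
        using tpoly_conv_integral[OF sets iE, of "K n" x] by (simp add: tpoly_reflect has_bochner_integral_iff)
      also have "\<dots> = Z * integral\<^sup>L torus (tpoly (tpoly_reflect x (K n)))"
        unfolding E_def Z_def by (rule weighted_fourier_modes) (simp add: Kn)
      also have "integral\<^sup>L torus (tpoly (tpoly_reflect x (K n))) = tpoly (tpoly_conv torus (\<lambda>_. 1) (K n)) x"
      proof -
        have "tpoly (tpoly_reflect x (K n)) = (\<lambda>y. tpoly (K n) (x - y))" by (simp add: fun_eq_iff tpoly_reflect)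
        then show ?thesis
          using tpoly_conv_integral[OF refl int1, of "K n" x] by (simp add: has_bochner_integral_iff)
      qed
      finally show ?thesis .
    qed
    have "(\<lambda>n. \<integral>x. tpoly (tpoly_conv \<mu> E (K n)) x * \<phi> x \<partial>torus) \<longlonglongrightarrow> (\<integral>y. \<phi> y * E y \<partial>\<mu>)"
      by (rule approx_identity_conv_tendsto[OF K sets iE \<phi>])
    moreover have "(\<lambda>n. Z * (\<integral>x. tpoly (tpoly_conv torus (\<lambda>_. 1) (K n)) x * \<phi> x \<partial>torus)) \<longlonglongrightarrow> Z * (\<integral>y. \<phi> y * 1 \<partial>torus)"
      by (intro tendsto_intros approx_identity_conv_tendsto[OF K refl int1 \<phi>])
    ultimately have "(\<integral>y. \<phi> y * E y \<partial>\<mu>) = Z * (\<integral>y. \<phi> y \<partial>torus)"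
      unfolding conv_eq mult.assoc by (auto intro: LIMSEQ_unique)
    moreover have "integral\<^sup>L (density \<mu> (\<lambda>x. ennreal (E x))) \<phi> = (\<integral>y. E y * \<phi> y \<partial>\<mu>)"
      using \<phi>m Em Epos by (subst integral_density) (auto simp: less_imp_le)
    moreover have "integral\<^sup>L (density torus (\<lambda>x. ennreal Z)) \<phi> = Z * (\<integral>y. \<phi> y \<partial>torus)"
      using \<phi>mt Z0 by (subst integral_density) (auto simp: less_imp_le)
    ultimately show "integral\<^sup>L (density \<mu> (\<lambda>x. ennreal (E x))) \<phi> = integral\<^sup>L (density torus (\<lambda>x. ennreal Z)) \<phi>"
      by (simp add: mult.commute)
  qed
  then have "density (density \<mu> (\<lambda>x. ennreal (E x))) (\<lambda>x. ennreal (inverse (E x)))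
     = density (density torus (\<lambda>x. ennreal Z)) (\<lambda>x. ennreal (inverse (E x)))" by simp
  moreover have "density (density \<mu> (\<lambda>x. ennreal (E x))) (\<lambda>x. ennreal (inverse (E x))) = \<mu>"
  proof -
    have "density (density \<mu> (\<lambda>x. ennreal (E x))) (\<lambda>x. ennreal (inverse (E x))) = density \<mu> (\<lambda>x. ennreal (E x) * ennreal (inverse (E x)))"
      by (rule density_density_eq) (use Em in auto)
    also have "(\<lambda>x. ennreal (E x) * ennreal (inverse (E x))) = (\<lambda>x. 1)"
      using Epos by (simp add: fun_eq_iff ennreal_mult[symmetric] less_imp_le less_imp_neq[symmetric])
    finally show ?thesis by (simp add: density_1)
  qed
  moreover have "density (density torus (\<lambda>x. ennreal Z)) (\<lambda>x. ennreal (inverse (E x))) = density torus (\<lambda>x. ennreal (Z * exp (- \<beta> * U x)))"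
  proof -
    have "density (density torus (\<lambda>x. ennreal Z)) (\<lambda>x. ennreal (inverse (E x))) = density torus (\<lambda>x. ennreal Z * ennreal (inverse (E x)))"
      by (rule density_density_eq) (use Emt in auto)
    also have "(\<lambda>x. ennreal Z * ennreal (inverse (E x))) = (\<lambda>x. ennreal (Z * exp (- \<beta> * U x)))"
      using Z0 by (simp add: fun_eq_iff ennreal_mult[symmetric] E_def exp_minus)
    finally show ?thesis .
  qed
  ultimately have "\<mu> = density torus (\<lambda>x. ennreal (Z * exp (- \<beta> * U x)))" by simp
  then show ?thesis using Z0 by blast
qed

end

subsection \<open>Convolution with a measure\<close>

lemma measurable_periodic:
  fixes f :: "real ^ 'd \<Rightarrow> real"
  assumes "sets \<mu> = sets torus" "continuous_on UNIV f"
  shows "f \<in> borel_measurable \<mu>"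
  using measurable_torus_continuous[OF assms(2)] measurable_cong_sets[OF assms(1) refl] by blast

lemma periodic_conv:
  fixes f :: "real ^ 'd \<Rightarrow> real"
  assumes "periodic f"
  shows "periodic (\<lambda>x. \<integral>y. f (x - y) \<partial>\<mu>)"
proof -
  have "f (x + axis i 1 - y) = f (x - y)" for x y i
    using assms unfolding periodic_def by (metis add_diff_eq diff_add_eq)
  then show ?thesis by (simp add: periodic_def)
qed

lemma continuous_on_conv:
  fixes f :: "real ^ 'd \<Rightarrow> real"
  assumes \<mu>: "finite_measure \<mu>" "sets \<mu> = sets torus" and f: "periodic f" "continuous_on UNIV f"
  shows "continuous_on UNIV (\<lambda>x. \<integral>y. f (x - y) \<partial>\<mu>)"
proof -
  interpret finite_measure \<mu> by fact
  obtain C where C: "C > 0" "\<And>x. \<bar>f x\<bar> \<le> C" using periodic_continuous_bounded[OF f] by blast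
  have cm: "continuous_on UNIV (\<lambda>y. f (x - y))" for x
    by (rule continuous_on_compose2[OF f(2)]) (auto intro!: continuous_intros)
  have "isCont (\<lambda>x. \<integral>y. f (x - y) \<partial>\<mu>) x" for x
    unfolding continuous_at_sequentially o_def
  proof (intro allI impI)
    fix u :: "nat \<Rightarrow> real ^ 'd" assume u: "u \<longlonglongrightarrow> x"
    show "(\<lambda>n. \<integral>y. f (u n - y) \<partial>\<mu>) \<longlonglongrightarrow> (\<integral>y. f (x - y) \<partial>\<mu>)"
    proof (rule integral_dominated_convergence[where w="\<lambda>_. C"])
      have "(\<lambda>n. f (u n - y)) \<longlonglongrightarrow> f (x - y)" for y
        using f(2) by (rule continuous_on_tendsto_compose) (auto intro!: tendsto_intros u)
      then show "AE y in \<mu>. (\<lambda>n. f (u n - y)) \<longlonglongrightarrow> f (x - y)" by (intro AE_I2)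
    qed (use C measurable_periodic[OF \<mu>(2) cm] in auto)
  qed
  then show ?thesis by (intro continuous_at_imp_continuous_on) blast
qed

text \<open>A bound for f' makes f Lipschitz along the axis, which dominates the difference
  quotients.\<close>

lemma has_partial_conv:
  fixes f :: "real ^ 'd \<Rightarrow> real"
  assumes \<mu>: "finite_measure \<mu>" "sets \<mu> = sets torus" and f: "periodic f" "continuous_on UNIV f"
    and f': "has_partial i f f'" "continuous_on UNIV f'"
  shows "has_partial i (\<lambda>x. \<integral>y. f (x - y) \<partial>\<mu>) (\<lambda>x. \<integral>y. f' (x - y) \<partial>\<mu>)"
  unfolding has_partial_def
proof
  fix x :: "real ^ 'd"
  interpret finite_measure \<mu> by fact
  have pf': "periodic f'" by (rule periodic_has_partial[OF f'(1) f(1)])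
  obtain C where C: "C > 0" "\<And>x. \<bar>f' x\<bar> \<le> C" using periodic_continuous_bounded[OF pf' f'(2)] by blast
  have cm: "continuous_on UNIV (\<lambda>y. g (x - y))" if "continuous_on UNIV g" for x and g :: "real ^ 'd \<Rightarrow> real"
    by (rule continuous_on_compose2[OF that]) (auto intro!: continuous_intros)
  have int: "integrable \<mu> (\<lambda>y. f (x - y))" for x
    by (rule integrable_periodic_continuous[OF \<mu> periodic_minus_left[OF f(1)] cm[OF f(2)]])
  have lip: "\<bar>f (z + s *\<^sub>R axis i 1) - f z\<bar> \<le> C * \<bar>s\<bar>" for z s
  proof -
    have "norm (f (z + s *\<^sub>R axis i 1) - f (z + 0 *\<^sub>R axis i 1)) \<le> C * norm (s - 0)"
      by (rule field_differentiable_bound[where S=UNIV and f="\<lambda>s. f (z + s *\<^sub>R axis i 1)" and f'="\<lambda>s. f' (z + s *\<^sub>R axis i 1)"])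
         (auto intro: has_partial_line[OF f'(1)] C)
    then show ?thesis by simp
  qed
  have "((\<lambda>s. ((\<integral>y. f (x + s *\<^sub>R axis i 1 - y) \<partial>\<mu>) - (\<integral>y. f (x - y) \<partial>\<mu>)) / s) \<longlongrightarrow> (\<integral>y. f' (x - y) \<partial>\<mu>)) (at 0)"
    unfolding tendsto_at_iff_sequentially o_def
  proof (intro allI impI)
    fix s :: "nat \<Rightarrow> real" assume s0: "\<forall>n. s n \<in> UNIV - {0}" and s: "s \<longlonglongrightarrow> 0"
    have eq: "((\<integral>y. f (x + s n *\<^sub>R axis i 1 - y) \<partial>\<mu>) - (\<integral>y. f (x - y) \<partial>\<mu>)) / s n
        = (\<integral>y. (f (x + s n *\<^sub>R axis i 1 - y) - f (x - y)) / s n \<partial>\<mu>)" for n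
      using int[of "x + s n *\<^sub>R axis i 1"] int[of x] by simp
    have e: "x + r *\<^sub>R axis i 1 - y = x - y + r *\<^sub>R axis i 1" for r y by simp
    show "(\<lambda>n. ((\<integral>y. f (x + s n *\<^sub>R axis i 1 - y) \<partial>\<mu>) - (\<integral>y. f (x - y) \<partial>\<mu>)) / s n) \<longlonglongrightarrow> (\<integral>y. f' (x - y) \<partial>\<mu>)"
      unfolding eq
    proof (rule integral_dominated_convergence[where w="\<lambda>_. C"])
      show "(\<lambda>y. f' (x - y)) \<in> borel_measurable \<mu>" by (rule measurable_periodic[OF \<mu>(2) cm[OF f'(2)]])
      show "(\<lambda>y. (f (x + s n *\<^sub>R axis i 1 - y) - f (x - y)) / s n) \<in> borel_measurable \<mu>" for n
        by (intro borel_measurable_divide borel_measurable_diff borel_measurable_const measurable_periodic[OF \<mu>(2) cm[OF f(2)]])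
      have "(\<lambda>n. (f (x - y + s n *\<^sub>R axis i 1) - f (x - y)) / s n) \<longlonglongrightarrow> f' (x - y)" for y
      proof -
        have "((\<lambda>s. (f (x - y + s *\<^sub>R axis i 1) - f (x - y)) / s) \<longlongrightarrow> f' (x - y)) (at 0)"
          using has_partialD[OF f'(1), of "x - y"] unfolding has_field_derivative_iff by simp
        then show ?thesis using s0 s unfolding tendsto_at_iff_sequentially o_def by blast
      qed
      then show "AE y in \<mu>. (\<lambda>n. (f (x + s n *\<^sub>R axis i 1 - y) - f (x - y)) / s n) \<longlonglongrightarrow> f' (x - y)"
        unfolding e by (intro AE_I2)
      have "\<bar>f (x - y + s n *\<^sub>R axis i 1) - f (x - y)\<bar> / \<bar>s n\<bar> \<le> C" for n y
        using lip[of "x - y" "s n"] s0 by (simp add: field_simps)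
      then show "AE y in \<mu>. norm ((f (x + s n *\<^sub>R axis i 1 - y) - f (x - y)) / s n) \<le> C" for n
        unfolding e by simp
    qed simp
  qed
  then show "((\<lambda>s. \<integral>y. f (x + s *\<^sub>R axis i 1 - y) \<partial>\<mu>) has_real_derivative (\<integral>y. f' (x - y) \<partial>\<mu>)) (at 0)"
    unfolding has_field_derivative_iff by simp
qed

lemma integral_vec_component:
  fixes f :: "'a \<Rightarrow> real ^ 'd"
  assumes "\<And>i. integrable M (\<lambda>x. f x $ i)"
  shows "(\<integral>x. f x \<partial>M) $ i = (\<integral>x. f x $ i \<partial>M)"
proof -
  have "f x = (\<Sum>i\<in>UNIV. f x $ i *\<^sub>R axis i 1)" for x
    by (simp add: vec_eq_iff axis_def if_distrib[of "(*) _"] cong: if_cong)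
  moreover have "integrable M (\<lambda>x. \<Sum>i\<in>UNIV. f x $ i *\<^sub>R (axis i 1 :: real ^ 'd))"
    by (intro Bochner_Integration.integrable_sum integrable_scaleR_left assms)
  ultimately have "integrable M f" by simp
  then have "(\<integral>x. f x \<bullet> axis i 1 \<partial>M) = (\<integral>x. f x \<partial>M) \<bullet> axis i 1" by (intro integral_inner_left)
  then show ?thesis by (simp add: inner_axis)
qed

subsection \<open>Stationarity of the law of the process\<close>

lemma measurable_coarser:
  assumes "f \<in> N \<rightarrow>\<^sub>M L" "space N = space M" "sets N \<subseteq> sets M"
  shows "f \<in> M \<rightarrow>\<^sub>M L"
  using assms unfolding measurable_def by auto

lemma expectation_torus_law:
  fixes f :: "real ^ 'd \<Rightarrow> real"
  assumes Y: "Y \<in> borel_measurable M" and f: "periodic f" "continuous_on UNIV f"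
  shows "(\<integral>x. f x \<partial>torus_law M Y) = (\<integral>\<omega>. f (Y \<omega>) \<partial>M)"
proof -
  have "(\<lambda>\<omega>. torus_proj (Y \<omega>)) \<in> M \<rightarrow>\<^sub>M torus"
    by (rule measurable_compose[OF Y torus_proj_measurable])
  then show ?thesis
    unfolding torus_law_def
    by (subst integral_distr) (auto simp: periodic_torus_proj[OF f(1)] measurable_torus_continuous[OF f(2)])
qed

text \<open>Independence factorises after the addition theorem. Sines are written as cosines with
  shifted phase, so that one product formula covers both terms; the term with the sine of the
  symmetric increment has expectation 0.\<close>

lemma (in prob_space) expectation_cos_gauss_increment:
  fixes Y Z :: "'a \<Rightarrow> real ^ 'd"
  assumes ind: "indep_var borel Y borel Z" and Z: "distributed M lborel Z (\<lambda>x. ennreal (gauss_density s x))" and s: "s > 0"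
  shows "expectation (\<lambda>\<omega>. cos (2 * pi * (k \<bullet> Y \<omega>) + \<theta> + 2 * pi * (l \<bullet> Z \<omega>)))
    = exp (- 2 * pi\<^sup>2 * (l \<bullet> l) * s) * expectation (\<lambda>\<omega>. cos (2 * pi * (k \<bullet> Y \<omega>) + \<theta>))"
proof -
  have meas: "(\<lambda>y :: real ^ 'd. cos (2 * pi * (m \<bullet> y) + \<eta>)) \<in> borel_measurable borel" for m \<eta>
    by (intro borel_measurable_continuous_onI continuous_intros)
  have Ym: "Y \<in> borel_measurable M" and Zm: "Z \<in> borel_measurable M" by (rule indep_var_rv1[OF ind], rule indep_var_rv2[OF ind])
  have eZ: "expectation (\<lambda>\<omega>. cos (2 * pi * (l \<bullet> Z \<omega>) + \<eta>)) = exp (- 2 * pi\<^sup>2 * (l \<bullet> l) * s) * cos \<eta>" for \<eta>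
  proof -
    have "expectation (\<lambda>\<omega>. cos (2 * pi * (l \<bullet> Z \<omega>) + \<eta>)) = (\<integral>x. gauss_density s x * cos (2 * pi * (l \<bullet> x) + \<eta>) \<partial>lborel)"
      by (rule distributed_integral[symmetric, OF Z]) (auto simp: meas gauss_density_nonneg)
    then show ?thesis using gauss_density_cos[OF s, of l \<eta>] by (simp add: has_bochner_integral_iff)
  qed
  have prod: "expectation (\<lambda>\<omega>. cos (2 * pi * (k \<bullet> Y \<omega>) + \<theta>) * cos (2 * pi * (l \<bullet> Z \<omega>) + \<eta>))
      = expectation (\<lambda>\<omega>. cos (2 * pi * (k \<bullet> Y \<omega>) + \<theta>)) * expectation (\<lambda>\<omega>. cos (2 * pi * (l \<bullet> Z \<omega>) + \<eta>))"
    "integrable M (\<lambda>\<omega>. cos (2 * pi * (k \<bullet> Y \<omega>) + \<theta>) * cos (2 * pi * (l \<bullet> Z \<omega>) + \<eta>))" for \<theta> \<eta>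
  proof -
    have i: "indep_var borel (\<lambda>\<omega>. cos (2 * pi * (k \<bullet> Y \<omega>) + \<theta>)) borel (\<lambda>\<omega>. cos (2 * pi * (l \<bullet> Z \<omega>) + \<eta>))"
      using indep_var_compose[OF ind meas[of k \<theta>] meas[of l \<eta>]] by (simp add: o_def)
    have j: "integrable M (\<lambda>\<omega>. cos (2 * pi * (k \<bullet> Y \<omega>) + \<theta>))" "integrable M (\<lambda>\<omega>. cos (2 * pi * (l \<bullet> Z \<omega>) + \<eta>))"
      by (rule integrable_const_bound[where B=1]; auto intro: measurable_compose[OF Ym meas] measurable_compose[OF Zm meas])+
    show "expectation (\<lambda>\<omega>. cos (2 * pi * (k \<bullet> Y \<omega>) + \<theta>) * cos (2 * pi * (l \<bullet> Z \<omega>) + \<eta>))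
      = expectation (\<lambda>\<omega>. cos (2 * pi * (k \<bullet> Y \<omega>) + \<theta>)) * expectation (\<lambda>\<omega>. cos (2 * pi * (l \<bullet> Z \<omega>) + \<eta>))"
      by (rule indep_var_lebesgue_integral[OF i j])
    show "integrable M (\<lambda>\<omega>. cos (2 * pi * (k \<bullet> Y \<omega>) + \<theta>) * cos (2 * pi * (l \<bullet> Z \<omega>) + \<eta>))"
      by (rule indep_var_integrable[OF i j])
  qed
  have sn: "sin t = cos (t + - (pi / 2))" for t :: real using cos_diff[of t "pi / 2"] by simp
  have "cos (2 * pi * (k \<bullet> Y \<omega>) + \<theta> + 2 * pi * (l \<bullet> Z \<omega>))
      = cos (2 * pi * (k \<bullet> Y \<omega>) + \<theta>) * cos (2 * pi * (l \<bullet> Z \<omega>) + 0)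
        - cos (2 * pi * (k \<bullet> Y \<omega>) + (\<theta> + - (pi / 2))) * cos (2 * pi * (l \<bullet> Z \<omega>) + - (pi / 2))" for \<omega>
    unfolding cos_add[of "2 * pi * (k \<bullet> Y \<omega>) + \<theta>" "2 * pi * (l \<bullet> Z \<omega>)"]
      sn[of "2 * pi * (k \<bullet> Y \<omega>) + \<theta>"] sn[of "2 * pi * (l \<bullet> Z \<omega>)"]
    by (simp only: add.assoc add_0_right)
  then have "expectation (\<lambda>\<omega>. cos (2 * pi * (k \<bullet> Y \<omega>) + \<theta> + 2 * pi * (l \<bullet> Z \<omega>)))
    = expectation (\<lambda>\<omega>. cos (2 * pi * (k \<bullet> Y \<omega>) + \<theta>) * cos (2 * pi * (l \<bullet> Z \<omega>) + 0))
      - expectation (\<lambda>\<omega>. cos (2 * pi * (k \<bullet> Y \<omega>) + (\<theta> + - (pi / 2))) * cos (2 * pi * (l \<bullet> Z \<omega>) + - (pi / 2)))"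
    using prod(2)[of \<theta> 0] prod(2)[of "\<theta> + - (pi / 2)" "- (pi / 2)"] by (simp only: Bochner_Integration.integral_diff)
  also have "\<dots> = exp (- 2 * pi\<^sup>2 * (l \<bullet> l) * s) * expectation (\<lambda>\<omega>. cos (2 * pi * (k \<bullet> Y \<omega>) + \<theta>))"
    unfolding prod(1) eZ by simp
  finally show ?thesis .
qed

text \<open>Along a path the phase A contains Brownian motion and is only continuous; just the drift
  part h is differentiable. The sum-to-product formula makes h alone appear in the small
  factor.\<close>

lemma cos_increment_limit:
  fixes h A :: "real \<Rightarrow> real"
  assumes h: "(h has_real_derivative c) (at 0 within {0..1})" "h 0 = 0"
    and A: "((\<lambda>t. A t) \<longlongrightarrow> A 0) (at 0 within {0..1})"
  shows "((\<lambda>t. (cos (A t) - cos (A t - h t)) / t) \<longlongrightarrow> - sin (A 0) * c) (at 0 within {0..1})"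
proof -
  have "((\<lambda>t. sin (h t / 2)) has_real_derivative cos (h 0 / 2) * (c / 2)) (at 0 within {0..1})"
    by (rule derivative_eq_intros h refl | simp)+
  then have "((\<lambda>t. sin (h t / 2) / t) \<longlongrightarrow> c / 2) (at 0 within {0..1})"
    unfolding has_field_derivative_iff using h(2) by simp
  moreover have "(h \<longlongrightarrow> 0) (at 0 within {0..1})"
    using has_field_derivative_imp_has_derivative[OF h(1), THEN has_derivative_continuous] h(2) by (simp add: continuous_within)
  then have "((\<lambda>t. sin (A t - h t / 2)) \<longlongrightarrow> sin (A 0 - 0 / 2)) (at 0 within {0..1})"
    by (intro tendsto_intros A) auto
  ultimately have "((\<lambda>t. - 2 * sin (A t - h t / 2) * (sin (h t / 2) / t)) \<longlongrightarrow> - 2 * sin (A 0 - 0 / 2) * (c / 2)) (at 0 within {0..1})"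
    by (intro tendsto_mult tendsto_const)
  moreover have "- 2 * sin (A t - h t / 2) * (sin (h t / 2) / t) = (cos (A t) - cos (A t - h t)) / t" for t
  proof -
    have e: "(A t + (A t - h t)) / 2 = A t - h t / 2" "(A t - h t - A t) / 2 = - (h t / 2)" by (auto simp: field_simps)
    show ?thesis using cos_diff_cos[of "A t" "A t - h t"] unfolding e by simp
  qed
  ultimately show ?thesis by simp
qed

text \<open>The process is compared with the driftless \<open>Y\<close>, which has the same starting
  point and the same noise. The expectation of the mode is constant along X and decays like exp (-
  \<kappa> t) along \<open>Y\<close>, while the pathwise difference is of first order in t with the
  drift as coefficient. Differentiating at time 0 gives the identity without stochastic
  calculus.\<close>

lemma stationary_mode:
  fixes M :: "'w measure" and X B :: "real \<Rightarrow> 'w \<Rightarrow> real ^ 'd" and v :: "real ^ 'd \<Rightarrow> real ^ 'd"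
  assumes \<beta>: "\<beta> > 0" and M: "prob_space M" and F: "filtration (space M) F" "\<forall>t. sets (F t) \<subseteq> sets M"
    and B: "brownian_motion M F B" and X: "\<forall>t\<ge>0. X t \<in> borel_measurable (F t)" "AE \<omega> in M. continuous_on {0..} (\<lambda>t. X t \<omega>)"
    and eq: "AE \<omega> in M. \<forall>t\<ge>0. ((\<lambda>s. v (X s \<omega>)) has_integral (X t \<omega> - X 0 \<omega> - sqrt (2 / \<beta>) *\<^sub>R B t \<omega>)) {0..t}"
    and law: "\<forall>t\<ge>0. torus_law M (X t) = \<mu>"
    and v: "periodic v" "continuous_on UNIV v"
    and k: "\<And>i. k $ i \<in> \<int>"
  shows "4 * pi\<^sup>2 * (k \<bullet> k) / \<beta> * (\<integral>x. cos (2 * pi * (k \<bullet> x) + \<theta>) \<partial>\<mu>)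
    = (\<integral>x. - sin (2 * pi * (k \<bullet> x) + \<theta>) * (2 * pi * (k \<bullet> v x)) \<partial>\<mu>)"
proof -
  interpret prob_space M by fact
  interpret filtration "space M" F by fact
  define \<sigma> where "\<sigma> = sqrt (2 / \<beta>)"
  define \<kappa> where "\<kappa> = 4 * pi\<^sup>2 * (k \<bullet> k) / \<beta>"
  define \<psi> where "\<psi> x = cos (2 * pi * (k \<bullet> x) + \<theta>)" for x
  define q where "q x = 2 * pi * (k \<bullet> v x)" for x
  \<comment> \<open>The increment B t - B 0 is used because this is what is independent of
    \<open>F 0\<close>; B 0 is 0 only almost surely.\<close>
  define Y where "Y t \<omega> = X 0 \<omega> + \<sigma> *\<^sub>R (B t \<omega> - B 0 \<omega>)" for t \<omega>
  have \<psi>: "periodic \<psi>" "continuous_on UNIV \<psi>"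
    using periodic_tpoly[of "[(1, k, \<theta>)]"] k by (auto simp: \<psi>_def periodic_def intro!: continuous_intros)
  have q: "periodic q" "continuous_on UNIV q" using v(1) by (auto simp: q_def periodic_def intro!: continuous_intros v(2))
  have sin_eq: "sin (2 * pi * (k \<bullet> x) + \<theta>) = cos (2 * pi * (k \<bullet> x) + (\<theta> - pi / 2))" for x
    using cos_diff[of "2 * pi * (k \<bullet> x) + \<theta>" "pi / 2"] by (simp add: algebra_simps)
  have \<psi>': "periodic (\<lambda>x. - sin (2 * pi * (k \<bullet> x) + \<theta>) * q x)" "continuous_on UNIV (\<lambda>x. - sin (2 * pi * (k \<bullet> x) + \<theta>) * q x)"
    using periodic_tpoly[of "[(1, k, \<theta> - pi / 2)]"] k q(1)
    by (auto simp: sin_eq periodic_def intro!: continuous_intros q(2))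
  obtain C where C: "C > 0" "\<And>x. \<bar>q x\<bar> \<le> C" using periodic_continuous_bounded[OF q] by blast
  have Xm: "X t \<in> borel_measurable M" if "t \<ge> 0" for t
    by (rule measurable_coarser[of _ "F t"]) (use X(1) F(2) that space_F in auto)
  have Bm: "B t \<in> borel_measurable M" if "t \<ge> 0" for t
    by (rule measurable_coarser[of _ "F t"]) (use B F(2) that space_F in \<open>auto simp: brownian_motion_def\<close>)
  have Ym: "Y t \<in> borel_measurable M" if "t \<ge> 0" for t
    unfolding Y_def using Xm[of 0] Bm[OF that] Bm[of 0] by measurable
  have EX: "expectation (\<lambda>\<omega>. \<psi> (X t \<omega>)) = integral\<^sup>L \<mu> \<psi>" if "t \<ge> 0" for t
    using expectation_torus_law[OF Xm[OF that] \<psi>] law that by simp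
  have EY: "expectation (\<lambda>\<omega>. \<psi> (Y t \<omega>)) = exp (- \<kappa> * t) * integral\<^sup>L \<mu> \<psi>" if t: "t > 0" for t
  proof -
    have dist: "distributed M lborel (\<lambda>\<omega>. B t \<omega> - B 0 \<omega>) (\<lambda>x. ennreal (gauss_density t x))"
      and ind: "indep_set (sets (F 0)) {(\<lambda>\<omega>. B t \<omega> - B 0 \<omega>) -` A \<inter> space M | A. A \<in> sets borel}"
      using B t unfolding brownian_motion_def gauss_density_def by force+
    have Zm: "(\<lambda>\<omega>. B t \<omega> - B 0 \<omega>) \<in> borel_measurable M" using Bm[of t] Bm[of 0] t by simp
    have sub1: "sigma_sets (space M) {X 0 -` A \<inter> space M | A. A \<in> sets borel} \<subseteq> sets (F 0)"
    proof -
      have "{X 0 -` A \<inter> space M | A. A \<in> sets borel} \<subseteq> sets (F 0)"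
        using X(1) measurable_sets[of "X 0" "F 0" borel] space_F[of 0] by auto
      then show ?thesis using sets.sigma_sets_subset[of _ "F 0"] space_F[of 0] by simp
    qed
    \<comment> \<open>Preimages of the Borel sets already form a sigma-algebra, so the independence
      stated in \<open>brownian_motion\<close> is that of the generated sigma-algebras.\<close>
    have sub2: "sigma_sets (space M) {(\<lambda>\<omega>. B t \<omega> - B 0 \<omega>) -` A \<inter> space M | A. A \<in> sets borel}
        = {(\<lambda>\<omega>. B t \<omega> - B 0 \<omega>) -` A \<inter> space M | A. A \<in> sets borel}"
    proof -
      have "sigma_sets UNIV (sets borel) = sets (borel :: (real ^ 'd) measure)"
        using sets.sigma_sets_eq[of "borel :: (real ^ 'd) measure"] by simp
      then show ?thesis
        using sigma_sets_vimage_commute[of "\<lambda>\<omega>. B t \<omega> - B 0 \<omega>" "space M" UNIV "sets borel"] by simp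
    qed
    have "indep_var borel (X 0) borel (\<lambda>\<omega>. B t \<omega> - B 0 \<omega>)"
      unfolding indep_var_eq
    proof (intro conjI)
      show "indep_set (sigma_sets (space M) {X 0 -` A \<inter> space M | A. A \<in> sets borel})
          (sigma_sets (space M) {(\<lambda>\<omega>. B t \<omega> - B 0 \<omega>) -` A \<inter> space M | A. A \<in> sets borel})"
        using ind sub1 unfolding sub2 indep_sets2_eq by blast
    qed (use Xm[of 0] Zm in auto)
    from expectation_cos_gauss_increment[OF this dist t, of k \<theta> "\<sigma> *\<^sub>R k"]
    have "expectation (\<lambda>\<omega>. \<psi> (Y t \<omega>)) = exp (- 2 * pi\<^sup>2 * ((\<sigma> *\<^sub>R k) \<bullet> (\<sigma> *\<^sub>R k)) * t) * expectation (\<lambda>\<omega>. \<psi> (X 0 \<omega>))"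
      by (simp add: \<psi>_def Y_def inner_add_right algebra_simps)
    also have "- 2 * pi\<^sup>2 * ((\<sigma> *\<^sub>R k) \<bullet> (\<sigma> *\<^sub>R k)) * t = - \<kappa> * t"
    proof -
      have "\<sigma> * \<sigma> = 2 / \<beta>" using \<beta> by (simp add: \<sigma>_def)
      then have "(\<sigma> *\<^sub>R k) \<bullet> (\<sigma> *\<^sub>R k) = 2 / \<beta> * (k \<bullet> k)" by (simp add: mult.assoc[symmetric])
      then show ?thesis by (simp add: \<kappa>_def)
    qed
    finally show ?thesis using EX[of 0] by simp
  qed
  \<comment> \<open>Dominated convergence is applied along a sequence of positive times tending to
    0.\<close>
  define s where "s n = 1 / real (Suc n)" for n
  have s: "0 < s n" "s n \<le> 1" for n by (auto simp: s_def)
  have s_lim: "s \<longlonglongrightarrow> 0" unfolding s_def using LIMSEQ_inverse_real_of_nat by (simp add: inverse_eq_divide)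
  have s_filt: "filterlim s (at 0 within {0..1}) sequentially"
    unfolding filterlim_at using s_lim s by (auto simp: less_imp_le less_imp_neq[symmetric])
  have B0: "AE \<omega> in M. B 0 \<omega> = 0" using B by (simp add: brownian_motion_def)
  have path: "AE \<omega> in M. (\<lambda>n. (\<psi> (X (s n) \<omega>) - \<psi> (Y (s n) \<omega>)) / s n) \<longlonglongrightarrow> - sin (2 * pi * (k \<bullet> X 0 \<omega>) + \<theta>) * q (X 0 \<omega>) \<and>
      (\<forall>n. \<bar>(\<psi> (X (s n) \<omega>) - \<psi> (Y (s n) \<omega>)) / s n\<bar> \<le> C)"
    using B0 X(2) eq
  proof eventually_elim
    case (elim \<omega>)
    \<comment> \<open>The phase shift caused by the drift up to time t: A is the phase of X, and A -
      h is the phase of \<open>Y\<close> wherever B 0 = 0.\<close>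
    define h where "h t = 2 * pi * (k \<bullet> (X t \<omega> - X 0 \<omega> - \<sigma> *\<^sub>R B t \<omega>))" for t
    define A where "A t = 2 * pi * (k \<bullet> X t \<omega>) + \<theta>" for t
    have hint: "((\<lambda>r. q (X r \<omega>)) has_integral h t) {0..t}" if "t \<ge> 0" for t
    proof -
      have "((\<lambda>r. v (X r \<omega>)) has_integral (X t \<omega> - X 0 \<omega> - \<sigma> *\<^sub>R B t \<omega>)) {0..t}"
        using elim(3) that unfolding \<sigma>_def by blast
      from has_integral_linear[OF this, of "\<lambda>z. 2 * pi * (k \<bullet> z)"]
      show ?thesis by (simp add: o_def h_def q_def bounded_linear_intros bounded_linear_inner_right bounded_linear_const_mult)
    qed
    have cX: "continuous_on {0..1} (\<lambda>r. X r \<omega>)" using elim(2) by (rule continuous_on_subset) auto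
    have "continuous_on {0..1} (\<lambda>r. q (X r \<omega>))"
      by (rule continuous_on_compose2[OF q(2) cX]) auto
    then have "((\<lambda>u. integral {0..u} (\<lambda>r. q (X r \<omega>))) has_vector_derivative q (X 0 \<omega>)) (at 0 within {0..1})"
      by (rule integral_has_vector_derivative) simp
    then have "(h has_vector_derivative q (X 0 \<omega>)) (at 0 within {0..1})"
      by (rule has_vector_derivative_transform[rotated 2]) (auto simp: integral_unique[OF hint])
    then have hd: "(h has_real_derivative q (X 0 \<omega>)) (at 0 within {0..1})"
      by (simp add: has_real_derivative_iff_has_vector_derivative)
    have h0: "h 0 = 0" using hint[of 0] by (simp add: has_integral_iff)
    have "((\<lambda>t. A t) \<longlongrightarrow> A 0) (at 0 within {0..1})"
      unfolding A_def using cX by (intro tendsto_intros) (auto simp: continuous_on_def)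
    from cos_increment_limit[OF hd h0 this]
    have "(\<lambda>n. (cos (A (s n)) - cos (A (s n) - h (s n))) / s n) \<longlonglongrightarrow> - sin (A 0) * q (X 0 \<omega>)"
      using s_filt by (rule filterlim_compose)
    moreover have cosY: "cos (A t - h t) = \<psi> (Y t \<omega>)" for t
      unfolding A_def h_def \<psi>_def Y_def using elim(1) by (simp add: inner_diff_right inner_add_right algebra_simps)
    moreover have cosX: "cos (A t) = \<psi> (X t \<omega>)" for t by (simp add: A_def \<psi>_def)
    \<comment> \<open>The cosine is 1-Lipschitz and the drift bounded, so C dominates all the
      difference quotients.\<close>
    moreover have bound: "\<bar>(\<psi> (X t \<omega>) - \<psi> (Y t \<omega>)) / t\<bar> \<le> C" if t: "t > 0" for t
    proof -
      have "norm (h t) \<le> C * measure lborel (cbox 0 t)"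
        by (rule has_integral_bound[of C "\<lambda>r. q (X r \<omega>)"]) (use C hint[of t] t in auto)
      then have ht: "\<bar>h t\<bar> \<le> C * t" using t by simp
      have "\<bar>cos (A t) - cos (A t - h t)\<bar> \<le> \<bar>h t\<bar>"
      proof -
        have "norm (cos (A t) - cos (A t - h t)) \<le> 1 * norm (A t - (A t - h t))"
          by (rule field_differentiable_bound[where S=UNIV and f'="\<lambda>x. - sin x"]) (auto intro: derivative_eq_intros)
        then show ?thesis by simp
      qed
      then have "\<bar>\<psi> (X t \<omega>) - \<psi> (Y t \<omega>)\<bar> \<le> C * t" using ht cosX cosY by simp
      then show ?thesis using t by (simp add: field_simps)
    qed
    ultimately show ?case using bound[OF s(1)] by (simp add: A_def)
  qed
  have \<psi>m: "(\<lambda>\<omega>. \<psi> (Z \<omega>)) \<in> borel_measurable M" if "Z \<in> borel_measurable M" for Z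
    by (rule measurable_compose[OF that borel_measurable_continuous_onI[OF \<psi>(2)]])
  have "(\<lambda>n. expectation (\<lambda>\<omega>. (\<psi> (X (s n) \<omega>) - \<psi> (Y (s n) \<omega>)) / s n)) \<longlonglongrightarrow> expectation (\<lambda>\<omega>. - sin (2 * pi * (k \<bullet> X 0 \<omega>) + \<theta>) * q (X 0 \<omega>))"
  proof (rule integral_dominated_convergence[where w="\<lambda>_. C"])
    show "(\<lambda>\<omega>. - sin (2 * pi * (k \<bullet> X 0 \<omega>) + \<theta>) * q (X 0 \<omega>)) \<in> borel_measurable M"
      by (rule measurable_compose[OF Xm[of 0] borel_measurable_continuous_onI[OF \<psi>'(2)]]) simp
    show "(\<lambda>\<omega>. (\<psi> (X (s n) \<omega>) - \<psi> (Y (s n) \<omega>)) / s n) \<in> borel_measurable M" for n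
      using \<psi>m[OF Xm[of "s n"]] \<psi>m[OF Ym[of "s n"]] s[of n] by simp
    show "AE \<omega> in M. (\<lambda>n. (\<psi> (X (s n) \<omega>) - \<psi> (Y (s n) \<omega>)) / s n) \<longlonglongrightarrow> - sin (2 * pi * (k \<bullet> X 0 \<omega>) + \<theta>) * q (X 0 \<omega>)"
      using path by eventually_elim blast
    show "AE \<omega> in M. norm ((\<psi> (X (s n) \<omega>) - \<psi> (Y (s n) \<omega>)) / s n) \<le> C" for n
      using path by eventually_elim (simp only: real_norm_def)
  qed simp
  moreover have "expectation (\<lambda>\<omega>. (\<psi> (X (s n) \<omega>) - \<psi> (Y (s n) \<omega>)) / s n) = (1 - exp (- \<kappa> * s n)) / s n * integral\<^sup>L \<mu> \<psi>" for n
  proof -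
    have b: "\<bar>\<psi> x\<bar> \<le> 1" for x by (simp add: \<psi>_def)
    have "integrable M (\<lambda>\<omega>. \<psi> (X (s n) \<omega>))" "integrable M (\<lambda>\<omega>. \<psi> (Y (s n) \<omega>))"
      using b \<psi>m[OF Xm[of "s n"]] \<psi>m[OF Ym[of "s n"]] s[of n] by (auto intro!: integrable_const_bound[where B=1])
    then show ?thesis using EX[of "s n"] EY[of "s n"] s[of n] by (simp add: algebra_simps diff_divide_distrib)
  qed
  moreover have "expectation (\<lambda>\<omega>. - sin (2 * pi * (k \<bullet> X 0 \<omega>) + \<theta>) * q (X 0 \<omega>)) = (\<integral>x. - sin (2 * pi * (k \<bullet> x) + \<theta>) * q x \<partial>\<mu>)"
    using expectation_torus_law[OF Xm[of 0] \<psi>'] law by simp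
  ultimately have "(\<lambda>n. (1 - exp (- \<kappa> * s n)) / s n * integral\<^sup>L \<mu> \<psi>) \<longlonglongrightarrow> (\<integral>x. - sin (2 * pi * (k \<bullet> x) + \<theta>) * q x \<partial>\<mu>)"
    by (simp only:)
  moreover have "(\<lambda>n. (1 - exp (- \<kappa> * s n)) / s n * integral\<^sup>L \<mu> \<psi>) \<longlonglongrightarrow> \<kappa> * integral\<^sup>L \<mu> \<psi>"
  proof -
    have "((\<lambda>t. 1 - exp (- \<kappa> * t)) has_real_derivative \<kappa>) (at 0 within {0..1})"
      by (auto intro!: derivative_eq_intros)
    then have "((\<lambda>t. (1 - exp (- \<kappa> * t)) / t) \<longlongrightarrow> \<kappa>) (at 0 within {0..1})"
      unfolding has_field_derivative_iff by simp
    then have "(\<lambda>n. (1 - exp (- \<kappa> * s n)) / s n) \<longlonglongrightarrow> \<kappa>" using s_filt by (rule filterlim_compose)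
    then show ?thesis by (intro tendsto_intros)
  qed
  ultimately have "\<kappa> * integral\<^sup>L \<mu> \<psi> = (\<integral>x. - sin (2 * pi * (k \<bullet> x) + \<theta>) * q x \<partial>\<mu>)"
    by (rule LIMSEQ_unique[rotated])
  then show ?thesis unfolding \<kappa>_def \<psi>_def q_def .
qed

subsection \<open>The invariant measure is a Gibbs measure\<close>

text \<open>If \<bar>f\<bar> exceeded the essential supremum r at some x, its part above r,
  translated so that x moves to 0, would have positive integral although it vanishes almost
  everywhere.\<close>

lemma abs_le_Linf_norm:
  fixes f :: "real ^ 'd \<Rightarrow> real"
  assumes f: "periodic f" "continuous_on UNIV f"
  shows "\<bar>f x\<bar> \<le> Linf_norm f"
proof -
  obtain C where C: "C > 0" "\<And>x. \<bar>f x\<bar> \<le> C" using periodic_continuous_bounded[OF f] by blast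
  define E where "E = esssup torus (\<lambda>x. ereal \<bar>f x\<bar>)"
  have AE: "AE x in torus. ereal \<bar>f x\<bar> \<le> E" unfolding E_def by (rule esssup_AE)
  have m: "(\<lambda>x. ereal \<bar>f x\<bar>) \<in> borel_measurable torus" using measurable_torus_continuous[OF f(2)] by simp
  have "E \<le> ereal C" unfolding E_def by (rule esssup_I[OF m]) (use C in auto)
  \<comment> \<open>The conversion from extended reals sends infinite values to 0, so both
    infinities have to be excluded before the norm can be read as the supremum.\<close>
  moreover have "E \<noteq> - \<infinity>"
  proof
    assume "E = - \<infinity>"
    then have "AE x in (torus :: (real ^ 'd) measure). False" using AE by simp
    then show False using torus.AE_False by (simp add: torus.AE_False)
  qed
  ultimately obtain r where r: "E = ereal r" by (cases E) auto
  have Lr: "Linf_norm f = r" by (simp add: Linf_norm_def E_def[symmetric] r)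
  have AEr: "AE x in torus. \<bar>f x\<bar> \<le> r" using AE by (simp add: r)
  show ?thesis
  proof (rule ccontr)
    assume "\<not> \<bar>f x\<bar> \<le> Linf_norm f"
    then have fx: "r < \<bar>f x\<bar>" by (simp add: Lr)
    define g where "g z = max 0 (\<bar>f z\<bar> - r)" for z
    have g: "periodic g" "continuous_on UNIV g" using f(1) by (auto simp: g_def periodic_def intro!: continuous_intros f(2))
    have "0 < (\<integral>z. g (z + x) \<partial>torus)"
      by (rule integral_torus_positive[OF continuous_on_shift[OF g(2)]]) (use fx in \<open>auto simp: g_def\<close>)
    also have "\<dots> = integral\<^sup>L torus g" by (rule integral_torus_shift[OF g])
    also have "\<dots> = 0"
      by (rule integral_eq_zero_AE) (use AEr in \<open>eventually_elim, simp add: g_def\<close>)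
    finally show False by simp
  qed
qed

text \<open>All marginals equal \<mu>, so the drift is the fixed field - \<nabla>U for U = V + W *
  \<mu>, and the linear theory applies. The bound on U is uniform in \<mu>, because \<mu> has mass
  1.\<close>

lemma mckean_invariant_measure_Gibbs:
  fixes V W :: "real ^ 'd \<Rightarrow> real" and \<mu> :: "(real ^ 'd) measure"
  assumes \<beta>: "\<beta> > 0" and V: "torus_Ck 2 V" and W: "torus_Ck 2 W"
    and inv: "mckean_invariant_measure TYPE('w) \<beta> V W \<mu>"
  obtains c U where "c > 0" "periodic U" "continuous_on UNIV U" "\<And>x. \<bar>U x\<bar> \<le> Linf_norm V + Linf_norm W"
    "\<mu> = density torus (\<lambda>x. ennreal (c * exp (- \<beta> * U x)))" "prob_space \<mu>"
proof -
  obtain M :: "'w measure" and F B X where proc: "mckean_process M F B \<beta> V W X" and law: "\<forall>t\<ge>0. torus_law M (X t) = \<mu>"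
    using inv unfolding mckean_invariant_measure_def by blast
  have M: "prob_space M" and F: "filtration (space M) F" "\<forall>t. sets (F t) \<subseteq> sets M" and B: "brownian_motion M F B"
    and X: "\<forall>t\<ge>0. X t \<in> borel_measurable (F t)" "AE \<omega> in M. continuous_on {0..} (\<lambda>t. X t \<omega>)"
    and eq: "AE \<omega> in M. \<forall>t\<ge>0. ((\<lambda>s. mckean_drift V W (torus_law M (X s)) (X s \<omega>)) has_integral
           (X t \<omega> - X 0 \<omega> - sqrt (2 / \<beta>) *\<^sub>R B t \<omega>)) {0..t}"
    using proc unfolding mckean_process_def by blast+
  interpret M: prob_space M by (rule M)
  define v where "v = mckean_drift V W \<mu>"
  have eqv: "AE \<omega> in M. \<forall>t\<ge>0. ((\<lambda>s. v (X s \<omega>)) has_integral (X t \<omega> - X 0 \<omega> - sqrt (2 / \<beta>) *\<^sub>R B t \<omega>)) {0..t}"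
    using eq
  proof eventually_elim
    case (elim \<omega>)
    show ?case
    proof (intro allI impI)
      fix t :: real assume "t \<ge> 0"
      then have "((\<lambda>s. mckean_drift V W (torus_law M (X s)) (X s \<omega>)) has_integral
           (X t \<omega> - X 0 \<omega> - sqrt (2 / \<beta>) *\<^sub>R B t \<omega>)) {0..t}" using elim by blast
      then show "((\<lambda>s. v (X s \<omega>)) has_integral (X t \<omega> - X 0 \<omega> - sqrt (2 / \<beta>) *\<^sub>R B t \<omega>)) {0..t}"
        by (rule has_integral_eq[rotated]) (use law in \<open>auto simp: v_def\<close>)
    qed
  qed
  have X0m: "X 0 \<in> borel_measurable M"
    by (rule measurable_coarser[of _ "F 0"]) (use X(1) F filtration.space_F[OF F(1)] in auto)
  have \<mu>0: "\<mu> = distr M torus (\<lambda>\<omega>. torus_proj (X 0 \<omega>))" using law unfolding torus_law_def by simp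
  have sets: "sets \<mu> = sets torus" by (simp add: \<mu>0)
  have prob: "prob_space \<mu>"
    unfolding \<mu>0 by (rule M.prob_space_distr) (rule measurable_compose[OF X0m torus_proj_measurable])
  then have fin: "finite_measure \<mu>" by (simp add: prob_space.finite_measure)
  have pV: "periodic V" and pW: "periodic W" and CV: "Ck (Suc (Suc 0)) V" and CW: "Ck (Suc (Suc 0)) W"
    using V W by (auto simp: torus_Ck_def numeral_2_eq_2 simp del: Ck.simps)
  have cV: "continuous_on UNIV V" and cW: "continuous_on UNIV W" by (rule Ck_continuous[OF CV], rule Ck_continuous[OF CW])
  have dV: "has_partial i V (partial i V)" and dW: "has_partial i W (partial i W)" for i
    by (rule Ck_Suc_has_partial[OF CV], rule Ck_Suc_has_partial[OF CW])
  have cdV: "continuous_on UNIV (partial i V)" and cdW: "continuous_on UNIV (partial i W)" for i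
    using Ck_continuous[of "Suc 0" "partial i V"] Ck_continuous[of "Suc 0" "partial i W"] CV CW by (auto simp del: Ck.simps simp: Ck.simps(2)[of "Suc 0"])
  have pdW: "periodic (partial i W)" and pdV: "periodic (partial i V)" for i
    by (rule periodic_has_partial[OF dW pW], rule periodic_has_partial[OF dV pV])
  define U where "U x = V x + (\<integral>y. W (x - y) \<partial>\<mu>)" for x
  have v_comp: "v x $ i = - (partial i V x + (\<integral>y. partial i W (x - y) \<partial>\<mu>))" for x i
  proof -
    have "integrable \<mu> (\<lambda>y. partial i W (x - y))" for i
      by (rule integrable_periodic_continuous[OF fin sets periodic_minus_left[OF pdW]])
         (rule continuous_on_compose2[OF cdW]; auto intro!: continuous_intros)
    then have "(\<integral>y. grad W (x - y) \<partial>\<mu>) $ i = (\<integral>y. grad W (x - y) $ i \<partial>\<mu>)"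
      by (intro integral_vec_component) (simp add: grad_def)
    then show ?thesis by (simp add: v_def mckean_drift_def grad_def)
  qed
  have ccW: "continuous_on UNIV (\<lambda>x. \<integral>y. partial i W (x - y) \<partial>\<mu>)" for i
    by (rule continuous_on_conv[OF fin sets pdW cdW])
  have cv: "continuous_on UNIV (\<lambda>x. v x $ i)" for i unfolding v_comp by (intro continuous_intros cdV ccW)
  have cv': "continuous_on UNIV v"
  proof -
    have "continuous_on UNIV (\<lambda>x. \<chi> i. v x $ i)" by (intro continuous_on_vec_lambda cv)
    then show ?thesis by simp
  qed
  have pv: "periodic v"
    using pdV periodic_conv[OF pdW, where \<mu> = \<mu>] unfolding periodic_def vec_eq_iff v_comp by simp
  have dU: "has_partial i U (\<lambda>x. - v x $ i)" for i
    unfolding U_def has_partial_def v_comp minus_minus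
    by (intro allI DERIV_add has_partialD[OF dV] has_partialD[OF has_partial_conv[OF fin sets pW cW dW cdW]])
  have pU: "periodic U" using pV periodic_conv[OF pW, where \<mu> = \<mu>] by (simp add: periodic_def U_def)
  have cU: "continuous_on UNIV U" unfolding U_def by (intro continuous_intros cV continuous_on_conv[OF fin sets pW cW])
  interpret stationary_drift \<beta> \<mu> "\<lambda>i x. v x $ i" U
  proof (rule stationary_drift.intro)
    fix L :: "(real \<times> (real ^ 'd) \<times> real) list"
    assume "int_freqs L"
    \<comment> \<open>Stationarity is assembled from single modes; stating it with
      \<open>has_bochner_integral\<close> carries integrability through the induction.\<close>
    then have "has_bochner_integral \<mu> (\<lambda>y. \<Sum>i\<in>UNIV. tpoly (tpoly_partial i (tpoly_partial i L)) y / \<beta> + v y $ i * tpoly (tpoly_partial i L) y) 0"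
    proof (induction L)
      case Nil
      then show ?case by (simp add: has_bochner_integral_zero)
    next
      case (Cons p L)
      obtain a k \<theta> where p: "p = (a, k, \<theta>)" by (cases p)
      have k: "\<And>i. k $ i \<in> \<int>" and L: "int_freqs L" using Cons.prems p by auto
      let ?c = "\<lambda>y. cos (2 * pi * (k \<bullet> y) + \<theta>)" and ?s = "\<lambda>y. - sin (2 * pi * (k \<bullet> y) + \<theta>) * (2 * pi * (k \<bullet> v y))"
      have ic: "integrable \<mu> ?c"
        by (rule integrable_periodic_continuous[OF fin sets])
           (use periodic_tpoly[of "[(1, k, \<theta>)]"] k in \<open>auto simp: periodic_def intro!: continuous_intros\<close>)
      have isin: "integrable \<mu> ?s"
      proof (rule integrable_periodic_continuous[OF fin sets])
        have "- sin (2 * pi * (k \<bullet> y) + \<theta>) = tpoly [(1, k, \<theta> + pi / 2)] y" for y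
          using minus_sin_cos_eq[of "2 * pi * (k \<bullet> y) + \<theta>"] by (simp add: add.assoc)
        then show "periodic ?s" using periodic_tpoly[of "[(1, k, \<theta> + pi / 2)]"] k pv by (simp add: periodic_def del: tpoly_simps)
        show "continuous_on UNIV ?s" by (intro continuous_intros cv')
      qed
      have "has_bochner_integral \<mu> (\<lambda>y. a * (?s y - 4 * pi\<^sup>2 * (k \<bullet> k) / \<beta> * ?c y)) (a * (integral\<^sup>L \<mu> ?s - 4 * pi\<^sup>2 * (k \<bullet> k) / \<beta> * integral\<^sup>L \<mu> ?c))"
        by (intro has_bochner_integral_mult_right has_bochner_integral_diff has_bochner_integral_integrable ic isin)
      moreover have "integral\<^sup>L \<mu> ?s = 4 * pi\<^sup>2 * (k \<bullet> k) / \<beta> * integral\<^sup>L \<mu> ?c"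
        by (rule stationary_mode[OF \<beta> M F B X eqv law pv cv' k, symmetric])
      ultimately have "has_bochner_integral \<mu> (\<lambda>y. a * (?s y - 4 * pi\<^sup>2 * (k \<bullet> k) / \<beta> * ?c y)) 0" by simp
      from has_bochner_integral_add[OF this Cons.IH[OF L]]
      have *: "has_bochner_integral \<mu> (\<lambda>y. a * (?s y - 4 * pi\<^sup>2 * (k \<bullet> k) / \<beta> * ?c y)
        + (\<Sum>i\<in>UNIV. tpoly (tpoly_partial i (tpoly_partial i L)) y / \<beta> + v y $ i * tpoly (tpoly_partial i L) y)) 0" by simp
      have split: "(\<Sum>i\<in>UNIV. tpoly (tpoly_partial i (tpoly_partial i N)) y / \<beta> + v y $ i * tpoly (tpoly_partial i N) y)
         = (\<Sum>i\<in>UNIV. tpoly (tpoly_partial i (tpoly_partial i N)) y) / \<beta> + (\<Sum>i\<in>UNIV. v y $ i * tpoly (tpoly_partial i N) y)" for N y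
        by (simp add: sum.distrib sum_divide_distrib)
      have cos_shift: "cos (2 * pi * (k \<bullet> y) + (\<theta> + pi / 2)) = - sin (2 * pi * (k \<bullet> y) + \<theta>)" for y
        using minus_sin_cos_eq[of "2 * pi * (k \<bullet> y) + \<theta>"] by (simp add: add.assoc)
      have kv: "(\<Sum>i\<in>UNIV. v y $ i * tpoly (tpoly_partial i (p # L)) y)
         = a * ?s y + (\<Sum>i\<in>UNIV. v y $ i * tpoly (tpoly_partial i L) y)" for y
      proof -
        define S where "S = - sin (2 * pi * (k \<bullet> y) + \<theta>)"
        have cs: "cos (2 * pi * (k \<bullet> y) + (\<theta> + pi / 2)) = S" unfolding S_def by (rule cos_shift)
        have "(\<Sum>i\<in>UNIV. v y $ i * (2 * pi * k $ i * a * S)) = a * (S * (2 * pi * (\<Sum>i\<in>UNIV. k $ i * v y $ i)))"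
          by (simp add: sum_distrib_left mult_ac)
        also have "(\<Sum>i\<in>UNIV. k $ i * v y $ i) = k \<bullet> v y" by (simp add: inner_vec_def)
        finally show ?thesis
          unfolding p S_def[symmetric] tpoly_partial_simps tpoly_simps cs distrib_left sum.distrib by simp
      qed
      have lap: "(\<Sum>i\<in>UNIV. tpoly (tpoly_partial i (tpoly_partial i (p # L))) y)
         = - 4 * pi\<^sup>2 * (k \<bullet> k) * (a * ?c y) + (\<Sum>i\<in>UNIV. tpoly (tpoly_partial i (tpoly_partial i L)) y)" for y
        unfolding tpoly_laplacian p by simp
      have ring: "(- 4 * P * K * (a * C) + l) / \<beta> + (a * S + r) = a * (S - 4 * P * K / \<beta> * C) + (l / \<beta> + r)" for P K C S l r :: real
        by (simp add: add_divide_distrib diff_divide_distrib right_diff_distrib mult.left_commute mult.commute)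
      have "(\<Sum>i\<in>UNIV. tpoly (tpoly_partial i (tpoly_partial i (p # L))) y / \<beta> + v y $ i * tpoly (tpoly_partial i (p # L)) y)
         = a * (?s y - 4 * pi\<^sup>2 * (k \<bullet> k) / \<beta> * ?c y)
          + (\<Sum>i\<in>UNIV. tpoly (tpoly_partial i (tpoly_partial i L)) y / \<beta> + v y $ i * tpoly (tpoly_partial i L) y)" for y
        unfolding split kv lap by (rule ring)
      then show ?case using * by (simp only:)
    qed
    then show "(\<integral>y. (\<Sum>i\<in>UNIV. tpoly (tpoly_partial i (tpoly_partial i L)) y / \<beta> + v y $ i * tpoly (tpoly_partial i L) y) \<partial>\<mu>) = 0"
      by (simp add: has_bochner_integral_iff)
  qed (rule \<beta> prob sets pU cU dU cv)+
  obtain c where c: "c > 0" "\<mu> = density torus (\<lambda>x. ennreal (c * exp (- \<beta> * U x)))"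
    using density_Gibbs by blast
  have "\<bar>U x\<bar> \<le> Linf_norm V + Linf_norm W" for x
  proof -
    have "\<bar>\<integral>y. W (x - y) \<partial>\<mu>\<bar> \<le> (\<integral>y. \<bar>W (x - y)\<bar> \<partial>\<mu>)" by (rule integral_abs_bound)
    also have "\<dots> \<le> (\<integral>y. Linf_norm W \<partial>\<mu>)"
    proof (rule integral_mono)
      show "integrable \<mu> (\<lambda>y. \<bar>W (x - y)\<bar>)"
        by (intro integrable_abs integrable_periodic_continuous[OF fin sets periodic_minus_left[OF pW]])
           (rule continuous_on_compose2[OF cW]; auto intro!: continuous_intros)
      show "integrable \<mu> (\<lambda>y. Linf_norm W)" using fin by (simp add: finite_measure.integrable_const)
    qed (rule abs_le_Linf_norm[OF pW cW])
    also have "\<dots> = Linf_norm W" using prob_space.prob_space[OF prob] by simp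
    finally show ?thesis using abs_le_Linf_norm[OF pV cV, of x] unfolding U_def by linarith
  qed
  then show ?thesis using that[OF c(1) pU cU _ c(2) prob] by blast
qed

section \<open>Holley-Stroock perturbation\<close>

text \<open>Entropy and Fisher information are integrals of nonnegative functions, so exchanging f
  for Haar measure costs A in the first and 1 / a in the second. The entropy must be used in the
  form \<open>entropy_gap\<close> for this, since h ln h changes sign.\<close>

lemma Holley_Stroock_torus:
  fixes f h :: "real ^ 'd \<Rightarrow> real"
  assumes f: "f \<in> borel_measurable torus" "\<And>x. a \<le> f x" "\<And>x. f x \<le> A" "a > 0"
    and h: "h \<in> borel_measurable torus" "\<And>x. 0 \<le> h x"
    and mass: "prob_space (density torus (\<lambda>x. ennreal (f x)))" "prob_space (density (density torus (\<lambda>x. ennreal (f x))) (\<lambda>x. ennreal (h x)))"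
    and lg: "log_gradient h v"
    and fin: "(\<integral>\<^sup>+x. ennreal ((norm (v x))\<^sup>2) \<partial>density (density torus (\<lambda>x. ennreal (f x))) (\<lambda>x. ennreal (h x))) = ennreal J" "0 \<le> J"
  shows "integrable (density (density torus (\<lambda>x. ennreal (f x))) (\<lambda>x. ennreal (h x))) (\<lambda>x. ln (h x))"
    and "(\<integral>x. ln (h x) \<partial>density (density torus (\<lambda>x. ennreal (f x))) (\<lambda>x. ennreal (h x))) \<le> A / a / (8 * pi\<^sup>2) * J"
proof -
  define \<nu> where "\<nu> = density torus (\<lambda>x. ennreal (f x))"
  have fpos: "0 < f x" for x using f(2)[of x] f(4) by linarith
  have A: "A > 0" using fpos[of 0] f(3)[of 0] by linarith
  have vm: "v \<in> borel_measurable torus" and hi: "integrable torus h" using lg by (auto simp: log_gradient_def weak_gradient_def)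
  have hm\<nu>: "h \<in> borel_measurable \<nu>" using h(1) by (simp add: \<nu>_def)
  have nv: "(\<lambda>x. (norm (v x))\<^sup>2) \<in> borel_measurable torus" using vm by measurable
  have J: "ennreal J = (\<integral>\<^sup>+x. ennreal (f x * (h x * (norm (v x))\<^sup>2)) \<partial>torus)"
    unfolding fin(1)[symmetric] using f(1) h nv fpos
    by (simp add: nn_integral_density ennreal_mult' less_imp_le mult.assoc)
  have "ennreal a * (\<integral>\<^sup>+x. ennreal (h x * (norm (v x))\<^sup>2) \<partial>torus) = (\<integral>\<^sup>+x. ennreal (a * (h x * (norm (v x))\<^sup>2)) \<partial>torus)"
    using f(4) h nv by (simp add: nn_integral_cmult[symmetric] ennreal_mult')
  also have "\<dots> \<le> ennreal J"
    unfolding J using f(2) h(2) by (intro nn_integral_mono ennreal_leI mult_right_mono) auto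
  finally have aJ: "ennreal a * (\<integral>\<^sup>+x. ennreal (h x * (norm (v x))\<^sup>2) \<partial>torus) \<le> ennreal J" .
  then have "(\<integral>\<^sup>+x. ennreal (h x * (norm (v x))\<^sup>2) \<partial>torus) < \<infinity>"
    using f(4) by (auto simp: ennreal_mult_eq_top_iff less_top[symmetric] top_unique)
  then have iF: "integrable torus (\<lambda>x. h x * (norm (v x))\<^sup>2)"
    using h nv by (intro integrableI_nonneg) auto
  define I where "I = (\<integral>x. h x * (norm (v x))\<^sup>2 \<partial>torus)"
  have I0: "0 \<le> I" using h(2) by (simp add: I_def)
  have aI: "a * I \<le> J"
  proof -
    have "(\<integral>\<^sup>+x. ennreal (h x * (norm (v x))\<^sup>2) \<partial>torus) = ennreal I"
      unfolding I_def by (rule nn_integral_eq_integral[OF iF]) (use h in auto)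
    then show ?thesis using aJ fin(2) f(4) by (simp add: ennreal_mult'[symmetric] less_imp_le)
  qed
  have one: "(\<integral>\<^sup>+x. ennreal (h x) \<partial>\<nu>) = 1"
    using prob_space.emeasure_space_1[OF mass(2)] hm\<nu> unfolding \<nu>_def[symmetric]
    by (subst (asm) emeasure_density) (auto intro!: nn_integral_cong simp: indicator_def cong: nn_integral_cong_simp)
  have h\<nu>: "integrable \<nu> h" "integral\<^sup>L \<nu> h = 1"
    using one hm\<nu> h(2) by (auto intro!: integrableI_nonneg simp: integral_eq_nn_integral)
  \<comment> \<open>The mass of h under Haar measure, in general different from its mass 1 under
    \<nu>.\<close>
  define m where "m = integral\<^sup>L torus h"
  have m: "m > 0"
  proof -
    have "1 = (\<integral>x. f x * h x \<partial>torus)"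
      using h\<nu>(2) f(1) h(1) fpos unfolding \<nu>_def by (subst (asm) integral_density) (auto simp: less_imp_le)
    also have "\<dots> \<le> (\<integral>x. A * h x \<partial>torus)"
    proof (rule integral_mono)
      have "integrable \<nu> h \<longleftrightarrow> integrable torus (\<lambda>x. f x * h x)"
        unfolding \<nu>_def using f(1) h(1) fpos by (subst integrable_density) (auto simp: less_imp_le)
      then show "integrable torus (\<lambda>x. f x * h x)" using h\<nu>(1) by simp
    qed (use hi f(3) h(2) in \<open>auto intro: mult_right_mono\<close>)
    finally have "1 \<le> A * m" by (simp add: m_def)
    then show ?thesis using A by (smt (verit) mult_nonneg_nonpos)
  qed
  have em: "(\<lambda>x. entropy_gap m (h x)) \<in> borel_measurable torus"
    unfolding entropy_gap_def using h(1) by measurable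
  have em\<nu>: "(\<lambda>x. entropy_gap m (h x)) \<in> borel_measurable \<nu>" using em by (simp add: \<nu>_def)
  have e0: "0 \<le> entropy_gap m (h x)" for x by (rule entropy_gap_nonneg[OF m h(2)])
  have "(\<integral>\<^sup>+x. ennreal (entropy_gap m (h x)) \<partial>\<nu>) = (\<integral>\<^sup>+x. ennreal (f x) * ennreal (entropy_gap m (h x)) \<partial>torus)"
    unfolding \<nu>_def using f(1) em by (simp add: nn_integral_density)
  also have "\<dots> \<le> (\<integral>\<^sup>+x. ennreal A * ennreal (entropy_gap m (h x)) \<partial>torus)"
    using f(3) by (intro nn_integral_mono mult_right_mono ennreal_leI) auto
  also have "\<dots> = ennreal A * (\<integral>\<^sup>+x. ennreal (entropy_gap m (h x)) \<partial>torus)"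
    using em by (simp add: nn_integral_cmult)
  also have "\<dots> \<le> ennreal A * ennreal (I / (8 * pi\<^sup>2))"
    unfolding m_def I_def
    by (intro mult_left_mono torus_log_Sobolev[OF h(2) _ lg iF]) (use m in \<open>auto simp: m_def\<close>)
  also have "\<dots> = ennreal (A * (I / (8 * pi\<^sup>2)))" using A I0 by (intro ennreal_mult[symmetric]) auto
  finally have le: "(\<integral>\<^sup>+x. ennreal (entropy_gap m (h x)) \<partial>\<nu>) \<le> ennreal (A * (I / (8 * pi\<^sup>2)))" .
  then have "(\<integral>\<^sup>+x. ennreal (entropy_gap m (h x)) \<partial>\<nu>) < \<infinity>" by (rule order.strict_trans1) simp
  then have ie: "integrable \<nu> (\<lambda>x. entropy_gap m (h x))"
    using em\<nu> e0 by (intro integrableI_nonneg) auto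
  have ent: "(\<integral>x. entropy_gap m (h x) \<partial>\<nu>) \<le> A * (I / (8 * pi\<^sup>2))"
    using le nn_integral_eq_integral[OF ie] e0 A I0 by simp
  have hln: "h x * ln (h x) = entropy_gap m (h x) + ln m * h x + h x - m" for x
    using m h(2)[of x] by (cases "h x = 0") (auto simp: entropy_gap_def ln_div algebra_simps)
  have i\<nu>m: "integrable \<nu> (\<lambda>_. m)"
    using mass(1) by (simp add: \<nu>_def[symmetric] prob_space.finite_measure finite_measure.integrable_const)
  have ihln: "integrable \<nu> (\<lambda>x. h x * ln (h x))"
    unfolding hln using ie h\<nu>(1) i\<nu>m by simp
  show int: "integrable (density (density torus (\<lambda>x. ennreal (f x))) (\<lambda>x. ennreal (h x))) (\<lambda>x. ln (h x))"
    unfolding \<nu>_def[symmetric] using ihln hm\<nu> h(2) by (subst integrable_density) auto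
  have "(\<integral>x. ln (h x) \<partial>density \<nu> (\<lambda>x. ennreal (h x))) = (\<integral>x. h x * ln (h x) \<partial>\<nu>)"
    using hm\<nu> h(2) by (subst integral_density) auto
  also have "\<dots> = (\<integral>x. entropy_gap m (h x) \<partial>\<nu>) + ln m + 1 - m"
    unfolding hln using ie h\<nu> i\<nu>m prob_space.prob_space[OF mass(1)] by (simp add: \<nu>_def[symmetric])
  \<comment> \<open>Centring the entropy at a value m other than the mean 1 can only increase it, as
    ln m \<le> m - 1.\<close>
  also have "\<dots> \<le> (\<integral>x. entropy_gap m (h x) \<partial>\<nu>)" using ln_le_minus_one[OF m] by simp
  also have "\<dots> \<le> A * (I / (8 * pi\<^sup>2))" by (rule ent)
  also have "\<dots> \<le> A * (J / a / (8 * pi\<^sup>2))"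
    using aI f(4) A by (intro mult_left_mono divide_right_mono) (auto simp: field_simps)
  finally show "(\<integral>x. ln (h x) \<partial>density (density torus (\<lambda>x. ennreal (f x))) (\<lambda>x. ennreal (h x))) \<le> A / a / (8 * pi\<^sup>2) * J"
    unfolding \<nu>_def by simp
qed

text \<open>A quarter of c / (2 pi^2) is c / (8 pi^2), the Haar constant times c. The Fisher
  information is an infimum, so the bound is shown for each logarithmic gradient separately.\<close>

lemma satisfies_LSI_density:
  fixes f :: "real ^ 'd \<Rightarrow> real"
  assumes f: "f \<in> borel_measurable torus" "\<And>x. a \<le> f x" "\<And>x. f x \<le> A" "a > 0"
    and prob: "prob_space (density torus (\<lambda>x. ennreal (f x)))"
    and le: "A / a \<le> c"
  shows "satisfies_LSI (density torus (\<lambda>x. ennreal (f x))) (c / (2 * pi\<^sup>2))"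
proof -
  define \<nu> where "\<nu> = density torus (\<lambda>x. ennreal (f x))"
  interpret \<nu>: prob_space \<nu> unfolding \<nu>_def by (rule prob)
  have Aa: "0 < A / a" using f(2)[of 0] f(3)[of 0] f(4) by (intro divide_pos_pos) linarith+
  then have c: "0 < c" using le by linarith
  have "relative_entropy \<mu> \<nu> \<le> ereal (c / (2 * pi\<^sup>2) / 4) * enn2ereal (fisher_information \<mu> \<nu>)"
    if \<mu>: "prob_space \<mu>" "sets \<mu> = sets \<nu>" "absolutely_continuous \<nu> \<mu>" for \<mu>
  proof (cases "fisher_information \<mu> \<nu> = \<infinity>")
    case True
    then show ?thesis using c by simp
  next
    case False
    define h where "h x = enn2real (RN_deriv \<nu> \<mu> x)" for x
    have RN: "density \<nu> (RN_deriv \<nu> \<mu>) = \<mu>" by (rule \<nu>.density_RN_deriv[OF \<mu>(3,2)])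
    interpret \<mu>: prob_space \<mu> by (rule \<mu>(1))
    have "AE x in \<nu>. RN_deriv \<nu> \<mu> x \<noteq> \<infinity>"
      by (rule \<nu>.RN_deriv_finite[OF \<mu>.sigma_finite_measure_axioms \<mu>(3,2)])
    then have "AE x in \<nu>. RN_deriv \<nu> \<mu> x = ennreal (h x)"
      by eventually_elim (simp add: h_def less_top)
    then have "density \<nu> (RN_deriv \<nu> \<mu>) = density \<nu> (\<lambda>x. ennreal (h x))"
      by (intro density_cong) (auto simp: h_def)
    then have \<mu>_eq: "\<mu> = density \<nu> (\<lambda>x. ennreal (h x))" using RN by simp
    have hm: "h \<in> borel_measurable torus"
    proof -
      have "h \<in> borel_measurable \<nu>" unfolding h_def by measurable
      then show ?thesis by (simp add: \<nu>_def)
    qed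
    have h0: "0 \<le> h x" for x by (simp add: h_def)
    have HS: "integrable \<mu> (\<lambda>x. ln (h x))" "(\<integral>x. ln (h x) \<partial>\<mu>) \<le> A / a / (8 * pi\<^sup>2) * J"
      if "log_gradient h v" "(\<integral>\<^sup>+x. ennreal ((norm (v x))\<^sup>2) \<partial>\<mu>) = ennreal J" "0 \<le> J" for v J
      using Holley_Stroock_torus[OF f hm h0 prob _ that(1) _ that(3)] \<mu>(1) that(2)
      unfolding \<nu>_def[symmetric] \<mu>_eq[symmetric] by auto
    have fi: "fisher_information \<mu> \<nu> = (INF v \<in> {v. log_gradient h v}. \<integral>\<^sup>+ x. ennreal ((norm (v x))\<^sup>2) \<partial>\<mu>)"
      unfolding fisher_information_def h_def ..
    \<comment> \<open>One logarithmic gradient of finite energy is enough to make ln h integrable,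
      so that \<open>relative_entropy\<close> takes its finite branch.\<close>
    obtain v0 where v0: "log_gradient h v0" "(\<integral>\<^sup>+ x. ennreal ((norm (v0 x))\<^sup>2) \<partial>\<mu>) \<noteq> \<infinity>"
    proof -
      have "\<not> (\<forall>v\<in>{v. log_gradient h v}. \<infinity> \<le> (\<integral>\<^sup>+ x. ennreal ((norm (v x))\<^sup>2) \<partial>\<mu>))"
      proof
        assume "\<forall>v\<in>{v. log_gradient h v}. \<infinity> \<le> (\<integral>\<^sup>+ x. ennreal ((norm (v x))\<^sup>2) \<partial>\<mu>)"
        then have "\<infinity> \<le> fisher_information \<mu> \<nu>" unfolding fi by (intro INF_greatest) auto
        then show False using False by (simp add: top_unique)
      qed
      then show ?thesis using that by auto
    qed
    define R where "R = (\<integral>x. ln (h x) \<partial>\<mu>)"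
    have int: "integrable \<mu> (\<lambda>x. ln (h x))"
      by (rule HS(1)[OF v0(1), of "enn2real (\<integral>\<^sup>+ x. ennreal ((norm (v0 x))\<^sup>2) \<partial>\<mu>)"]) (use v0(2) in \<open>auto simp: less_top\<close>)
    have rel: "relative_entropy \<mu> \<nu> = ereal R"
      using int unfolding relative_entropy_def h_def R_def by simp
    define C where "C = c / (8 * pi\<^sup>2)"
    have C: "C > 0" using c by (simp add: C_def)
    \<comment> \<open>A negative quotient would be truncated to 0 here; the conclusion R / C \<le> t
      is not affected, as t \<ge> 0.\<close>
    have "ennreal (R / C) \<le> fisher_information \<mu> \<nu>"
      unfolding fi
    proof (rule INF_greatest)
      fix v assume "v \<in> {v. log_gradient h v}"
      then have v: "log_gradient h v" by simp
      show "ennreal (R / C) \<le> (\<integral>\<^sup>+ x. ennreal ((norm (v x))\<^sup>2) \<partial>\<mu>)"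
      proof (cases "\<integral>\<^sup>+ x. ennreal ((norm (v x))\<^sup>2) \<partial>\<mu>")
        case (real J)
        have "R \<le> A / a / (8 * pi\<^sup>2) * J" unfolding R_def by (rule HS(2)[OF v real(2,1)])
        also have "\<dots> \<le> C * J" unfolding C_def using le real(1) by (intro mult_right_mono divide_right_mono) auto
        finally have "R / C \<le> J" using C by (simp add: field_simps)
        then show ?thesis using real by (simp add: ennreal_leI)
      qed simp
    qed
    moreover obtain t where t: "fisher_information \<mu> \<nu> = ennreal t" "0 \<le> t"
      using False by (cases "fisher_information \<mu> \<nu>") auto
    ultimately have "R / C \<le> t" by simp
    then have "R \<le> C * t" using C by (simp add: field_simps)
    then show ?thesis unfolding rel t(1) using t(2) by (simp add: C_def enn2ereal_ennreal)
  qed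
  then show ?thesis using c unfolding satisfies_LSI_def \<nu>_def[symmetric] by simp
qed

theorem lemma2p12:
  fixes \<beta> :: real and V W :: "real ^ 'd \<Rightarrow> real" and \<mu> :: "(real ^ 'd) measure" and \<Gamma> :: real
  assumes "\<beta> > 0"
    and "torus_Ck 2 V" and "torus_Ck 2 W"
    and "\<forall>x. W (- x) = W x"
    and "H_stable W \<or> Linf_norm W < 1 / \<beta>"
    and "mckean_invariant_measure TYPE('w) \<beta> V W \<mu>"
    and "\<Gamma> = exp (2 * \<beta> * (Linf_norm V + Linf_norm W))"
  shows "satisfies_LSI \<mu> (\<Gamma> / (2 * pi\<^sup>2))"
proof -
  define N where "N = Linf_norm V + Linf_norm W"
  obtain c U where c: "c > 0" and U: "periodic U" "continuous_on UNIV U" "\<And>x. \<bar>U x\<bar> \<le> N"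
    and \<mu>: "\<mu> = density torus (\<lambda>x. ennreal (c * exp (- \<beta> * U x)))" and prob: "prob_space \<mu>"
    using mckean_invariant_measure_Gibbs[OF assms(1,2,3,6)] unfolding N_def by metis
  have bound: "\<bar>\<beta> * U x\<bar> \<le> \<beta> * N" for x using assms(1) U(3)[of x] by (simp add: abs_mult)
  show ?thesis
    unfolding \<mu>
  \<comment> \<open>The unknown normalising factor c cancels in the quotient of the two bounds,
    leaving exp (2 \<beta> N).\<close>
  proof (rule satisfies_LSI_density[where a="c * exp (- (\<beta> * N))" and A="c * exp (\<beta> * N)"])
    show "(\<lambda>x. c * exp (- \<beta> * U x)) \<in> borel_measurable torus"
      by (rule measurable_torus_continuous) (intro continuous_intros U)
    show "c * exp (- (\<beta> * N)) \<le> c * exp (- \<beta> * U x)" "c * exp (- \<beta> * U x) \<le> c * exp (\<beta> * N)" for x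
      using c bound[of x] by (auto simp: abs_le_iff)
    show "0 < c * exp (- (\<beta> * N))" using c by simp
    show "prob_space (density torus (\<lambda>x. ennreal (c * exp (- \<beta> * U x))))" using prob unfolding \<mu> .
    show "c * exp (\<beta> * N) / (c * exp (- (\<beta> * N))) \<le> \<Gamma>"
    proof -
      have "c * exp (\<beta> * N) / (c * exp (- (\<beta> * N))) = exp (\<beta> * N + \<beta> * N)"
        unfolding exp_add using c by (simp add: exp_minus divide_inverse)
      also have "\<dots> = \<Gamma>" unfolding assms(7) N_def[symmetric] by (simp add: algebra_simps)
      finally show ?thesis by simp
    qed
  qed
qed

end
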